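(* Let $\Omega\subset\mathbb{R}^2$ be a smooth bounded domain which is symmetric with respect to some line $H$. Then there exists $p_0$ such that for all $p>p_0$, the minimizers of $\Lambda_p(\Omega)=\inf_{u\in H_{za}(\Omega)\setminus\{0\}}\frac{\|\nabla u\|_2^2}{\|u\|_p^2}$ are not antisymmetric with respect to the reflection at $H$.
   Context: $H_{za}(\Omega)=\{u\in H^1(\Omega):\int_\Omega u=0\}$ with norm $\|\nabla u\|_2$. *)

theory Defs
  imports "HOL-Analysis.Analysis"
begin

type_synonym R2 = "real ^ 2"

fun Ck_on :: "nat \<Rightarrow> R2 set \<Rightarrow> (R2 \<Rightarrow> real) \<Rightarrow> bool" where
  "Ck_on 0 S f = continuous_on S f"
| "Ck_on (Suc k) S f = (f differentiable_on S \<and> continuous_on S f \<and>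
      (\<forall>v. Ck_on k S (\<lambda>x. frechet_derivative f (at x) v)))"

definition smooth_on :: "R2 set \<Rightarrow> (R2 \<Rightarrow> real) \<Rightarrow> bool" where
  "smooth_on S f \<longleftrightarrow> (\<forall>k. Ck_on k S f)"

definition smooth_bounded_domain :: "R2 set \<Rightarrow> bool" where
  "smooth_bounded_domain \<Omega> \<longleftrightarrow> open \<Omega> \<and> connected \<Omega> \<and> bounded \<Omega> \<and> \<Omega> \<noteq> {} \<and>
     (\<exists>\<rho>. smooth_on UNIV \<rho> \<and> \<Omega> = {x. \<rho> x < 0} \<and>
        (\<forall>x. \<rho> x = 0 \<longrightarrow> frechet_derivative \<rho> (at x) \<noteq> (\<lambda>v. 0)))"

text \<open>Reflection at the line H = {x. (x - a) . n = 0}, with unit normal n.\<close>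
definition reflection :: "R2 \<Rightarrow> R2 \<Rightarrow> R2 \<Rightarrow> R2" where
  "reflection a n x = x - (2 * ((x - a) \<bullet> n)) *\<^sub>R n"

definition test_function :: "R2 set \<Rightarrow> (R2 \<Rightarrow> real) \<Rightarrow> bool" where
  "test_function \<Omega> \<phi> \<longleftrightarrow> smooth_on UNIV \<phi> \<and> compact (closure {x. \<phi> x \<noteq> 0})
      \<and> closure {x. \<phi> x \<noteq> 0} \<subseteq> \<Omega>"

definition weak_gradient :: "R2 set \<Rightarrow> (R2 \<Rightarrow> real) \<Rightarrow> (R2 \<Rightarrow> R2) \<Rightarrow> bool" where
  "weak_gradient \<Omega> u g \<longleftrightarrow>
     (\<forall>i. integrable (lebesgue_on \<Omega>) (\<lambda>x. (g x $ i)\<^sup>2)) \<and> g \<in> borel_measurable (lebesgue_on \<Omega>) \<and>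
     (\<forall>\<phi>. test_function \<Omega> \<phi> \<longrightarrow> (\<forall>i.
        (\<integral>x. u x * frechet_derivative \<phi> (at x) (axis i 1) \<partial>lebesgue_on \<Omega>)
          = - (\<integral>x. (g x $ i) * \<phi> x \<partial>lebesgue_on \<Omega>)))"

definition H1 :: "R2 set \<Rightarrow> (R2 \<Rightarrow> real) set" where
  "H1 \<Omega> = {u. u \<in> borel_measurable (lebesgue_on \<Omega>) \<and>
              integrable (lebesgue_on \<Omega>) (\<lambda>x. (u x)\<^sup>2) \<and> (\<exists>g. weak_gradient \<Omega> u g)}"

definition Hza :: "R2 set \<Rightarrow> (R2 \<Rightarrow> real) set" where
  "Hza \<Omega> = {u \<in> H1 \<Omega>. integrable (lebesgue_on \<Omega>) u \<and> (\<integral>x. u x \<partial>lebesgue_on \<Omega>) = 0}"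

text \<open>||grad u||_2^2 (the weak gradient is unique a.e., so the choice does not matter).\<close>
definition grad_norm_sq :: "R2 set \<Rightarrow> (R2 \<Rightarrow> real) \<Rightarrow> real" where
  "grad_norm_sq \<Omega> u = (\<integral>x. (norm ((SOME g. weak_gradient \<Omega> u g) x))\<^sup>2 \<partial>lebesgue_on \<Omega>)"

definition Lp_norm :: "real \<Rightarrow> R2 set \<Rightarrow> (R2 \<Rightarrow> real) \<Rightarrow> real" where
  "Lp_norm p \<Omega> u = (\<integral>x. \<bar>u x\<bar> powr p \<partial>lebesgue_on \<Omega>) powr (1 / p)"

definition Hza_nonzero :: "R2 set \<Rightarrow> (R2 \<Rightarrow> real) set" where
  "Hza_nonzero \<Omega> = {u \<in> Hza \<Omega>. \<not> (AE x in lebesgue_on \<Omega>. u x = 0)}"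

definition Lambda_p :: "real \<Rightarrow> R2 set \<Rightarrow> real" where
  "Lambda_p p \<Omega> = (INF u \<in> Hza_nonzero \<Omega>. grad_norm_sq \<Omega> u / (Lp_norm p \<Omega> u)\<^sup>2)"

definition is_minimizer :: "real \<Rightarrow> R2 set \<Rightarrow> (R2 \<Rightarrow> real) \<Rightarrow> bool" where
  "is_minimizer p \<Omega> u \<longleftrightarrow> u \<in> Hza_nonzero \<Omega> \<and>
     grad_norm_sq \<Omega> u / (Lp_norm p \<Omega> u)\<^sup>2 = Lambda_p p \<Omega>"

definition antisymmetric_wrt :: "R2 set \<Rightarrow> (R2 \<Rightarrow> R2) \<Rightarrow> (R2 \<Rightarrow> real) \<Rightarrow> bool" where
  "antisymmetric_wrt \<Omega> R u \<longleftrightarrow> (AE x in lebesgue_on \<Omega>. u (R x) = - u x)"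

end

theory Submission
  imports Defs "HOL-Real_Asymp.Real_Asymp"
begin

text \<open>
  Let \<open>u\<close> be antisymmetric and let \<open>w\<close> be the restriction of \<open>u\<close> to one side of the axis, extended by zero
  and made mean-free. Choosing the better side, \<open>w\<close> has at most half the Dirichlet energy of \<open>u\<close>, while
  \<open>\<parallel>w\<parallel>\<^sub>p\<close> is close to \<open>2 powr (-1/p) * \<parallel>u\<parallel>\<^sub>p\<close> as soon as the subtracted mean is small compared to \<open>\<parallel>u\<parallel>\<^sub>p\<close>.
  By the Poincare inequality the mean is controlled by \<open>\<parallel>\<nabla>u\<parallel>\<^sub>2\<close>, and for a minimizer this is
  \<open>sqrt \<Lambda>\<^sub>p * \<parallel>u\<parallel>\<^sub>p\<close> with \<open>\<Lambda>\<^sub>p \<longlongrightarrow> 0\<close>, because a point has zero capacity in the plane. Hence the quotient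
  of \<open>w\<close> beats that of \<open>u\<close> for large \<open>p\<close>.

  The embedding of \<open>H\<^sup>1\<close> into all \<open>L\<^sup>p\<close> is really needed: a function with \<open>\<bar>u\<bar> powr p\<close> not integrable would have
  \<open>Lp_norm\<close> equal to \<open>0\<close>, hence quotient \<open>x / 0 = 0\<close>. It is obtained, together with the Poincare inequality, by
  telescoping mollified values along dyadic bumps inside an interior cone; differences of bumps are divergences
  of compactly supported fields, so only the definition of the weak gradient is used.
\<close>

section \<open>Smooth functions and bumps\<close>

text \<open>The competitor gains a factor 2 in the energy but loses only about
  \<open>2 powr (2/p)\<close> in the squared norm. For a minimizer the gain would force
  \<open>\<parallel>w\<parallel>\<^sub>p powr p \<le> 2 powr (-p/2) *
  \<parallel>u\<parallel>\<^sub>p powr p\<close>, whereas cutting leaves about one half of this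
  integral, so the two bounds separate as \<open>p\<close> grows. The obstacle is analytic: a
  function of \<open>Hza\<close> is known only through integration by parts against compactly
  supported smooth functions, and the domain only through a defining function \<open>\<rho>\<close>
  with nonvanishing derivative. The cone comes from the sign of one partial derivative of
  \<open>\<rho>\<close>, without straightening the boundary; neither density of smooth functions nor
  extension operators enter. In two dimensions the increments of the telescope have a bound
  independent of the scale and decay geometrically in \<open>L\<^sup>2\<close>; interpolation
  between the two reaches every even exponent.\<close>

fun C1k :: "nat \<Rightarrow> (real \<Rightarrow> real) \<Rightarrow> bool" where
  "C1k 0 f = continuous_on UNIV f"
| "C1k (Suc k) f = (\<exists>f'. (\<forall>x. (f has_real_derivative f' x) (at x)) \<and> C1k k f')"

text \<open>The derivative inside \<open>C1k\<close> is existentially quantified, so closure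
  properties are proved by exhibiting a witness. Bumps and the cutoff across the axis are built in
  one variable and carried to the plane by inner products, where \<open>Ck_on\<close> asks for every
  directional derivative.\<close>

definition smooth1 :: "(real \<Rightarrow> real) \<Rightarrow> bool" where
  "smooth1 f \<longleftrightarrow> (\<forall>k. C1k k f)"

lemma C1k_continuous: "C1k k f \<Longrightarrow> continuous_on UNIV f"
  by (cases k) (auto, metis DERIV_isCont continuous_at_imp_continuous_on)

lemma C1k_SucD: "C1k (Suc k) f \<Longrightarrow> C1k k f"
proof (induction k arbitrary: f)
  case 0 then show ?case using C1k_continuous[OF 0] by simp
next
  case (Suc k) then show ?case by (metis C1k.simps(2))
qed

lemma C1k_const: "C1k k (\<lambda>x. c)"
proof (induction k arbitrary: c)
  case (Suc k) 
  have "\<forall>x. ((\<lambda>x. c) has_real_derivative (\<lambda>x. 0) x) (at x)" by simp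
  then show ?case using Suc[of 0] by (metis C1k.simps(2))
qed simp

lemma C1k_add: "C1k k f \<Longrightarrow> C1k k g \<Longrightarrow> C1k k (\<lambda>x. f x + g x)"
proof (induction k arbitrary: f g)
  case (Suc k)
  then obtain f' g' where "\<forall>x. (f has_real_derivative f' x) (at x)" "C1k k f'"
      "\<forall>x. (g has_real_derivative g' x) (at x)" "C1k k g'" by auto
  then show ?case using Suc.IH[of f' g']
    by (auto intro!: exI[of _ "\<lambda>x. f' x + g' x"] derivative_intros)
qed (auto intro: continuous_intros)

lemma C1k_mult: "C1k k f \<Longrightarrow> C1k k g \<Longrightarrow> C1k k (\<lambda>x. f x * g x)"
proof (induction k arbitrary: f g)
  case (Suc k)
  then obtain f' g' where *: "\<forall>x. (f has_real_derivative f' x) (at x)" "C1k k f'"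
      "\<forall>x. (g has_real_derivative g' x) (at x)" "C1k k g'" by auto
  have "C1k k (\<lambda>x. f' x * g x + g' x * f x)"
    using * Suc C1k_SucD by (intro C1k_add Suc.IH) auto
  then show ?case using *
    by (auto intro!: exI[of _ "\<lambda>x. f' x * g x + g' x * f x"] derivative_intros)
qed (auto intro: continuous_intros)

lemma C1k_inverse:
  assumes "C1k k f" "\<And>x. f x \<noteq> 0" shows "C1k k (\<lambda>x. inverse (f x))"
  using assms
proof (induction k arbitrary: f)
  case (Suc k)
  then obtain f' where *: "\<forall>x. (f has_real_derivative f' x) (at x)" "C1k k f'" by auto
  have i: "C1k k (\<lambda>x. inverse (f x))" using Suc C1k_SucD by blast
  have "C1k k (\<lambda>x. (-1) * (inverse (f x) * (f' x * inverse (f x))))"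
    by (intro C1k_mult i *(2) C1k_const)
  moreover have "((\<lambda>x. inverse (f x)) has_real_derivative (-1) * (inverse (f x) * (f' x * inverse (f x)))) (at x)" for x
    using DERIV_inverse'[OF *(1)[rule_format, of x] Suc.prems(2)] by (simp add: mult.assoc)
  ultimately show ?case
    by (auto intro!: exI[of _ "\<lambda>x. (-1) * (inverse (f x) * (f' x * inverse (f x)))"])
qed (auto intro: continuous_intros)

lemma C1k_affine: "C1k k f \<Longrightarrow> C1k k (\<lambda>x. f (a * x + b))"
proof (induction k arbitrary: f)
  case 0
  then show ?case by (auto intro!: continuous_on_compose2[of UNIV f] continuous_intros)
next
  case (Suc k)
  then obtain f' where *: "\<forall>x. (f has_real_derivative f' x) (at x)" "C1k k f'" by auto
  have "C1k k (\<lambda>x. f' (a * x + b) * a)" by (intro C1k_mult C1k_const Suc.IH *)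
  moreover have "((\<lambda>x. f (a * x + b)) has_real_derivative f' (a * x + b) * a) (at x)" for x
    by (rule DERIV_chain2[OF *(1)[rule_format]]) (auto intro!: derivative_eq_intros)
  ultimately show ?case
    by (auto intro!: exI[of _ "\<lambda>x. f' (a * x + b) * a"])
qed

lemma smooth1_const: "smooth1 (\<lambda>x. c)" by (simp add: smooth1_def C1k_const)
lemma smooth1_add: "smooth1 f \<Longrightarrow> smooth1 g \<Longrightarrow> smooth1 (\<lambda>x. f x + g x)" by (simp add: smooth1_def C1k_add)
lemma smooth1_mult: "smooth1 f \<Longrightarrow> smooth1 g \<Longrightarrow> smooth1 (\<lambda>x. f x * g x)" by (simp add: smooth1_def C1k_mult)
lemma smooth1_inverse: "smooth1 f \<Longrightarrow> (\<And>x. f x \<noteq> 0) \<Longrightarrow> smooth1 (\<lambda>x. inverse (f x))" by (simp add: smooth1_def C1k_inverse)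
lemma smooth1_affine: "smooth1 f \<Longrightarrow> smooth1 (\<lambda>x. f (a * x + b))" by (simp add: smooth1_def C1k_affine)

lemma smooth1_diff: "smooth1 f \<Longrightarrow> smooth1 g \<Longrightarrow> smooth1 (\<lambda>x. f x - g x)"
  using smooth1_add[OF _ smooth1_mult[OF smooth1_const[of "-1"]], of f g] by simp

text \<open>The derivative witnesses at different orders \<open>k\<close> are a priori unrelated;
  uniqueness of derivatives identifies them, so a single \<open>f'\<close> is smooth of every
  order.\<close>

lemma smooth1_derivE:
  assumes "smooth1 f"
  obtains f' where "\<And>x. (f has_real_derivative f' x) (at x)" "smooth1 f'"
proof -
  from assms have "C1k (Suc 0) f" unfolding smooth1_def by blast
  then obtain f' where f': "\<And>x. (f has_real_derivative f' x) (at x)" by auto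
  have "C1k k f'" for k
  proof -
    obtain f'' where "\<And>x. (f has_real_derivative f'' x) (at x)" "C1k k f''"
      using assms unfolding smooth1_def by (metis C1k.simps(2))
    moreover have "f'' = f'" using f' calculation(1) by (blast intro: DERIV_unique)
    ultimately show ?thesis by simp
  qed
  with f' that show ?thesis by (auto simp: smooth1_def)
qed

lemma smooth1_from_deriv:
  assumes "\<And>x. (f has_real_derivative f' x) (at x)" "smooth1 f'"
  shows "smooth1 f"
proof -
  have "C1k k f" for k
  proof (cases k)
    case 0 then show ?thesis using assms(1) by (auto intro!: DERIV_isCont continuous_at_imp_continuous_on)
  next
    case (Suc j) then show ?thesis using assms unfolding smooth1_def by auto
  qed
  then show ?thesis by (simp add: smooth1_def)
qed

lemma smooth1_continuous: "smooth1 f \<Longrightarrow> continuous_on S f"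
  unfolding smooth1_def using C1k_continuous continuous_on_subset by blast

lemma smooth1_ident: "smooth1 (\<lambda>x. x)"
  by (rule smooth1_from_deriv[OF _ smooth1_const[of 1]]) auto

lemma smooth1_arctan: "smooth1 arctan"
proof (rule smooth1_from_deriv[OF DERIV_arctan smooth1_inverse])
  show "smooth1 (\<lambda>x. 1 + x\<^sup>2)"
    using smooth1_add[OF smooth1_const[of 1] smooth1_mult[OF smooth1_ident smooth1_ident]]
    by (simp add: power2_eq_square)
qed (metis add_pos_nonneg less_irrefl zero_le_power2 zero_less_one)

text \<open>The polynomial in \<open>1/x\<close> makes the family closed under differentiation, so
  smoothness of all its members is one induction over the order.\<close>

definition flat_exp :: "real poly \<Rightarrow> real \<Rightarrow> real" where
  "flat_exp p x = (if x > 0 then poly p (1/x) * exp (-(1/x)) else 0)"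

lemma poly_exp_tendsto_0:
  "((\<lambda>t. poly p t * exp (-t)) \<longlongrightarrow> 0) (at_top :: real filter)"
proof (induction p)
  case (pCons a p)
  have "((\<lambda>t. t ^ i * exp (-t)) \<longlongrightarrow> 0) (at_top :: real filter)" for i
    using tendsto_power_div_exp_0[of i] by (simp add: exp_minus divide_inverse)
  note mon = this
  have "((\<lambda>t. \<Sum>i\<le>degree (pCons a p). coeff (pCons a p) i * (t ^ i * exp (-t))) \<longlongrightarrow> (\<Sum>i\<le>degree (pCons a p). coeff (pCons a p) i * 0)) (at_top :: real filter)"
    by (intro tendsto_intros mon)
  then show ?case by (simp add: poly_altdef sum_distrib_right mult.assoc)
qed simp

text \<open>With \<open>t = 1/x\<close>, differentiation in \<open>x\<close> is
  \<open>- t * t\<close> times differentiation in \<open>t\<close>, and the latter turns the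
  polynomial \<open>p\<close> into \<open>pderiv p - p\<close>; this explains the factor
  \<open>[:0,0,1:]\<close>. At 0 the difference quotient is again of the form
  \<open>t * poly p t * exp (-t)\<close>, which vanishes as \<open>t\<close> grows.\<close>

lemma flat_exp_DERIV:
  "(flat_exp p has_real_derivative flat_exp ([:0,0,1:] * (p - pderiv p)) x) (at x)"
proof -
  consider "x > 0" | "x < 0" | "x = 0" by linarith
  then show ?thesis
  proof cases
    case 1
    have i: "((\<lambda>x. 1/x) has_real_derivative - ((1/x) * (1/x))) (at x)"
      using 1 by (auto intro!: derivative_eq_intros simp: power2_eq_square)
    have e: "((\<lambda>x. exp (-(1/x))) has_real_derivative exp (-(1/x)) * ((1/x) * (1/x))) (at x)"
      using DERIV_chain2[OF DERIV_exp DERIV_minus[OF i]] by simp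
    have "((\<lambda>x. poly p (1/x) * exp (-(1/x))) has_real_derivative
        poly (pderiv p) (1/x) * (- ((1/x) * (1/x))) * exp (-(1/x)) + exp (-(1/x)) * ((1/x) * (1/x)) * poly p (1/x)) (at x)"
      by (rule DERIV_mult'[THEN DERIV_cong, OF DERIV_chain2[OF poly_DERIV i] e]) simp
    then have "((\<lambda>x. poly p (1/x) * exp (-(1/x))) has_real_derivative flat_exp ([:0,0,1:] * (p - pderiv p)) x) (at x)"
      by (rule DERIV_cong) (use 1 in \<open>simp add: flat_exp_def algebra_simps\<close>)
    moreover have "\<forall>\<^sub>F y in nhds x. flat_exp p y = poly p (1/y) * exp (-(1/y))"
      using 1 eventually_nhds_in_open[of "{0<..}" x] by (auto elim!: eventually_mono simp: flat_exp_def)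
    ultimately show ?thesis using DERIV_cong_ev[OF refl _ refl] by fast
  next
    case 2
    have "\<forall>\<^sub>F y in nhds x. flat_exp p y = 0"
      using 2 eventually_nhds_in_open[of "{..<0}" x] by (auto elim!: eventually_mono simp: flat_exp_def)
    moreover have "((\<lambda>x. 0) has_real_derivative flat_exp ([:0,0,1:] * (p - pderiv p)) x) (at x)"
      using 2 by (simp add: flat_exp_def)
    ultimately show ?thesis using DERIV_cong_ev[OF refl _ refl] by fast
  next
    case 3
    have "((\<lambda>y. flat_exp p y / y) \<longlongrightarrow> 0) (at_right 0)"
    proof -
      have "((\<lambda>y. poly (pCons 0 p) (inverse y) * exp (- inverse y)) \<longlongrightarrow> 0) (at_right (0::real))"
        by (rule filterlim_compose[OF poly_exp_tendsto_0 filterlim_inverse_at_top_right])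
      moreover have "\<forall>\<^sub>F y in at_right 0. poly (pCons 0 p) (inverse y) * exp (- inverse y) = flat_exp p y / y"
        by (auto simp: eventually_at_right_field flat_exp_def divide_inverse mult_ac intro!: exI[of _ 1])
      ultimately show ?thesis using tendsto_cong by fast
    qed
    moreover have "((\<lambda>y. flat_exp p y / y) \<longlongrightarrow> 0) (at_left 0)"
      by (rule tendsto_eventually) (auto simp: eventually_at_left_field flat_exp_def intro!: exI[of _ "-1"])
    ultimately have "((\<lambda>y. flat_exp p y / y) \<longlongrightarrow> 0) (at 0)"
      by (simp add: filterlim_at_split)
    then show ?thesis using 3 by (simp add: has_field_derivative_iff flat_exp_def)
  qed
qed

lemma smooth1_flat_exp: "smooth1 (flat_exp p)"
proof -
  have "C1k k (flat_exp p)" for k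
  proof (induction k arbitrary: p)
    case 0
    then show ?case using flat_exp_DERIV by (auto intro!: DERIV_isCont continuous_at_imp_continuous_on)
  next
    case (Suc k)
    then show ?case using flat_exp_DERIV by (metis C1k.simps(2))
  qed
  then show ?thesis by (simp add: smooth1_def)
qed

text \<open>The quotient \<open>f (1 + x) / (f (1 + x) + f (1 - x))\<close> of flat functions is a
  smooth step, and its derivative \<open>\<beta>\<close> is a bump. The step is exported together
  with the bump because differences of steps are the potentials whose derivatives are differences of
  bumps.\<close>

lemma smooth_step_exists:
  obtains F \<beta> :: "real \<Rightarrow> real" where "smooth1 F" "smooth1 \<beta>"
    "\<And>x. (F has_real_derivative \<beta> x) (at x)"
    "\<And>x. x \<le> -1 \<Longrightarrow> F x = 0" "\<And>x. x \<ge> 1 \<Longrightarrow> F x = 1"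
    "\<And>x. 0 \<le> F x" "\<And>x. F x \<le> 1" "\<And>x. 0 \<le> \<beta> x" "\<And>x. \<bar>x\<bar> > 1 \<Longrightarrow> \<beta> x = 0" "\<exists>t. \<beta> t > 0"
proof -
  define f where "f = flat_exp 1"
  have f: "f x = (if x > 0 then exp (-(1/x)) else 0)" for x by (simp add: f_def flat_exp_def)
  have f0: "f x \<ge> 0" "x > 0 \<Longrightarrow> f x > 0" "x \<le> 0 \<Longrightarrow> f x = 0" for x by (auto simp: f)
  have fmono: "f x \<le> f y" if "x \<le> y" for x y
    using that by (auto simp: f frac_le)
  define F where "F x = f (1 + x) * inverse (f (1 + x) + f (1 - x))" for x
  have pos: "f (1 + x) + f (1 - x) > 0" for x
    using f0(1)[of "1+x"] f0(1)[of "1-x"] f0(2)[of "1+x"] f0(2)[of "1-x"] by linarith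
  have s1: "smooth1 (\<lambda>x. f (1 + x))" using smooth1_affine[OF smooth1_flat_exp[of 1], of 1 1] by (simp add: f_def add.commute)
  have s2: "smooth1 (\<lambda>x. f (1 - x))" using smooth1_affine[OF smooth1_flat_exp[of 1], of "-1" 1] by (simp add: f_def)
  have sF: "smooth1 F" unfolding F_def
    using pos by (intro smooth1_mult smooth1_inverse smooth1_add s1 s2) (metis less_irrefl)
  then obtain \<beta> where b: "\<And>x. (F has_real_derivative \<beta> x) (at x)" "smooth1 \<beta>" using smooth1_derivE by blast
  have F01: "0 \<le> F x" "F x \<le> 1" for x
    using f0(1)[of "1+x"] f0(1)[of "1-x"] pos[of x] by (auto simp: F_def field_simps)
  have Fl: "F x = 0" if "x \<le> -1" for x using f0(3)[of "1+x"] that by (simp add: F_def)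
  have Fr: "F x = 1" if "x \<ge> 1" for x using f0(3)[of "1-x"] pos[of x] that by (simp add: F_def)
  have Fmono: "F x \<le> F y" if "x \<le> y" for x y
  proof -
    \<comment> \<open>Cross-multiplied form of \<open>F x \<le> F y\<close> after cancelling the
      common product \<open>f (1 + x) * f (1 + y)\<close>.\<close>
    have "f (1 + x) * f (1 - y) \<le> f (1 + y) * f (1 - x)"
      using fmono[of "1+x" "1+y"] fmono[of "1-y" "1-x"] that f0(1) by (intro mult_mono) auto
    then show ?thesis using pos[of x] pos[of y] by (simp add: F_def field_simps)
  qed
  have b0: "\<beta> x \<ge> 0" for x
    by (rule mono_on_imp_deriv_nonneg[OF _ b(1), of UNIV]) (auto intro: mono_onI Fmono)
  have bz: "\<beta> x = 0" if "\<bar>x\<bar> > 1" for x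
  proof -
    have "\<exists>c. \<forall>\<^sub>F y in nhds x. F y = c"
    proof (cases "x > 1")
      case True then show ?thesis using eventually_nhds_in_open[of "{1<..}" x] Fr by (auto elim!: eventually_mono intro!: exI[of _ 1])
    next
      case False then have "x < -1" using that by auto
      then show ?thesis using eventually_nhds_in_open[of "{..<-1}" x] Fl by (auto elim!: eventually_mono intro!: exI[of _ 0])
    qed
    then obtain c where "\<forall>\<^sub>F y in nhds x. F y = c" by blast
    then have "(F has_real_derivative 0) (at x)" using DERIV_cong_ev[OF refl _ refl, of F "\<lambda>_. c" x 0] by simp
    then show ?thesis using b(1) DERIV_unique by blast
  qed
  have "\<exists>t. -1 < t \<and> t < 1 \<and> F 1 - F (-1) = (1 - (-1)) * \<beta> t"
    by (rule MVT2) (auto simp: b)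
  then have "\<exists>t. \<beta> t > 0" using Fl[of "-1"] Fr[of 1] by (metis (no_types) b0 diff_zero less_eq_real_def mult_zero_right order_refl zero_neq_one)
  from that[OF sF b(2,1) Fl Fr F01 b0 bz this] show ?thesis .
qed

section \<open>Closure properties of smooth functions on the plane\<close>

lemma Ck_on_SucD: "Ck_on (Suc k) S f \<Longrightarrow> Ck_on k S f"
  by (induction k arbitrary: f) auto

lemma Ck_on_const: "Ck_on k S (\<lambda>x. c)"
  by (induction k arbitrary: c) (auto simp: frechet_derivative_const)

lemma Ck_on_add: "Ck_on k UNIV f \<Longrightarrow> Ck_on k UNIV g \<Longrightarrow> Ck_on k UNIV (\<lambda>x. f x + g x)"
proof (induction k arbitrary: f g)
  case (Suc k)
  then have d: "f differentiable at x" "g differentiable at x" for x by (auto simp: differentiable_on_def)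
  then have "frechet_derivative (\<lambda>x. f x + g x) (at x) = (\<lambda>v. frechet_derivative f (at x) v + frechet_derivative g (at x) v)" for x
    by (intro frechet_derivative_at[symmetric] has_derivative_add) (auto simp: frechet_derivative_works)
  then show ?case using Suc by (auto intro!: continuous_intros derivative_intros)
qed (auto intro: continuous_intros)

lemma Ck_on_mult: "Ck_on k UNIV f \<Longrightarrow> Ck_on k UNIV g \<Longrightarrow> Ck_on k UNIV (\<lambda>x. f x * g x)"
proof (induction k arbitrary: f g)
  case (Suc k)
  then have d: "f differentiable at x" "g differentiable at x" for x by (auto simp: differentiable_on_def)
  then have "frechet_derivative (\<lambda>x. f x * g x) (at x) = (\<lambda>v. f x * frechet_derivative g (at x) v + frechet_derivative f (at x) v * g x)" for x
    by (intro frechet_derivative_at[symmetric] has_derivative_mult) (auto simp: frechet_derivative_works)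
  moreover have "Ck_on k UNIV (\<lambda>x. f x * frechet_derivative g (at x) v + frechet_derivative f (at x) v * g x)" for v
    using Suc Ck_on_SucD[OF Suc.prems(1)] Ck_on_SucD[OF Suc.prems(2)] by (intro Ck_on_add Suc.IH) auto
  ultimately show ?case using Suc.prems by (auto intro!: continuous_intros derivative_intros)
qed (auto intro: continuous_intros)

lemma smooth1_inner_has_derivative:
  assumes "\<And>t. (f has_real_derivative f' t) (at t)"
  shows "((\<lambda>x. f (x \<bullet> w + c)) has_derivative (\<lambda>v. f' (x \<bullet> w + c) * (v \<bullet> w))) (at x)"
proof -
  have "((\<lambda>x. x \<bullet> w + c) has_derivative (\<lambda>v. v \<bullet> w)) (at x)" by (auto intro!: derivative_eq_intros)
  from has_derivative_compose[OF this assms[unfolded has_field_derivative_def]]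
  show ?thesis by simp
qed

text \<open>The derivative of a ridge function in direction \<open>v\<close> is again a ridge
  function, with profile \<open>f'\<close>, times the constant \<open>v \<bullet> w\<close>; the
  induction therefore runs over the one-variable order.\<close>

lemma Ck_on_inner: "C1k k f \<Longrightarrow> Ck_on k UNIV (\<lambda>x. f (x \<bullet> w + c))"
proof (induction k arbitrary: f)
  case 0
  then show ?case by (auto intro!: continuous_on_compose2[of UNIV f] continuous_intros)
next
  case (Suc k)
  then obtain f' where *: "\<And>x. (f has_real_derivative f' x) (at x)" "C1k k f'" by auto
  note d = smooth1_inner_has_derivative[of f f', OF *(1)]
  have "frechet_derivative (\<lambda>x. f (x \<bullet> w + c)) (at x) = (\<lambda>v. f' (x \<bullet> w + c) * (v \<bullet> w))" for x
    using frechet_derivative_at[OF d, symmetric] .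
  moreover have "Ck_on k UNIV (\<lambda>x. f' (x \<bullet> w + c) * (v \<bullet> w))" for v
    by (intro Ck_on_mult Ck_on_const Suc.IH *)
  moreover have "(\<lambda>x. f (x \<bullet> w + c)) differentiable_on UNIV"
    using d unfolding differentiable_on_def differentiable_def by blast
  ultimately show ?case using differentiable_imp_continuous_on by auto
qed

lemma smooth_on_inner: "smooth1 f \<Longrightarrow> smooth_on UNIV (\<lambda>x. f (x \<bullet> w + c))"
  by (simp add: smooth1_def smooth_on_def Ck_on_inner)

lemma smooth_on_mult: "smooth_on UNIV f \<Longrightarrow> smooth_on UNIV g \<Longrightarrow> smooth_on UNIV (\<lambda>x. f x * g x)"
  by (simp add: smooth_on_def Ck_on_mult)

lemma smooth_on_has_derivative:
  "smooth_on UNIV f \<Longrightarrow> (f has_derivative frechet_derivative f (at x)) (at x)"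
proof -
  assume "smooth_on UNIV f"
  then have "Ck_on (Suc 0) UNIV f" unfolding smooth_on_def by blast
  then show ?thesis by (simp add: frechet_derivative_works[symmetric] differentiable_on_def)
qed

lemma smooth_on_continuous_frechet:
  "smooth_on UNIV f \<Longrightarrow> continuous_on UNIV (\<lambda>x. frechet_derivative f (at x) v)"
proof -
  assume "smooth_on UNIV f"
  then have "Ck_on (Suc 0) UNIV f" unfolding smooth_on_def by blast
  then show ?thesis by simp
qed

lemma smooth_on_continuous: "smooth_on UNIV f \<Longrightarrow> continuous_on UNIV f"
  unfolding smooth_on_def by (metis Ck_on.simps(1))

section \<open>Convolution with shrinking kernels\<close>

lemma lborel_shift:
  fixes f :: "'a::euclidean_space \<Rightarrow> real"
  assumes [measurable]: "f \<in> borel_measurable borel"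
  shows lborel_integral_shift: "(\<integral>x. f (x + h) \<partial>lborel) = (\<integral>x. f x \<partial>lborel)"
    and lborel_integrable_shift: "integrable lborel (\<lambda>x. f (x + h)) \<longleftrightarrow> integrable lborel f"
proof -
  have "integral\<^sup>L lborel f = integral\<^sup>L (distr lborel borel ((+) h)) f" by (simp add: lborel_distr_plus)
  also have "\<dots> = (\<integral>x. f (x + h) \<partial>lborel)" by (subst integral_distr) (auto simp: add.commute)
  finally show "(\<integral>x. f (x + h) \<partial>lborel) = (\<integral>x. f x \<partial>lborel)" by simp
  have "integrable lborel f \<longleftrightarrow> integrable (distr lborel borel ((+) h)) f" by (simp add: lborel_distr_plus)
  also have "\<dots> \<longleftrightarrow> integrable lborel (\<lambda>x. f (x + h))" by (subst integrable_distr_eq) (auto simp: add.commute)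
  finally show "integrable lborel (\<lambda>x. f (x + h)) \<longleftrightarrow> integrable lborel f" by simp
qed

lemma lborel_integral_affine:
  fixes f :: "'a::euclidean_space \<Rightarrow> real"
  assumes [measurable]: "f \<in> borel_measurable borel" and "c \<noteq> 0"
  shows "(\<integral>x. f x \<partial>lborel) = \<bar>c\<bar> ^ DIM('a) * (\<integral>x. f (t + c *\<^sub>R x) \<partial>lborel)"
proof -
  have "integral\<^sup>L lborel f = integral\<^sup>L (density (distr lborel borel (\<lambda>x. t + c *\<^sub>R x)) (\<lambda>_. \<bar>c\<bar>^DIM('a))) f"
    using lborel_affine[OF \<open>c \<noteq> 0\<close>, of t] by simp
  also have "\<dots> = \<bar>c\<bar> ^ DIM('a) * (\<integral>x. f (t + c *\<^sub>R x) \<partial>lborel)"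
    by (subst integral_density) (auto simp: integral_distr)
  finally show ?thesis .
qed

text \<open>The \<open>L\<^sup>1\<close> modulus of continuity of \<open>f\<close> under
  translation.\<close>

definition shift_dist :: "('a::euclidean_space \<Rightarrow> real) \<Rightarrow> 'a \<Rightarrow> real" where
  "shift_dist f h = (\<integral>x. \<bar>f (x + h) - f x\<bar> \<partial>lborel)"

lemma shift_integrable:
  fixes f :: "'a::euclidean_space \<Rightarrow> real"
  assumes "integrable lborel f"
  shows "integrable lborel (\<lambda>x. f (x + h))"
  using assms lborel_integrable_shift[of f h] borel_measurable_integrable by auto

lemma shift_dist_le:
  fixes f g :: "'a::euclidean_space \<Rightarrow> real"
  assumes f: "integrable lborel f" and g: "integrable lborel g"
  shows "shift_dist f h \<le> shift_dist g h + 2 * (\<integral>x. \<bar>f x - g x\<bar> \<partial>lborel)"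
proof -
  note s = shift_integrable[OF f, of h] shift_integrable[OF g, of h]
  have [measurable]: "f \<in> borel_measurable borel" "g \<in> borel_measurable borel" using f g by auto
  have "shift_dist f h \<le> (\<integral>x. \<bar>g (x + h) - g x\<bar> + \<bar>f (x+h) - g (x+h)\<bar> + \<bar>f x - g x\<bar> \<partial>lborel)"
    unfolding shift_dist_def using f g s by (intro integral_mono) auto
  also have "\<dots> = shift_dist g h + (\<integral>x. \<bar>f (x+h) - g (x+h)\<bar> \<partial>lborel) + (\<integral>x. \<bar>f x - g x\<bar> \<partial>lborel)"
    unfolding shift_dist_def using f g s by (subst Bochner_Integration.integral_add; (intro integrable_abs Bochner_Integration.integrable_add Bochner_Integration.integrable_diff)?; simp?)+
  also have "(\<integral>x. \<bar>f (x+h) - g (x+h)\<bar> \<partial>lborel) = (\<integral>x. \<bar>f x - g x\<bar> \<partial>lborel)"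
    by (rule lborel_integral_shift[of "\<lambda>x. \<bar>f x - g x\<bar>"]) measurable
  finally show ?thesis by simp
qed

lemma shift_dist_nonneg: "shift_dist f h \<ge> 0" by (simp add: shift_dist_def)

lemma shift_dist_tendsto_approx:
  fixes f :: "'a::euclidean_space \<Rightarrow> real"
  assumes f: "integrable lborel f"
    and approx: "\<And>e. e > 0 \<Longrightarrow> \<exists>g. integrable lborel g \<and> (\<integral>x. \<bar>f x - g x\<bar> \<partial>lborel) \<le> e \<and> (\<lambda>n. shift_dist g (h n)) \<longlonglongrightarrow> 0"
  shows "(\<lambda>n. shift_dist f (h n)) \<longlonglongrightarrow> 0"
proof (rule LIMSEQ_I)
  fix r :: real assume "r > 0"
  then obtain g where g: "integrable lborel g" "(\<integral>x. \<bar>f x - g x\<bar> \<partial>lborel) \<le> r/4" "(\<lambda>n. shift_dist g (h n)) \<longlonglongrightarrow> 0"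
    using approx[of "r/4"] by auto
  from LIMSEQ_D[OF g(3), of "r/2"] \<open>r > 0\<close> obtain N where N: "\<And>n. n \<ge> N \<Longrightarrow> \<bar>shift_dist g (h n)\<bar> < r/2" by auto
  show "\<exists>no. \<forall>n\<ge>no. norm (shift_dist f (h n) - 0) < r"
  proof (intro exI[of _ N] allI impI)
    fix n assume "n \<ge> N"
    then show "norm (shift_dist f (h n) - 0) < r"
      using N[of n] shift_dist_le[OF f g(1), of "h n"] g(2) shift_dist_nonneg[of f "h n"] shift_dist_nonneg[of g "h n"] by simp
  qed
qed

text \<open>The \<open>L\<^sup>1\<close> distance between the indicators of \<open>V\<close> and of
  its translate is twice the measure of \<open>V\<close> minus twice that of the overlap. Hence
  convergence is needed at points of \<open>V\<close> only, where openness gives it; a boundary of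
  positive measure is harmless.\<close>

lemma shift_dist_open:
  fixes V :: "'a::euclidean_space set"
  assumes V: "open V" "emeasure lborel V < \<infinity>" and h: "h \<longlonglongrightarrow> 0"
  shows "(\<lambda>n. shift_dist (indicat_real V) (h n)) \<longlonglongrightarrow> 0"
proof -
  have [measurable]: "V \<in> sets borel" using V by auto
  have iV: "integrable lborel (indicat_real V)" using V by (intro integrable_real_indicator) auto
  note sV = shift_integrable[OF iV]
  have ip: "integrable lborel (\<lambda>x. indicat_real V x * indicat_real V (x + k))" for k
    by (rule Bochner_Integration.integrable_bound[OF iV]) (auto simp: indicator_def)
  have eq: "shift_dist (indicat_real V) k = 2 * (\<integral>x. indicat_real V x \<partial>lborel) - 2 * (\<integral>x. indicat_real V x * indicat_real V (x + k) \<partial>lborel)" for k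
  proof -
    have "shift_dist (indicat_real V) k = (\<integral>x. indicat_real V (x + k) + indicat_real V x - 2 * (indicat_real V x * indicat_real V (x + k)) \<partial>lborel)"
      unfolding shift_dist_def by (intro Bochner_Integration.integral_cong) (auto simp: indicator_def)
    also have "\<dots> = (\<integral>x. indicat_real V (x + k) \<partial>lborel) + (\<integral>x. indicat_real V x \<partial>lborel) - 2 * (\<integral>x. indicat_real V x * indicat_real V (x + k) \<partial>lborel)"
      using iV sV ip by simp
    finally show ?thesis by (simp add: lborel_integral_shift)
  qed
  have "(\<lambda>n. \<integral>x. indicat_real V x * indicat_real V (x + h n) \<partial>lborel) \<longlonglongrightarrow> (\<integral>x. indicat_real V x \<partial>lborel)"
  proof (rule integral_dominated_convergence[where w="indicat_real V"])
    show "AE x in lborel. (\<lambda>n. indicat_real V x * indicat_real V (x + h n)) \<longlonglongrightarrow> indicat_real V x"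
    proof (rule AE_I2)
      fix x
      show "(\<lambda>n. indicat_real V x * indicat_real V (x + h n)) \<longlonglongrightarrow> indicat_real V x"
      proof (cases "x \<in> V")
        case True
        have "(\<lambda>n. x + h n) \<longlonglongrightarrow> x" using tendsto_add[OF tendsto_const h] by simp
        then have "\<forall>\<^sub>F n in sequentially. x + h n \<in> V" using V(1) True topological_tendstoD by blast
        then show ?thesis using True by (intro tendsto_eventually) (auto elim!: eventually_mono)
      qed simp
    qed
  qed (use iV in \<open>auto simp: indicator_def\<close>)
  from tendsto_diff[OF tendsto_const tendsto_mult[OF tendsto_const this], of "2 * (\<integral>x. indicat_real V x \<partial>lborel)" 2]
  show ?thesis by (simp add: eq)
qed

text \<open>Continuity of translation in the mean. Outer regularity reduces measurable sets to open
  ones; linearity and dominated approximation extend the claim to integrable functions.\<close>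

lemma shift_dist_tendsto_0:
  fixes f :: "'a::euclidean_space \<Rightarrow> real"
  assumes "integrable lborel f" and h: "h \<longlonglongrightarrow> 0"
  shows "(\<lambda>n. shift_dist f (h n)) \<longlonglongrightarrow> 0"
  using assms(1)
proof (induction rule: integrable_induct)
  case (base A c)
  have A: "A \<in> sets borel" using base by simp
  have "(\<lambda>n. shift_dist (indicat_real A) (h n)) \<longlonglongrightarrow> 0"
  proof (rule shift_dist_tendsto_approx)
    show "integrable lborel (indicat_real A)" using base by auto
    fix e :: real assume "e > 0"
    then obtain V where V: "open V" "A \<subseteq> V" "emeasure lborel (V - A) < e" using outer_regular_lborel[OF A] by blast
    have [measurable]: "V \<in> sets borel" "A \<in> sets borel" using V A by auto
    have "emeasure lborel V \<le> emeasure lborel A + emeasure lborel (V - A)"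
      using V(2) by (subst plus_emeasure) (auto simp: Un_absorb1)
    also have "\<dots> < \<infinity>" using base V(3) by (auto simp: top.not_eq_extremum intro: order_less_trans)
    finally have fV: "emeasure lborel V < \<infinity>" .
    have "(\<integral>x. \<bar>indicat_real A x - indicat_real V x\<bar> \<partial>lborel) = (\<integral>x. indicat_real (V - A) x \<partial>lborel)"
      using V(2) by (intro Bochner_Integration.integral_cong) (auto simp: indicator_def)
    also have "\<dots> = measure lborel (V - A)" by simp
    also have "\<dots> \<le> e" using V(3) \<open>e > 0\<close> by (auto simp: measure_def intro!: enn2real_leI)
    finally show "\<exists>g. integrable lborel g \<and> (\<integral>x. \<bar>indicat_real A x - g x\<bar> \<partial>lborel) \<le> e \<and> (\<lambda>n. shift_dist g (h n)) \<longlonglongrightarrow> 0"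
      using shift_dist_open[OF V(1) fV h] fV by (intro exI[of _ "indicat_real V"]) auto
  qed
  from tendsto_mult[OF tendsto_const this, of "\<bar>c\<bar>"]
  have "(\<lambda>n. \<bar>c\<bar> * shift_dist (indicat_real A) (h n)) \<longlonglongrightarrow> 0" by simp
  moreover have "shift_dist (\<lambda>x. indicat_real A x *\<^sub>R c) k = \<bar>c\<bar> * shift_dist (indicat_real A) k" for k
    unfolding shift_dist_def integral_mult_right_zero[symmetric]
    by (intro Bochner_Integration.integral_cong) (auto simp: indicator_def)
  ultimately show ?case by simp
next
  case (add f g)
  have lim0: "(\<lambda>n. shift_dist f (h n) + shift_dist g (h n)) \<longlonglongrightarrow> 0" using tendsto_add[OF add.IH] by simp
  have le: "shift_dist (\<lambda>x. f x + g x) k \<le> shift_dist f k + shift_dist g k" for k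
  proof -
    have "shift_dist (\<lambda>x. f x + g x) k \<le> (\<integral>x. \<bar>f (x + k) - f x\<bar> + \<bar>g (x + k) - g x\<bar> \<partial>lborel)"
      unfolding shift_dist_def using add.hyps shift_integrable[OF add.hyps(1)] shift_integrable[OF add.hyps(2)]
      by (intro integral_mono) auto
    also have "\<dots> = shift_dist f k + shift_dist g k"
      unfolding shift_dist_def using add.hyps shift_integrable[OF add.hyps(1)] shift_integrable[OF add.hyps(2)]
      by (intro Bochner_Integration.integral_add) auto
    finally show ?thesis .
  qed
  show ?case
    by (rule tendsto_sandwich[OF _ _ tendsto_const lim0]) (simp_all add: shift_dist_nonneg le)
next
  case (lim f s)
  have [measurable]: "f \<in> borel_measurable borel" "\<And>i. s i \<in> borel_measurable borel" using lim by auto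
  have "(\<lambda>i. \<integral>x. \<bar>f x - s i x\<bar> \<partial>lborel) \<longlonglongrightarrow> (\<integral>x. \<bar>f x - f x\<bar> \<partial>(lborel :: 'a measure))"
  proof (rule integral_dominated_convergence[where w="\<lambda>x. 3 * \<bar>f x\<bar>"])
    show "AE x in lborel. (\<lambda>i. \<bar>f x - s i x\<bar>) \<longlonglongrightarrow> \<bar>f x - f x\<bar>"
      using lim by (intro AE_I2 tendsto_intros) auto
    have "\<bar>f x - s i x\<bar> \<le> 3 * \<bar>f x\<bar>" for i x using lim.hyps(3)[of x i] by auto
    then show "AE x in lborel. norm \<bar>f x - s i x\<bar> \<le> 3 * \<bar>f x\<bar>" for i by simp
  qed (use lim in auto)
  then have L: "(\<lambda>i. \<integral>x. \<bar>f x - s i x\<bar> \<partial>lborel) \<longlonglongrightarrow> 0" by simp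
  show ?case
  proof (rule shift_dist_tendsto_approx[OF lim.hyps(4)])
    fix e :: real assume "e > 0"
    from LIMSEQ_D[OF L this] obtain i where "\<bar>\<integral>x. \<bar>f x - s i x\<bar> \<partial>lborel\<bar> < e" by auto
    then show "\<exists>g. integrable lborel g \<and> (\<integral>x. \<bar>f x - g x\<bar> \<partial>lborel) \<le> e \<and> (\<lambda>n. shift_dist g (h n)) \<longlonglongrightarrow> 0"
      using lim by (intro exI[of _ "s i"]) auto
  qed
qed

text \<open>By Fubini the \<open>L\<^sup>1\<close> distance between the smeared function and the
  total mass of \<open>z\<close> times \<open>f\<close> is at most the integral of
  \<open>shift_dist f (s k *\<^sub>R y)\<close> against \<open>\<bar>z y\<bar>\<close>, which tends
  to 0 by dominated convergence. Convergence in the mean yields a.e. convergence along a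
  subsequence; this weak form stands in for Lebesgue differentiation.\<close>

lemma convolution_AE_subseq:
  fixes f z :: "'a::euclidean_space \<Rightarrow> real"
  assumes f: "integrable lborel f" and z: "integrable lborel z" and s: "s \<longlonglongrightarrow> 0"
  obtains r where "strict_mono r"
    "AE x in lborel. (\<lambda>k. \<integral>y. f (x + s (r k) *\<^sub>R y) * z y \<partial>lborel) \<longlonglongrightarrow> (\<integral>y. z y \<partial>lborel) * f x"
proof -
  have [measurable]: "f \<in> borel_measurable borel" "z \<in> borel_measurable borel" using f z by auto
  have shm[measurable]: "(\<lambda>y. shift_dist f (g y)) \<in> borel_measurable borel" if [measurable]: "g \<in> borel_measurable borel" for g :: "'a \<Rightarrow> 'a"
    unfolding shift_dist_def by measurable
  \<comment> \<open>Comparison with the zero function bounds the modulus uniformly in the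
    translation; this is the dominating constant below.\<close>
  have shb: "shift_dist f k \<le> 2 * (\<integral>x. \<bar>f x\<bar> \<partial>lborel)" for k
    using shift_dist_le[OF f, of "\<lambda>_. 0" k] by (simp add: shift_dist_def)
  define D where "D k x = (\<integral>y. f (x + s k *\<^sub>R y) * z y \<partial>lborel) - (\<integral>y. z y \<partial>lborel) * f x" for k x
  have si: "integrable lborel (\<lambda>x. f (x + k) - f x)" for k using f shift_integrable[OF f] by auto
  have P: "integrable (lborel \<Otimes>\<^sub>M lborel) (\<lambda>(y, x). (f (x + s k *\<^sub>R y) - f x) * z y)" for k
  proof (rule lborel_pair.Fubini_integrable)
    have "(\<integral>x. \<bar>(f (x + s k *\<^sub>R y) - f x) * z y\<bar> \<partial>lborel) = shift_dist f (s k *\<^sub>R y) * \<bar>z y\<bar>" for y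
      unfolding shift_dist_def abs_mult by simp
    moreover have "integrable lborel (\<lambda>y. shift_dist f (s k *\<^sub>R y) * \<bar>z y\<bar>)"
      by (rule Bochner_Integration.integrable_bound[of _ "\<lambda>y. 2 * (\<integral>x. \<bar>f x\<bar> \<partial>lborel) * \<bar>z y\<bar>"])
         (use z shb shift_dist_nonneg[of f] in \<open>auto simp: abs_mult intro!: mult_right_mono\<close>)
    ultimately show "integrable lborel (\<lambda>y. \<integral>x. norm (case (y, x) of (y, x) \<Rightarrow> (f (x + s k *\<^sub>R y) - f x) * z y) \<partial>lborel)" by simp
    show "AE y in lborel. integrable lborel (\<lambda>x. case (y, x) of (y, x) \<Rightarrow> (f (x + s k *\<^sub>R y) - f x) * z y)"
      using si by auto
  qed measurable
  have Pi: "integrable lborel (\<lambda>x. \<integral>y. \<bar>(f (x + s k *\<^sub>R y) - f x) * z y\<bar> \<partial>lborel)"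
    and Pe: "(\<integral>x. \<integral>y. \<bar>(f (x + s k *\<^sub>R y) - f x) * z y\<bar> \<partial>lborel \<partial>lborel) = (\<integral>y. shift_dist f (s k *\<^sub>R y) * \<bar>z y\<bar> \<partial>lborel)" for k
  proof -
    have a: "integrable (lborel \<Otimes>\<^sub>M lborel) (\<lambda>(y, x). \<bar>(f (x + s k *\<^sub>R y) - f x) * z y\<bar>)"
      using integrable_abs[OF P[of k]] by (simp add: case_prod_unfold)
    from lborel_pair.integrable_snd[OF a] show "integrable lborel (\<lambda>x. \<integral>y. \<bar>(f (x + s k *\<^sub>R y) - f x) * z y\<bar> \<partial>lborel)" by simp
    have "(\<integral>x. \<integral>y. \<bar>(f (x + s k *\<^sub>R y) - f x) * z y\<bar> \<partial>lborel \<partial>lborel) = (\<integral>y. \<integral>x. \<bar>(f (x + s k *\<^sub>R y) - f x) * z y\<bar> \<partial>lborel \<partial>lborel)"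
      using lborel_pair.Fubini_integral[OF a] by simp
    then show "(\<integral>x. \<integral>y. \<bar>(f (x + s k *\<^sub>R y) - f x) * z y\<bar> \<partial>lborel \<partial>lborel) = (\<integral>y. shift_dist f (s k *\<^sub>R y) * \<bar>z y\<bar> \<partial>lborel)"
      by (simp add: shift_dist_def abs_mult)
  qed
  have Dae: "AE x in lborel. \<bar>D k x\<bar> \<le> (\<integral>y. \<bar>(f (x + s k *\<^sub>R y) - f x) * z y\<bar> \<partial>lborel)" for k
  proof -
    have "AE x in lborel. integrable lborel (\<lambda>y. (f (x + s k *\<^sub>R y) - f x) * z y)"
      using lborel_pair.AE_integrable_snd[OF P[of k]] by simp
    then show ?thesis
    proof (eventually_elim)
      fix x assume i: "integrable lborel (\<lambda>y. (f (x + s k *\<^sub>R y) - f x) * z y)"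
      then have "integrable lborel (\<lambda>y. (f (x + s k *\<^sub>R y) - f x) * z y + f x * z y)" using z by auto
      then have i2: "integrable lborel (\<lambda>y. f (x + s k *\<^sub>R y) * z y)" by (simp add: algebra_simps)
      have "D k x = (\<integral>y. f (x + s k *\<^sub>R y) * z y \<partial>lborel) - (\<integral>y. f x * z y \<partial>lborel)"
        by (simp add: D_def)
      also have "\<dots> = (\<integral>y. f (x + s k *\<^sub>R y) * z y - f x * z y \<partial>lborel)"
        using i2 z by (intro Bochner_Integration.integral_diff[symmetric]) auto
      finally have "D k x = (\<integral>y. (f (x + s k *\<^sub>R y) - f x) * z y \<partial>lborel)"
        by (simp only: left_diff_distrib)
      then show "\<bar>D k x\<bar> \<le> (\<integral>y. \<bar>(f (x + s k *\<^sub>R y) - f x) * z y\<bar> \<partial>lborel)"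
        using integral_norm_bound[of lborel "\<lambda>y. (f (x + s k *\<^sub>R y) - f x) * z y"] by simp
    qed
  qed
  have Dm[measurable]: "D k \<in> borel_measurable borel" for k unfolding D_def by measurable
  have Di: "integrable lborel (D k)" for k
    by (rule Bochner_Integration.integrable_bound[OF Pi[of k]]) (use Dae[of k] in \<open>auto elim!: eventually_mono\<close>)
  have Dle: "(\<integral>x. \<bar>D k x\<bar> \<partial>lborel) \<le> (\<integral>y. shift_dist f (s k *\<^sub>R y) * \<bar>z y\<bar> \<partial>lborel)" for k
    unfolding Pe[symmetric] using Di[of k] Pi[of k] Dae[of k] by (intro integral_mono_AE) auto
  have "(\<lambda>k. \<integral>y. shift_dist f (s k *\<^sub>R y) * \<bar>z y\<bar> \<partial>lborel) \<longlonglongrightarrow> (\<integral>y. 0 * \<bar>z y\<bar> \<partial>(lborel :: 'a measure))"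
  proof (rule integral_dominated_convergence[where w="\<lambda>y. 2 * (\<integral>x. \<bar>f x\<bar> \<partial>lborel) * \<bar>z y\<bar>"])
    show "AE y in lborel. (\<lambda>k. shift_dist f (s k *\<^sub>R y) * \<bar>z y\<bar>) \<longlonglongrightarrow> 0 * \<bar>z y\<bar>"
    proof (intro AE_I2 tendsto_mult tendsto_const shift_dist_tendsto_0[OF f])
      fix y :: 'a show "(\<lambda>k. s k *\<^sub>R y) \<longlonglongrightarrow> 0" using tendsto_scaleR[OF s tendsto_const[of y]] by simp
    qed
    show "AE y in lborel. norm (shift_dist f (s k *\<^sub>R y) * \<bar>z y\<bar>) \<le> 2 * (\<integral>x. \<bar>f x\<bar> \<partial>lborel) * \<bar>z y\<bar>" for k
      using shb shift_dist_nonneg[of f] by (auto simp: abs_mult intro!: mult_right_mono)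
  qed (use z in auto)
  then have lim0: "(\<lambda>k. \<integral>y. shift_dist f (s k *\<^sub>R y) * \<bar>z y\<bar> \<partial>lborel) \<longlonglongrightarrow> 0" by simp
  have "(\<lambda>k. \<integral>x. \<bar>D k x\<bar> \<partial>lborel) \<longlonglongrightarrow> 0"
    by (rule tendsto_sandwich[OF _ _ tendsto_const lim0]) (simp_all add: Dle)
  then obtain r where r: "strict_mono r" "AE x in lborel. (\<lambda>n. D (r n) x) \<longlonglongrightarrow> 0"
    using tendsto_L1_AE_subseq[of lborel D, OF Di] by auto
  show ?thesis
  proof (rule that[OF r(1)])
    show "AE x in lborel. (\<lambda>k. \<integral>y. f (x + s (r k) *\<^sub>R y) * z y \<partial>lborel) \<longlonglongrightarrow> (\<integral>y. z y \<partial>lborel) * f x"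
      using r(2) by eventually_elim (simp add: D_def LIM_zero_iff)
  qed
qed

section \<open>Weak gradients tested against bumps\<close>

lemma borel_measurable_lebesgue_on: "f \<in> borel_measurable borel \<Longrightarrow> f \<in> borel_measurable (lebesgue_on S)"
  by (simp add: measurable_completion measurable_restrict_space1)

lemma integrable_mult_bounded:
  fixes f h :: "'a \<Rightarrow> real"
  assumes "integrable M f" "h \<in> borel_measurable M" "\<And>x. \<bar>h x\<bar> \<le> B"
  shows "integrable M (\<lambda>x. f x * h x)"
proof (rule Bochner_Integration.integrable_bound[of _ "\<lambda>x. B * \<bar>f x\<bar>"])
  have "\<bar>f x * h x\<bar> \<le> B * \<bar>f x\<bar>" for x
    using mult_left_mono[OF assms(3)[of x] abs_ge_zero[of "f x"]] by (simp add: abs_mult mult.commute)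
  then show "AE x in M. norm (f x * h x) \<le> norm (B * \<bar>f x\<bar>)"
    by (auto intro: order_trans[OF _ abs_ge_self])
qed (use assms in auto)

lemma integrable_mult_square:
  fixes f h :: "'a \<Rightarrow> real"
  assumes "integrable M (\<lambda>x. (f x)\<^sup>2)" "integrable M (\<lambda>x. (h x)\<^sup>2)" "f \<in> borel_measurable M" "h \<in> borel_measurable M"
  shows "integrable M (\<lambda>x. f x * h x)"
proof (rule Bochner_Integration.integrable_bound[of _ "\<lambda>x. (f x)\<^sup>2 + (h x)\<^sup>2"])
  have "\<bar>f x * h x\<bar> \<le> (f x)\<^sup>2 + (h x)\<^sup>2" for x
    using sum_squares_bound[of "\<bar>f x\<bar>" "\<bar>h x\<bar>"] mult_nonneg_nonneg[OF abs_ge_zero[of "f x"] abs_ge_zero[of "h x"]] unfolding abs_mult power2_abs by linarith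
  then show "AE x in M. norm (f x * h x) \<le> norm ((f x)\<^sup>2 + (h x)\<^sup>2)" by auto
qed (use assms in auto)

text \<open>Cauchy-Schwarz: the integral of \<open>(s * f + h)\<^sup>2\<close> is a nonnegative
  quadratic in \<open>s\<close>. If its leading coefficient \<open>A\<close> is nonzero, it is
  evaluated at the minimum \<open>- B / A\<close>.\<close>

lemma integral_square_le:
  fixes f h :: "'a \<Rightarrow> real"
  assumes "integrable M (\<lambda>x. (f x)\<^sup>2)" "integrable M (\<lambda>x. (h x)\<^sup>2)" "f \<in> borel_measurable M" "h \<in> borel_measurable M"
  shows "(\<integral>x. f x * h x \<partial>M)\<^sup>2 \<le> (\<integral>x. (f x)\<^sup>2 \<partial>M) * (\<integral>x. (h x)\<^sup>2 \<partial>M)"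
proof -
  define A B C where "A = (\<integral>x. (f x)\<^sup>2 \<partial>M)" and "B = (\<integral>x. f x * h x \<partial>M)" and "C = (\<integral>x. (h x)\<^sup>2 \<partial>M)"
  note i = assms(1,2) integrable_mult_square[OF assms]
  have q: "0 \<le> A * s\<^sup>2 + 2 * B * s + C" for s
  proof -
    have "0 \<le> (\<integral>x. (s * f x + h x)\<^sup>2 \<partial>M)" by simp
    also have "(\<lambda>x. (s * f x + h x)\<^sup>2) = (\<lambda>x. s\<^sup>2 * (f x)\<^sup>2 + (2 * s) * (f x * h x) + (h x)\<^sup>2)"
      by (auto simp: power2_eq_square algebra_simps)
    also have "(\<integral>x. s\<^sup>2 * (f x)\<^sup>2 + (2 * s) * (f x * h x) + (h x)\<^sup>2 \<partial>M) = s\<^sup>2 * A + (2 * s) * B + C"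
      using i by (simp add: A_def B_def C_def)
    finally show ?thesis by (simp add: algebra_simps)
  qed
  have "A \<ge> 0" by (simp add: A_def)
  show ?thesis
  proof (cases "A = 0")
    case True
    have "B = 0"
    proof (rule ccontr)
      assume "B \<noteq> 0"
      \<comment> \<open>This \<open>s\<close> gives the linear function \<open>2 * B * s + C\<close>
        the value \<open>-1\<close>.\<close>
      then show False using q[of "- (C + 1) / (2 * B)"] True by (simp add: field_simps)
    qed
    then show ?thesis using True by (simp add: A_def B_def)
  next
    case False
    have "0 \<le> A * (A * (- B / A)\<^sup>2 + 2 * B * (- B / A) + C)" by (intro mult_nonneg_nonneg q \<open>A \<ge> 0\<close>)
    also have "\<dots> = A * C - B\<^sup>2" using False by (simp add: power2_eq_square field_simps)
    finally show ?thesis by (simp add: A_def B_def C_def)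
  qed
qed

lemma norm_square_R2: "(norm (v :: R2))\<^sup>2 = (v $ 1)\<^sup>2 + (v $ 2)\<^sup>2"
  by (simp add: norm_eq_sqrt_inner inner_vec_def sum_2 power2_eq_square)

lemma mem_cbox_R2: "x \<in> cbox l (h :: R2) \<longleftrightarrow> l $ 1 \<le> x $ 1 \<and> x $ 1 \<le> h $ 1 \<and> l $ 2 \<le> x $ 2 \<and> x $ 2 \<le> h $ 2"
  by (auto simp: mem_box_cart forall_2)

text \<open>Source of the explicit test functions: a difference of steps in one coordinate times a
  bump in the other, or a product of two bumps.\<close>

lemma product_test_function:
  fixes p q p' q' :: "real \<Rightarrow> real"
  assumes p: "smooth1 p" "\<And>t. (p has_real_derivative p' t) (at t)"
    and q: "smooth1 q" "\<And>t. (q has_real_derivative q' t) (at t)"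
    and pz: "\<And>t. t < l $ 1 \<or> t > h $ 1 \<Longrightarrow> p t = 0" and qz: "\<And>t. t < l $ 2 \<or> t > h $ 2 \<Longrightarrow> q t = 0"
    and sub: "cbox l h \<subseteq> \<Omega>"
  shows "test_function \<Omega> (\<lambda>x. p (x $ 1) * q (x $ 2))"
    and "frechet_derivative (\<lambda>x::R2. p (x $ 1) * q (x $ 2)) (at x) (axis 1 1) = p' (x $ 1) * q (x $ 2)"
    and "frechet_derivative (\<lambda>x::R2. p (x $ 1) * q (x $ 2)) (at x) (axis 2 1) = p (x $ 1) * q' (x $ 2)"
proof -
  have ax: "x \<bullet> axis i 1 + 0 = x $ i" for x :: R2 and i by (simp add: cart_eq_inner_axis)
  have s: "smooth_on UNIV (\<lambda>x::R2. p (x $ 1) * q (x $ 2))"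
    using smooth_on_mult[OF smooth_on_inner[OF p(1), of "axis 1 1" 0] smooth_on_inner[OF q(1), of "axis 2 1" 0]] by (simp only: ax)
  have sub1: "{x::R2. p (x $ 1) * q (x $ 2) \<noteq> 0} \<subseteq> cbox l h"
    using pz qz by (force simp: mem_cbox_R2)
  then have sub2: "closure {x::R2. p (x $ 1) * q (x $ 2) \<noteq> 0} \<subseteq> cbox l h" by (intro closure_minimal) auto
  then have "compact (closure {x::R2. p (x $ 1) * q (x $ 2) \<noteq> 0})"
    using bounded_subset[OF bounded_cbox sub2] by (simp add: compact_eq_bounded_closed)
  with s sub sub2 show "test_function \<Omega> (\<lambda>x. p (x $ 1) * q (x $ 2))" by (auto simp: test_function_def)
  have "((\<lambda>x::R2. p (x $ 1) * q (x $ 2)) has_derivative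
      (\<lambda>v. p (x $ 1) * (q' (x $ 2) * (v $ 2)) + p' (x $ 1) * (v $ 1) * q (x $ 2))) (at x)"
    using has_derivative_mult[OF smooth1_inner_has_derivative[OF p(2), of "axis 1 1" 0 x] smooth1_inner_has_derivative[OF q(2), of "axis 2 1" 0 x]]
    by (simp only: add_0_right ax[unfolded add_0_right])
  note e = frechet_derivative_at[OF this, symmetric]
  show "frechet_derivative (\<lambda>x::R2. p (x $ 1) * q (x $ 2)) (at x) (axis 1 1) = p' (x $ 1) * q (x $ 2)"
    and "frechet_derivative (\<lambda>x::R2. p (x $ 1) * q (x $ 2)) (at x) (axis 2 1) = p (x $ 1) * q' (x $ 2)"
    unfolding e by (simp_all add: axis_def)
qed

text \<open>Carries a weak gradient along with the function, so that estimates hold for any weak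
  gradient; the choice operator in \<open>grad_norm_sq\<close> is then resolved once, in
  \<open>grad_norm_sq_eq_energy\<close>.\<close>

definition H1_pair :: "R2 set \<Rightarrow> (R2 \<Rightarrow> real) \<Rightarrow> (R2 \<Rightarrow> R2) \<Rightarrow> bool" where
  "H1_pair \<Omega> u g \<longleftrightarrow> u \<in> borel_measurable (lebesgue_on \<Omega>) \<and> integrable (lebesgue_on \<Omega>) (\<lambda>x. (u x)\<^sup>2) \<and> weak_gradient \<Omega> u g"

definition energy :: "R2 set \<Rightarrow> (R2 \<Rightarrow> R2) \<Rightarrow> real" where
  "energy \<Omega> g = (\<integral>x. (norm (g x))\<^sup>2 \<partial>lebesgue_on \<Omega>)"

lemma energy_nonneg: "energy \<Omega> g \<ge> 0" by (simp add: energy_def)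

lemma weak_gradientD:
  assumes "weak_gradient \<Omega> u g"
  shows "integrable (lebesgue_on \<Omega>) (\<lambda>x. (norm (g x))\<^sup>2)" "g \<in> borel_measurable (lebesgue_on \<Omega>)"
    "(\<lambda>x. g x $ i) \<in> borel_measurable (lebesgue_on \<Omega>)" "integrable (lebesgue_on \<Omega>) (\<lambda>x. (g x $ i)\<^sup>2)"
proof -
  show m: "g \<in> borel_measurable (lebesgue_on \<Omega>)" using assms by (simp add: weak_gradient_def)
  show "integrable (lebesgue_on \<Omega>) (\<lambda>x. (norm (g x))\<^sup>2)" 
    using assms unfolding weak_gradient_def norm_square_R2 by (intro Bochner_Integration.integrable_add) auto
  show "(\<lambda>x. g x $ i) \<in> borel_measurable (lebesgue_on \<Omega>)"
    using borel_measurable_inner[OF m borel_measurable_const[of "axis i 1"]] by (simp add: cart_eq_inner_axis)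
  show "integrable (lebesgue_on \<Omega>) (\<lambda>x. (g x $ i)\<^sup>2)" using assms by (simp add: weak_gradient_def)
qed

locale R2_domain =
  fixes \<Omega> :: "R2 set"
  assumes open_dom: "open \<Omega>" and bounded_dom: "bounded \<Omega>"
begin

lemma dom_borel[measurable, simp]: "\<Omega> \<in> sets borel" using open_dom by auto

lemma dom_lmeasurable: "\<Omega> \<in> lmeasurable" using open_dom bounded_dom by (simp add: lmeasurable_open)

sublocale fin: finite_measure "lebesgue_on \<Omega>"
  using dom_lmeasurable by (rule finite_measure_lebesgue_on)

lemma integrable_of_square:
  assumes "f \<in> borel_measurable (lebesgue_on \<Omega>)" "integrable (lebesgue_on \<Omega>) (\<lambda>x. (f x)\<^sup>2)"
  shows "integrable (lebesgue_on \<Omega>) (f :: R2 \<Rightarrow> real)"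
  using integrable_mult_square[OF assms(2) _ assms(1) borel_measurable_const[of 1]] by simp

lemma integrable_norm_gradient:
  "weak_gradient \<Omega> u g \<Longrightarrow> integrable (lebesgue_on \<Omega>) (\<lambda>x. norm (g x))"
  by (rule integrable_of_square[OF measurable_compose[OF weak_gradientD(2) borel_measurable_norm] weak_gradientD(1)])

end

section \<open>Rescaled bumps and means against them\<close>

locale smooth_step =
  fixes F \<beta> :: "real \<Rightarrow> real" and S :: real
  assumes smooth_F: "smooth1 F" and smooth_\<beta>: "smooth1 \<beta>"
    and F_deriv: "\<And>x. (F has_real_derivative \<beta> x) (at x)"
    and F_left: "\<And>x. x \<le> -1 \<Longrightarrow> F x = 0" and F_right: "\<And>x. x \<ge> 1 \<Longrightarrow> F x = 1"
    and F_nonneg: "\<And>x. 0 \<le> F x" and F_le1: "\<And>x. F x \<le> 1" 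
    and \<beta>_nonneg: "\<And>x. 0 \<le> \<beta> x" and \<beta>_out: "\<And>x. \<bar>x\<bar> > 1 \<Longrightarrow> \<beta> x = 0" and \<beta>_pos: "\<exists>t. \<beta> t > 0"
    and \<beta>_le: "\<And>x. \<beta> x \<le> S"

lemma smooth_step_locale: obtains F \<beta> S where "smooth_step F \<beta> S"
proof -
  obtain F \<beta> where Fb: "smooth1 F" "smooth1 \<beta>"
    "\<And>x. (F has_real_derivative \<beta> x) (at x)"
    "\<And>x. x \<le> -1 \<Longrightarrow> F x = 0" "\<And>x. x \<ge> 1 \<Longrightarrow> F x = 1"
    "\<And>x. 0 \<le> F x" "\<And>x. F x \<le> 1" "\<And>x. 0 \<le> \<beta> x" "\<And>x. \<bar>x\<bar> > 1 \<Longrightarrow> \<beta> x = 0" "\<exists>t. \<beta> t > 0"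
    using smooth_step_exists by blast
  have "bounded (\<beta> ` {-1..1})"
    using compact_continuous_image[OF smooth1_continuous[OF Fb(2)]] compact_Icc compact_imp_bounded by blast
  then obtain B where B0: "\<forall>y\<in>\<beta> ` {-1..1}. norm y \<le> B" unfolding bounded_iff by blast
  have B: "\<bar>\<beta> x\<bar> \<le> B" if "x \<in> {-1..1}" for x using B0 that by auto
  have "\<beta> x \<le> max B 0" for x
  proof (cases "\<bar>x\<bar> > 1")
    case False
    then have "x \<in> {-1..1}" by auto
    from B[OF this] show ?thesis by linarith
  qed (simp add: Fb(9))
  with Fb show ?thesis by (intro that[of F \<beta> "max B 0"]) (unfold_locales, auto)
qed

context smooth_step
begin

lemma S_pos: "S > 0" using \<beta>_pos \<beta>_le by (meson less_le_trans)

text \<open>Dividing by \<open>\<sigma>\<close> keeps the integral the same at all scales and makes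
  the bump the exact derivative of the rescaled step \<open>F ((t - c) / \<sigma>)\<close>.\<close>

definition bump1 :: "real \<Rightarrow> real \<Rightarrow> real \<Rightarrow> real" where
  "bump1 c \<sigma> t = \<beta> ((t - c) / \<sigma>) / \<sigma>"

definition bump :: "R2 \<Rightarrow> real \<Rightarrow> R2 \<Rightarrow> real" where
  "bump c \<sigma> x = bump1 (c $ 1) \<sigma> (x $ 1) * bump1 (c $ 2) \<sigma> (x $ 2)"

lemma bump1_smooth: "smooth1 (bump1 c \<sigma>)"
proof -
  have "bump1 c \<sigma> = (\<lambda>t. (1/\<sigma>) * \<beta> ((1/\<sigma>) * t + (-c/\<sigma>)))"
    by (auto simp: bump1_def diff_divide_distrib)
  then show ?thesis by (metis smooth1_mult[OF smooth1_const smooth1_affine[OF smooth_\<beta>]])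
qed

lemma step_smooth: "smooth1 (\<lambda>t. F ((t - c) / \<sigma>))"
proof -
  have "(\<lambda>t. F ((t - c) / \<sigma>)) = (\<lambda>t. F ((1/\<sigma>) * t + (-c/\<sigma>)))"
    by (auto simp: diff_divide_distrib)
  then show ?thesis by (metis smooth1_affine[OF smooth_F])
qed

lemma step_deriv: "((\<lambda>t. F ((t - c) / \<sigma>)) has_real_derivative bump1 c \<sigma> t) (at t)"
proof -
  have "((\<lambda>t. F ((t - c) / \<sigma>)) has_real_derivative \<beta> ((t - c) / \<sigma>) * (1/\<sigma>)) (at t)"
    by (rule DERIV_chain2[OF F_deriv DERIV_cdivide]) (auto intro!: derivative_eq_intros)
  then show ?thesis by (simp add: bump1_def)
qed

lemma bump1_out: "\<sigma> > 0 \<Longrightarrow> t < c - \<sigma> \<or> t > c + \<sigma> \<Longrightarrow> bump1 c \<sigma> t = 0"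
  by (auto simp: bump1_def less_divide_eq divide_less_eq intro!: \<beta>_out)

lemma bump1_bounds: "\<sigma> > 0 \<Longrightarrow> 0 \<le> bump1 c \<sigma> t \<and> bump1 c \<sigma> t \<le> S / \<sigma>"
  using \<beta>_nonneg \<beta>_le by (auto simp: bump1_def divide_right_mono)

text \<open>A single step is not compactly supported, but both steps equal 0 to the left and 1 to
  the right of an interval containing the two transition zones, so their difference is.\<close>

lemma step_diff_out: 
  assumes "\<sigma> > 0" "\<sigma>' > 0" "l \<le> c - \<sigma>" "c + \<sigma> \<le> h" "l \<le> c' - \<sigma>'" "c' + \<sigma>' \<le> h" "t < l \<or> t > h"
  shows "F ((t - c) / \<sigma>) - F ((t - c') / \<sigma>') = 0"
  using assms(7)
proof
  assume "t < l"
  then have "(t - c) / \<sigma> \<le> -1" "(t - c') / \<sigma>' \<le> -1" using assms by (auto simp: divide_le_eq)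
  then show ?thesis by (simp add: F_left)
next
  assume "t > h"
  then have "(t - c) / \<sigma> \<ge> 1" "(t - c') / \<sigma>' \<ge> 1" using assms by (auto simp: le_divide_eq)
  then show ?thesis by (simp add: F_right)
qed

lemma bump_measurable[measurable]: "bump c \<sigma> \<in> borel_measurable borel"
proof -
  have "continuous_on UNIV (bump c \<sigma>)"
    unfolding bump_def[abs_def]
    by (intro continuous_intros continuous_on_compose2[OF smooth1_continuous[OF bump1_smooth, of UNIV]]) auto
  then show ?thesis by (rule borel_measurable_continuous_onI)
qed

lemma bump_bounds: "\<sigma> > 0 \<Longrightarrow> 0 \<le> bump c \<sigma> x \<and> bump c \<sigma> x \<le> (S / \<sigma>)\<^sup>2"
  using bump1_bounds[of \<sigma> "c $ 1" "x $ 1"] bump1_bounds[of \<sigma> "c $ 2" "x $ 2"]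
    mult_mono[of "bump1 (c $ 1) \<sigma> (x $ 1)" "S / \<sigma>" "bump1 (c $ 2) \<sigma> (x $ 2)" "S / \<sigma>"]
  by (simp add: bump_def power2_eq_square)

text \<open>A mean up to normalisation: the mass of the bump is not divided out, which is why
  \<open>bump_mass * u x\<close> appears as the limit later.\<close>

definition bump_mean :: "R2 set \<Rightarrow> (R2 \<Rightarrow> real) \<Rightarrow> R2 \<Rightarrow> real \<Rightarrow> real" where
  "bump_mean \<Omega> u c \<sigma> = (\<integral>x. u x * bump c \<sigma> x \<partial>lebesgue_on \<Omega>)"

lemma bump_integrable:
  assumes "integrable (lebesgue_on \<Omega>) u" "\<sigma> > 0"
  shows "integrable (lebesgue_on \<Omega>) (\<lambda>x. u x * bump c \<sigma> x)"
  using assms bump_bounds[OF assms(2), of c] borel_measurable_lebesgue_on[OF bump_measurable]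
  by (intro integrable_mult_bounded[where B="(S/\<sigma>)\<^sup>2"]) auto

text \<open>The difference of two bumps is a divergence: change one coordinate at a time.\<close>

lemma bump_mean_transfer:
  assumes u: "weak_gradient \<Omega> u g" "integrable (lebesgue_on \<Omega>) u" "integrable (lebesgue_on \<Omega>) (\<lambda>x. norm (g x))"
    and pos: "\<sigma> > 0" "\<sigma>' > 0" and sub: "cbox l h \<subseteq> \<Omega>"
    and b: "\<And>i. l $ i \<le> c $ i - \<sigma>" "\<And>i. c $ i + \<sigma> \<le> h $ i" "\<And>i. l $ i \<le> c' $ i - \<sigma>'" "\<And>i. c' $ i + \<sigma>' \<le> h $ i"
  shows "\<bar>bump_mean \<Omega> u c \<sigma> - bump_mean \<Omega> u c' \<sigma>'\<bar> \<le> S * (1/\<sigma> + 1/\<sigma>') * (\<integral>x. norm (g x) * indicator (cbox l h) x \<partial>lebesgue_on \<Omega>)"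
proof -
  let ?I = "\<integral>x. norm (g x) * indicator (cbox l h) x \<partial>lebesgue_on \<Omega>"
  define A where "A i t = F ((t - c $ i) / \<sigma>) - F ((t - c' $ i) / \<sigma>')" for i t
  have A: "smooth1 (A i)" "\<And>t. (A i has_real_derivative bump1 (c $ i) \<sigma> t - bump1 (c' $ i) \<sigma>' t) (at t)"
     "\<And>t. t < l $ i \<or> t > h $ i \<Longrightarrow> A i t = 0" for i
  proof -
    show "smooth1 (A i)" unfolding A_def[abs_def] by (intro smooth1_diff step_smooth)
    show "(A i has_real_derivative bump1 (c $ i) \<sigma> t - bump1 (c' $ i) \<sigma>' t) (at t)" for t
      unfolding A_def[abs_def] by (intro DERIV_diff step_deriv)
    show "A i t = 0" if "t < l $ i \<or> t > h $ i" for t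
      unfolding A_def by (rule step_diff_out[OF pos b(1-4) that])
  qed
  have A1: "\<bar>A i t\<bar> \<le> 1" for i t
    using F_nonneg[of "(t - c $ i) / \<sigma>"] F_nonneg[of "(t - c' $ i) / \<sigma>'"] F_le1[of "(t - c $ i) / \<sigma>"] F_le1[of "(t - c' $ i) / \<sigma>'"]
    unfolding A_def by linarith
  obtain d1 where d1: "\<And>t. (bump1 (c $ 2) \<sigma> has_real_derivative d1 t) (at t)" using smooth1_derivE[OF bump1_smooth] by metis
  obtain d2 where d2: "\<And>t. (bump1 (c' $ 1) \<sigma>' has_real_derivative d2 t) (at t)" using smooth1_derivE[OF bump1_smooth] by metis
  have z1: "bump1 (c $ 2) \<sigma> t = 0" if "t < l $ 2 \<or> t > h $ 2" for t
    using that b(1,2)[of 2] by (intro bump1_out pos) linarith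
  have z2: "bump1 (c' $ 1) \<sigma>' t = 0" if "t < l $ 1 \<or> t > h $ 1" for t
    using that b(3,4)[of 1] by (intro bump1_out pos) linarith
  \<comment> \<open>The mixed product has its first factor from \<open>c'\<close> and its second
    from \<open>c\<close>. Differentiating \<open>\<phi>1\<close> in direction 1 gives the bump at
    \<open>c\<close> minus the mixed product; differentiating \<open>\<phi>2\<close> in direction 2
    gives the mixed product minus the bump at \<open>c'\<close>.\<close>
  define \<phi>1 where "\<phi>1 x = A 1 (x $ 1) * bump1 (c $ 2) \<sigma> (x $ 2)" for x :: R2
  define \<phi>2 where "\<phi>2 x = bump1 (c' $ 1) \<sigma>' (x $ 1) * A 2 (x $ 2)" for x :: R2
  note t1 = product_test_function[where l=l and h=h, OF A(1)[of 1] A(2)[of 1] bump1_smooth d1 A(3)[of _ 1] z1 sub, folded \<phi>1_def[abs_def]]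
  note t2 = product_test_function[where l=l and h=h, OF bump1_smooth d2 A(1)[of 2] A(2)[of 2] z2 A(3)[of _ 2] sub, folded \<phi>2_def[abs_def]]
  have f1: "frechet_derivative \<phi>1 (at x) (axis 1 1) = (bump1 (c $ 1) \<sigma> (x $ 1) - bump1 (c' $ 1) \<sigma>' (x $ 1)) * bump1 (c $ 2) \<sigma> (x $ 2)" for x
    by (rule t1(2))
  have f2: "frechet_derivative \<phi>2 (at x) (axis 2 1) = bump1 (c' $ 1) \<sigma>' (x $ 1) * (bump1 (c $ 2) \<sigma> (x $ 2) - bump1 (c' $ 2) \<sigma>' (x $ 2))" for x
    by (rule t2(3))
  have w: "(\<integral>x. u x * frechet_derivative \<phi> (at x) (axis i 1) \<partial>lebesgue_on \<Omega>) = - (\<integral>x. (g x $ i) * \<phi> x \<partial>lebesgue_on \<Omega>)"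
    if "test_function \<Omega> \<phi>" for \<phi> i using u(1) that by (simp add: weak_gradient_def)
  have mix: "integrable (lebesgue_on \<Omega>) (\<lambda>x. u x * (bump1 (c' $ 1) \<sigma>' (x $ 1) * bump1 (c $ 2) \<sigma> (x $ 2)))"
  proof (rule integrable_mult_bounded[OF u(2), where B="(S/\<sigma>') * (S/\<sigma>)"])
    have "continuous_on UNIV (\<lambda>x::R2. bump1 (c' $ 1) \<sigma>' (x $ 1) * bump1 (c $ 2) \<sigma> (x $ 2))"
      by (intro continuous_intros continuous_on_compose2[OF smooth1_continuous[OF bump1_smooth, of UNIV]]) auto
    then show "(\<lambda>x. bump1 (c' $ 1) \<sigma>' (x $ 1) * bump1 (c $ 2) \<sigma> (x $ 2)) \<in> borel_measurable (lebesgue_on \<Omega>)"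
      by (intro borel_measurable_lebesgue_on borel_measurable_continuous_onI)
    show "\<bar>bump1 (c' $ 1) \<sigma>' (x $ 1) * bump1 (c $ 2) \<sigma> (x $ 2)\<bar> \<le> (S/\<sigma>') * (S/\<sigma>)" for x :: R2
      using bump1_bounds[OF pos(2)] bump1_bounds[OF pos(1)] unfolding abs_mult by (intro mult_mono) (auto simp: S_pos less_imp_le pos)
  qed
  have "bump_mean \<Omega> u c \<sigma> - bump_mean \<Omega> u c' \<sigma>' =
     (\<integral>x. u x * frechet_derivative \<phi>1 (at x) (axis 1 1) \<partial>lebesgue_on \<Omega>) + (\<integral>x. u x * frechet_derivative \<phi>2 (at x) (axis 2 1) \<partial>lebesgue_on \<Omega>)"
    unfolding f1 f2 bump_mean_def left_diff_distrib right_diff_distrib bump_def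
    using bump_integrable[OF u(2) pos(1), of c] bump_integrable[OF u(2) pos(2), of c'] mix
    by (simp add: bump_def)
  also have "\<dots> = - (\<integral>x. (g x $ 1) * \<phi>1 x \<partial>lebesgue_on \<Omega>) - (\<integral>x. (g x $ 2) * \<phi>2 x \<partial>lebesgue_on \<Omega>)"
    using w[OF t1(1)] w[OF t2(1)] by simp
  finally have eq: "bump_mean \<Omega> u c \<sigma> - bump_mean \<Omega> u c' \<sigma>' = \<dots>" .
  \<comment> \<open>A difference of steps is at most 1 in absolute value and the remaining bump
    factor at most \<open>S / s\<close>; \<open>\<phi>1\<close> carries the scale
    \<open>\<sigma>\<close> and \<open>\<phi>2\<close> the scale \<open>\<sigma>'\<close>, hence the
    two summands of the constant.\<close>
  have est: "\<bar>\<integral>x. (g x $ i) * \<phi> x \<partial>lebesgue_on \<Omega>\<bar> \<le> S / s * ?I"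
    if \<phi>: "\<And>x. \<bar>\<phi> x\<bar> \<le> S / s * indicator (cbox l h) x" and "s > 0" for i \<phi> s
  proof -
    have i: "integrable (lebesgue_on \<Omega>) (\<lambda>x. S / s * (norm (g x) * indicator (cbox l h) x))"
      by (intro integrable_mult_right integrable_mult_bounded[OF u(3), where B=1] borel_measurable_lebesgue_on) (auto simp: indicator_def)
    have "\<bar>\<integral>x. (g x $ i) * \<phi> x \<partial>lebesgue_on \<Omega>\<bar> \<le> (\<integral>x. \<bar>(g x $ i) * \<phi> x\<bar> \<partial>lebesgue_on \<Omega>)"
      using integral_norm_bound[of "lebesgue_on \<Omega>" "\<lambda>x. (g x $ i) * \<phi> x"] by simp
    also have "\<dots> \<le> (\<integral>x. S / s * (norm (g x) * indicator (cbox l h) x) \<partial>lebesgue_on \<Omega>)"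
    proof (rule integral_mono'[OF i])
      fix x
      have "\<bar>g x $ i\<bar> * \<bar>\<phi> x\<bar> \<le> norm (g x) * (S / s * indicator (cbox l h) x)"
        using component_le_norm_cart[of "g x" i] \<phi>[of x] by (intro mult_mono) auto
      then show "\<bar>g x $ i * \<phi> x\<bar> \<le> S / s * (norm (g x) * indicator (cbox l h) x)" by (simp add: abs_mult mult_ac)
    qed (use S_pos \<open>s > 0\<close> in simp)
    finally show ?thesis by simp
  qed
  have "\<bar>\<phi>1 x\<bar> \<le> S / \<sigma> * indicator (cbox l h) x" for x
  proof (cases "x \<in> cbox l h")
    case True
    then show ?thesis using mult_mono[OF A1[of 1 "x $ 1"], of "\<bar>bump1 (c $ 2) \<sigma> (x $ 2)\<bar>" "S/\<sigma>"] bump1_bounds[OF pos(1)]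
      by (simp add: \<phi>1_def abs_mult)
  next
    case False
    then show ?thesis using A(3)[of "x $ 1" 1] z1[of "x $ 2"] by (auto simp: \<phi>1_def mem_cbox_R2)
  qed
  note e1 = est[OF this pos(1), of 1]
  have "\<bar>\<phi>2 x\<bar> \<le> S / \<sigma>' * indicator (cbox l h) x" for x
  proof (cases "x \<in> cbox l h")
    case True
    then show ?thesis using mult_mono[OF _ A1[of 2 "x $ 2"], of "\<bar>bump1 (c' $ 1) \<sigma>' (x $ 1)\<bar>" "S/\<sigma>'"] bump1_bounds[OF pos(2)] S_pos pos
      by (simp add: \<phi>2_def abs_mult)
  next
    case False
    then show ?thesis using A(3)[of "x $ 2" 2] z2[of "x $ 1"] by (auto simp: \<phi>2_def mem_cbox_R2)
  qed
  note e2 = est[OF this pos(2), of 2]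
  have "S * (1/\<sigma> + 1/\<sigma>') * ?I = S / \<sigma> * ?I + S / \<sigma>' * ?I" by (simp add: algebra_simps)
  then show ?thesis using e1 e2 unfolding eq by linarith
qed

end

section \<open>Chains of bumps and interior cones\<close>

text \<open>Balls of the maximum norm, fitting the supports of product bumps;
  \<open>\<sigma>\<close> is half the side length.\<close>

abbreviation square :: "R2 \<Rightarrow> real \<Rightarrow> R2 set" where
  "square x \<sigma> \<equiv> cbox (x - vec \<sigma>) (x + vec \<sigma>)"

lemma mem_square: "y \<in> square x \<sigma> \<longleftrightarrow> \<bar>y $ 1 - x $ 1\<bar> \<le> \<sigma> \<and> \<bar>y $ 2 - x $ 2\<bar> \<le> \<sigma>"
  by (auto simp: mem_cbox_R2)

lemma square_subset_open:
  assumes "open A" "x \<in> A"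
  obtains \<sigma> where "\<sigma> > 0" "square x \<sigma> \<subseteq> A"
proof -
  obtain e where e: "e > 0" "ball x e \<subseteq> A" using assms open_contains_ball by blast
  have "square x (e/3) \<subseteq> ball x e"
  proof
    fix y assume "y \<in> square x (e/3)"
    then have "\<bar>(y - x) $ 1\<bar> \<le> e/3" "\<bar>(y - x) $ 2\<bar> \<le> e/3" by (auto simp: mem_square)
    then have "norm (y - x) \<le> e/3 + e/3" using norm_le_l1_cart[of "y - x"] by (simp add: sum_2)
    then show "y \<in> ball x e" using e by (simp add: dist_norm norm_minus_commute)
  qed
  with e that[of "e/3"] show ?thesis by auto
qed

locale R2_smooth_step = R2_domain \<Omega> + smooth_step F \<beta> S for \<Omega> F \<beta> S
begin

lemma H1_pairD:
  assumes "H1_pair \<Omega> u g"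
  shows "weak_gradient \<Omega> u g" "integrable (lebesgue_on \<Omega>) u" "integrable (lebesgue_on \<Omega>) (\<lambda>x. norm (g x))"
proof -
  from assms have a: "u \<in> borel_measurable (lebesgue_on \<Omega>)" "integrable (lebesgue_on \<Omega>) (\<lambda>x. (u x)\<^sup>2)" "weak_gradient \<Omega> u g"
    unfolding H1_pair_def by blast+
  show "weak_gradient \<Omega> u g" by (rule a)
  show "integrable (lebesgue_on \<Omega>) u" by (rule integrable_of_square[OF a(1,2)])
  show "integrable (lebesgue_on \<Omega>) (\<lambda>x. norm (g x))" by (rule integrable_norm_gradient[OF a(3)])
qed

lemma gradient_L1_le_energy:
  assumes "weak_gradient \<Omega> u g" 
  shows "(\<integral>x. norm (g x) \<partial>lebesgue_on \<Omega>) \<le> sqrt (measure lebesgue \<Omega>) * sqrt (energy \<Omega> g)"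
proof -
  note d = weak_gradientD[OF assms]
  have "(\<integral>x. norm (g x) * 1 \<partial>lebesgue_on \<Omega>)\<^sup>2 \<le> (\<integral>x. (norm (g x))\<^sup>2 \<partial>lebesgue_on \<Omega>) * (\<integral>x. 1\<^sup>2 \<partial>lebesgue_on \<Omega>)"
    by (rule integral_square_le[OF d(1) _ measurable_compose[OF d(2) borel_measurable_norm]]) auto
  also have "\<dots> = energy \<Omega> g * measure lebesgue \<Omega>"
    by (simp add: energy_def measure_restrict_space)
  finally have "\<bar>\<integral>x. norm (g x) \<partial>lebesgue_on \<Omega>\<bar> \<le> sqrt (energy \<Omega> g * measure lebesgue \<Omega>)"
    using real_le_rsqrt by fastforce
  then show ?thesis by (simp add: real_sqrt_mult mult.commute)
qed

lemma bump_mean_transfer_energy: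
  assumes u: "H1_pair \<Omega> u g"
    and pos: "\<sigma> > 0" "\<sigma>' > 0" and sub: "square a s \<subseteq> \<Omega>"
    and b: "square c \<sigma> \<subseteq> square a s" "square c' \<sigma>' \<subseteq> square a s"
  shows "\<bar>bump_mean \<Omega> u c \<sigma> - bump_mean \<Omega> u c' \<sigma>'\<bar> \<le> S * (1/\<sigma> + 1/\<sigma>') * sqrt (measure lebesgue \<Omega>) * sqrt (energy \<Omega> g)"
proof -
  note h = H1_pairD[OF u]
  have e: "c - vec \<sigma> \<in> square a s" "c + vec \<sigma> \<in> square a s" "c' - vec \<sigma>' \<in> square a s" "c' + vec \<sigma>' \<in> square a s"
    by (rule subsetD[OF b(1)] subsetD[OF b(2)], use pos in \<open>simp add: mem_square\<close>)+
  have "\<bar>bump_mean \<Omega> u c \<sigma> - bump_mean \<Omega> u c' \<sigma>'\<bar> \<le> S * (1/\<sigma> + 1/\<sigma>') * (\<integral>x. norm (g x) * indicator (square a s) x \<partial>lebesgue_on \<Omega>)"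
    using e by (intro bump_mean_transfer[OF h pos sub]) (auto simp: mem_box_cart)
  also have "\<dots> \<le> S * (1/\<sigma> + 1/\<sigma>') * (\<integral>x. norm (g x) \<partial>lebesgue_on \<Omega>)"
    using S_pos pos h(3) by (intro mult_left_mono integral_mono') (auto simp: indicator_def)
  also have "\<dots> \<le> S * (1/\<sigma> + 1/\<sigma>') * (sqrt (measure lebesgue \<Omega>) * sqrt (energy \<Omega> g))"
    using S_pos pos gradient_L1_le_energy[OF h(1)] by (intro mult_left_mono) auto
  finally show ?thesis by (simp add: mult.assoc)
qed

text \<open>Being comparable with a constant uniform in \<open>u\<close> is an equivalence relation
  between points. Near each point it holds because two bumps in one square inside the domain can be
  compared directly; connectedness then leaves a single class, with no explicit chain of
  squares.\<close>

lemma bump_mean_connected: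
  assumes conn: "connected \<Omega>" and ab: "a \<in> \<Omega>" "b \<in> \<Omega>" and pos: "\<sigma> > 0" "\<sigma>' > 0"
    and sub: "square a \<sigma> \<subseteq> \<Omega>" "square b \<sigma>' \<subseteq> \<Omega>"
  obtains C where "\<And>u g. H1_pair \<Omega> u g \<Longrightarrow> \<bar>bump_mean \<Omega> u a \<sigma> - bump_mean \<Omega> u b \<sigma>'\<bar> \<le> C * sqrt (energy \<Omega> g)"
proof -
  define near where "near a \<sigma> b \<sigma>' \<longleftrightarrow> (\<exists>C. \<forall>u g. H1_pair \<Omega> u g \<longrightarrow> \<bar>bump_mean \<Omega> u a \<sigma> - bump_mean \<Omega> u b \<sigma>'\<bar> \<le> C * sqrt (energy \<Omega> g))"
    for a b :: R2 and \<sigma> \<sigma>' :: real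
  have near_sym: "near b \<sigma>' a \<sigma>" if "near a \<sigma> b \<sigma>'" for a b \<sigma> \<sigma>'
    using that unfolding near_def by (simp add: abs_minus_commute)
  have near_trans: "near a \<sigma> c \<sigma>''" if n: "near a \<sigma> b \<sigma>'" "near b \<sigma>' c \<sigma>''" for a b c \<sigma> \<sigma>' \<sigma>''
  proof -
    from n obtain C D where CD: "\<And>u g. H1_pair \<Omega> u g \<Longrightarrow> \<bar>bump_mean \<Omega> u a \<sigma> - bump_mean \<Omega> u b \<sigma>'\<bar> \<le> C * sqrt (energy \<Omega> g)"
       "\<And>u g. H1_pair \<Omega> u g \<Longrightarrow> \<bar>bump_mean \<Omega> u b \<sigma>' - bump_mean \<Omega> u c \<sigma>''\<bar> \<le> D * sqrt (energy \<Omega> g)"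
      unfolding near_def by blast
    have "\<bar>bump_mean \<Omega> u a \<sigma> - bump_mean \<Omega> u c \<sigma>''\<bar> \<le> (C + D) * sqrt (energy \<Omega> g)" if "H1_pair \<Omega> u g" for u g
      using CD(1)[OF that] CD(2)[OF that] by (simp add: distrib_right)
    then show ?thesis unfolding near_def by blast
  qed
  have near_in: "near c \<sigma> c' \<sigma>'" if "\<sigma> > 0" "\<sigma>' > 0" "square a s \<subseteq> \<Omega>" "square c \<sigma> \<subseteq> square a s" "square c' \<sigma>' \<subseteq> square a s" for c c' \<sigma> \<sigma>' a s
    using bump_mean_transfer_energy[OF _ that] unfolding near_def by blast
  have conc: "near c \<sigma> c \<sigma>'" if "\<sigma> > 0" "\<sigma>' > 0" "square c \<sigma> \<subseteq> \<Omega>" "square c \<sigma>' \<subseteq> \<Omega>" for c \<sigma> \<sigma>'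
  proof (rule near_in[OF that(1,2), of c "max \<sigma> \<sigma>'"])
    show "square c (max \<sigma> \<sigma>') \<subseteq> \<Omega>" using that by (auto simp: max_def)
  qed (auto simp: subset_iff mem_square)
  \<comment> \<open>Quantification over all admissible scales makes this a relation between points
    alone; transitivity inserts some admissible square at the middle point.\<close>
  define R where "R a b \<longleftrightarrow> (\<forall>\<sigma>>0. \<forall>\<sigma>'>0. square a \<sigma> \<subseteq> \<Omega> \<longrightarrow> square b \<sigma>' \<subseteq> \<Omega> \<longrightarrow> near a \<sigma> b \<sigma>')" for a b
  have "R a b"
  proof (rule connected_equivalence_relation[OF conn ab])
    show "R y x" if "R x y" for x y using that near_sym unfolding R_def by blast
    show "R x z" if xy: "R x y" "R y z" "x \<in> \<Omega>" "y \<in> \<Omega>" "z \<in> \<Omega>" for x y z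
    proof -
      obtain \<tau> where t: "\<tau> > 0" "square y \<tau> \<subseteq> \<Omega>" using square_subset_open[OF open_dom xy(4)] by blast
      show ?thesis
        unfolding R_def
      proof (intro allI impI)
        fix \<sigma> \<sigma>' :: real assume s: "0 < \<sigma>" "0 < \<sigma>'" "square x \<sigma> \<subseteq> \<Omega>" "square z \<sigma>' \<subseteq> \<Omega>"
        show "near x \<sigma> z \<sigma>'"
          by (rule near_trans[OF xy(1)[unfolded R_def, rule_format, OF s(1) t(1) s(3) t(2)] xy(2)[unfolded R_def, rule_format, OF t(1) s(2) t(2) s(4)]])
      qed
    qed
    show "\<exists>T. openin (top_of_set \<Omega>) T \<and> x \<in> T \<and> (\<forall>y\<in>T. R x y)" if x\<Omega>: "x \<in> \<Omega>" for x
    proof -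
      obtain \<tau> where t: "\<tau> > 0" "square x \<tau> \<subseteq> \<Omega>" using square_subset_open[OF open_dom x\<Omega>] by blast
      \<comment> \<open>Half the radius: squares of radius \<open>\<tau>/2\<close> around points of
        \<open>T\<close> stay inside \<open>square x \<tau>\<close>.\<close>
      define T where "T = box (x - vec (\<tau>/2)) (x + vec (\<tau>/2))"
      have Ty: "square y (\<tau>/2) \<subseteq> square x \<tau>" if "y \<in> T" for y
      proof
        fix z assume z: "z \<in> square y (\<tau>/2)"
        have "\<bar>y $ 1 - x $ 1\<bar> \<le> \<tau>/2" "\<bar>y $ 2 - x $ 2\<bar> \<le> \<tau>/2"
          using that unfolding T_def mem_box_cart forall_2 abs_le_iff vector_add_component vector_minus_component vec_component by linarith+
        with z show "z \<in> square x \<tau>" unfolding mem_square by linarith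
      qed
      have TO: "T \<subseteq> \<Omega>"
      proof
        fix y assume "y \<in> T"
        moreover have "y \<in> square y (\<tau>/2)" using t by (simp add: mem_square)
        ultimately show "y \<in> \<Omega>" using Ty t by blast
      qed
      have "R x y" if "y \<in> T" for y
        unfolding R_def
      proof (intro allI impI)
        fix \<sigma> \<sigma>' :: real assume s: "0 < \<sigma>" "0 < \<sigma>'" "square x \<sigma> \<subseteq> \<Omega>" "square y \<sigma>' \<subseteq> \<Omega>"
        have "near x \<sigma> x \<tau>" by (rule conc) (use s t in auto)
        moreover have "near x \<tau> y (\<tau>/2)" by (rule near_in[OF _ _ t(2)]) (use t Ty[OF that] in auto)
        moreover have "near y (\<tau>/2) y \<sigma>'" by (rule conc) (use s t Ty[OF that] in auto)
        ultimately show "near x \<sigma> y \<sigma>'" by (intro near_trans[of x \<sigma> y "\<tau>/2" y \<sigma>'] near_trans[of x \<sigma> x \<tau> y "\<tau>/2"])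
      qed
      moreover have "openin (top_of_set \<Omega>) T" using TO by (simp add: T_def openin_open_eq[OF open_dom] open_box)
      moreover have "x \<in> T" using t by (simp add: T_def mem_box_cart)
      ultimately show ?thesis by blast
    qed
  qed
  then show ?thesis using that pos sub unfolding R_def near_def by blast
qed

end

text \<open>Where \<open>\<rho>\<close> vanishes, some partial derivative is nonzero near
  \<open>x0\<close>, so \<open>\<rho>\<close> decreases along all directions close to a suitable
  coordinate direction \<open>d\<close>, and segments starting in the domain stay there. The box of
  directions spans \<open>d\<close> and \<open>d / 2\<close> with margin \<open>\<kappa>\<close>,
  because it has to contain two consecutive dyadic bumps of a chain.\<close>

lemma interior_cone:
  assumes dom: "smooth_bounded_domain \<Omega>" and x0: "x0 \<in> closure \<Omega>"
  obtains d :: R2 and \<kappa> r \<delta> :: real where "\<kappa> > 0" "\<kappa> \<le> 1/4" "r > 0" "\<delta> > 0" "\<And>i. \<bar>d $ i\<bar> \<le> 1"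
    "\<And>x t y. x \<in> \<Omega> \<Longrightarrow> x \<in> ball x0 \<delta> \<Longrightarrow> 0 < t \<Longrightarrow> t \<le> r \<Longrightarrow>
       (\<And>i. min (d $ i) (d $ i / 2) - \<kappa> \<le> y $ i \<and> y $ i \<le> max (d $ i) (d $ i / 2) + \<kappa>) \<Longrightarrow> x + t *\<^sub>R y \<in> \<Omega>"
proof -
  obtain \<rho> where \<rho>: "smooth_on UNIV \<rho>" "\<Omega> = {x. \<rho> x < 0}" "\<And>x. \<rho> x = 0 \<Longrightarrow> frechet_derivative \<rho> (at x) \<noteq> (\<lambda>v. 0)"
    and op: "open \<Omega>" using dom unfolding smooth_bounded_domain_def by blast
  have normy: "norm y \<le> 3" if "\<kappa> \<le> 1/4" "\<And>i. \<bar>d $ i\<bar> \<le> 1"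
     "\<And>i. min (d $ i) (d $ i / 2) - \<kappa> \<le> y $ i \<and> y $ i \<le> max (d $ i) (d $ i / 2) + \<kappa>" for y d :: R2 and \<kappa>
  proof -
    have "\<bar>y $ i\<bar> \<le> 3/2" for i
      using that(2)[of i] that(3)[of i] that(1) by (auto simp: min_def max_def abs_le_iff split: if_splits)
    from this[of 1] this[of 2] show ?thesis using norm_le_l1_cart[of y] by (simp add: sum_2)
  qed
  \<comment> \<open>The displacement is less than \<open>\<epsilon>/2\<close> from the centre to
    \<open>x\<close> and at most \<open>3 * \<epsilon>/12\<close> along the segment, less than
    \<open>\<epsilon>\<close> together.\<close>
  have near: "x + s *\<^sub>R y \<in> ball x0 \<epsilon>" if "x \<in> ball x0 (\<epsilon>/2)" "norm y \<le> 3" "0 \<le> s" "s \<le> \<epsilon>/12" "\<epsilon> > 0" for x y :: R2 and s \<epsilon>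
  proof -
    have n: "norm (s *\<^sub>R y) \<le> (\<epsilon>/12) * 3" unfolding norm_scaleR using that by (intro mult_mono) auto
    have "norm (x0 - (x + s *\<^sub>R y)) \<le> norm (x0 - x) + norm (s *\<^sub>R y)"
      using norm_triangle_ineq4[of "x0 - x" "s *\<^sub>R y"] by (simp add: diff_diff_eq)
    moreover have "norm (x0 - x) < \<epsilon>/2" using that(1) by (simp add: dist_norm)
    ultimately show ?thesis using n \<open>\<epsilon> > 0\<close> unfolding mem_ball dist_norm by linarith
  qed
  show ?thesis
  proof (cases "\<rho> x0 = 0")
    case False
    have "\<rho> x0 \<le> 0"
    proof -
      have "closed {x. \<rho> x \<le> 0}" using smooth_on_continuous[OF \<rho>(1)] by (intro closed_Collect_le) auto
      then have "closure \<Omega> \<subseteq> {x. \<rho> x \<le> 0}" by (intro closure_minimal) (auto simp: \<rho>(2))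
      then show ?thesis using x0 by auto
    qed
    with False have "x0 \<in> \<Omega>" by (auto simp: \<rho>(2))
    then obtain \<epsilon> where e: "\<epsilon> > 0" "ball x0 \<epsilon> \<subseteq> \<Omega>" using op open_contains_ball by blast
    \<comment> \<open>An interior point admits every direction; the first coordinate axis is an
      arbitrary choice.\<close>
    show ?thesis
    proof (rule that[of "1/4" "\<epsilon>/12" "\<epsilon>/2" "axis 1 1"])
      show ax: "\<bar>(axis 1 1 :: R2) $ i\<bar> \<le> 1" for i by (simp add: axis_def)
      fix x y :: R2 and t assume a: "x \<in> \<Omega>" "x \<in> ball x0 (\<epsilon>/2)" "0 < t" "t \<le> \<epsilon>/12"
        "\<And>i. min ((axis 1 1 :: R2) $ i) ((axis 1 1 :: R2) $ i / 2) - 1/4 \<le> y $ i \<and> y $ i \<le> max ((axis 1 1 :: R2) $ i) ((axis 1 1 :: R2) $ i / 2) + 1/4"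
      have "norm y \<le> 3" by (rule normy[OF _ ax a(5)]) simp
      from near[OF a(2) this] a(3,4) e show "x + t *\<^sub>R y \<in> \<Omega>" by auto
    qed (use e in auto)
  next
    case True
    define P where "P i x = frechet_derivative \<rho> (at x) (axis i 1)" for i x
    have Pc: "continuous_on UNIV (P i)" for i unfolding P_def[abs_def] by (rule smooth_on_continuous_frechet[OF \<rho>(1)])
    have D: "(\<rho> has_derivative (\<lambda>v. v $ 1 * P 1 x + v $ 2 * P 2 x)) (at x)" for x
    proof -
      note h = smooth_on_has_derivative[OF \<rho>(1), of x]
      have "frechet_derivative \<rho> (at x) v = v $ 1 * P 1 x + v $ 2 * P 2 x" for v
      proof -
        have "v = v $ 1 *\<^sub>R axis 1 1 + v $ 2 *\<^sub>R axis 2 1" by (simp add: vec_eq_iff forall_2 axis_def)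
        then have "frechet_derivative \<rho> (at x) v = frechet_derivative \<rho> (at x) (v $ 1 *\<^sub>R axis 1 1 + v $ 2 *\<^sub>R axis 2 1)" by simp
        also have "\<dots> = v $ 1 * P 1 x + v $ 2 * P 2 x"
          using has_derivative_linear[OF h] by (simp add: linear_add linear_scale P_def)
        finally show ?thesis .
      qed
      then show ?thesis using h by (metis (no_types, lifting) ext)
    qed
    have "\<exists>j. P j x0 \<noteq> 0"
    proof (rule ccontr)
      assume "\<not> ?thesis"
      then have "(\<rho> has_derivative (\<lambda>v. 0)) (at x0)" using D[of x0] by simp
      then show False using \<rho>(3)[OF True] frechet_derivative_at by metis
    qed
    then obtain j where j: "P j x0 \<noteq> 0" by blast
    have "(1 :: 2) \<noteq> 2" by simp
    then obtain i where i: "i \<noteq> j" by metis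
    have v12: "v $ 1 * P 1 x + v $ 2 * P 2 x = v $ j * P j x + v $ i * P i x" for v x :: R2
      using i exhaust_2[of i] exhaust_2[of j] by auto
    \<comment> \<open>\<open>s\<close> orients the axis so that \<open>\<rho>\<close> decreases with
      slope \<open>m\<close> at \<open>x0\<close>, and \<open>M\<close> bounds the other partial
      derivative nearby. A coordinate axis is taken instead of the gradient itself, to keep the box
      of directions parallel to the bumps.\<close>
    define s m M where "s = - sgn (P j x0)" and "m = \<bar>P j x0\<bar>" and "M = \<bar>P i x0\<bar> + 1"
    \<comment> \<open>On the box, coordinate \<open>j\<close> contributes at most
      \<open>- (1/4) * (m/2)\<close> and coordinate \<open>i\<close> at most
      \<open>\<kappa> * M \<le> m/16\<close>, so the derivative of \<open>\<rho>\<close> stays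
      negative.\<close>
    define \<kappa> where "\<kappa> = min (1/4) (m / (16 * M))"
    define d where "d = s *\<^sub>R (axis j 1 :: R2)"
    have mM: "m > 0" "M > 0" using j by (auto simp: m_def M_def)
    have s1: "s = 1 \<or> s = -1" and sP: "s * P j x0 = - m" using j by (auto simp: s_def m_def sgn_if)
    have k: "\<kappa> > 0" "\<kappa> \<le> 1/4" "\<kappa> * M \<le> m / 16"
    proof -
      show "\<kappa> > 0" "\<kappa> \<le> 1/4" using mM by (auto simp: \<kappa>_def)
      have "\<kappa> * M \<le> m / (16 * M) * M" using mM by (intro mult_right_mono) (auto simp: \<kappa>_def)
      then show "\<kappa> * M \<le> m / 16" using mM by simp
    qed
    have dj: "d $ j = s" "d $ i = 0" using i by (auto simp: d_def axis_def)
    have d1: "\<bar>d $ l\<bar> \<le> 1" for l using s1 by (auto simp: d_def axis_def)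
    obtain e1 where e1: "e1 > 0" "\<And>x. x \<in> ball x0 e1 \<Longrightarrow> \<bar>P j x - P j x0\<bar> < m/2"
      using Pc[of j] mM unfolding continuous_on_iff by (metis UNIV_I half_gt_zero mem_ball dist_commute dist_real_def)
    obtain e2 where e2: "e2 > 0" "\<And>x. x \<in> ball x0 e2 \<Longrightarrow> \<bar>P i x - P i x0\<bar> < 1"
      using Pc[of i] unfolding continuous_on_iff by (metis UNIV_I zero_less_one mem_ball dist_commute dist_real_def)
    define \<epsilon> where "\<epsilon> = min e1 e2"
    have e: "\<epsilon> > 0" using e1 e2 by (simp add: \<epsilon>_def)
    have neg: "y $ 1 * P 1 x + y $ 2 * P 2 x < 0" if x: "x \<in> ball x0 \<epsilon>"
      and y: "\<And>i. min (d $ i) (d $ i / 2) - \<kappa> \<le> y $ i \<and> y $ i \<le> max (d $ i) (d $ i / 2) + \<kappa>" for x y :: R2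
    proof -
      have a: "\<bar>P j x - P j x0\<bar> < m/2" "\<bar>P i x - P i x0\<bar> < 1" using e1(2)[of x] e2(2)[of x] x by (auto simp: \<epsilon>_def)
      have sy: "s * y $ j \<ge> 1/4" using y[of j] k(2) s1 unfolding dj by auto
      have "P j x0 - m/2 < P j x" "P j x < P j x0 + m/2" using a(1) by linarith+
      then have sPx: "s * P j x \<le> - (m/2)" using sP s1 by auto
      have "(s * y $ j) * (- (s * P j x)) \<ge> (1/4) * (m/2)" using sy sPx mM by (intro mult_mono) auto
      moreover have "(s * y $ j) * (s * P j x) = y $ j * P j x" using s1 by auto
      ultimately have j8: "y $ j * P j x \<le> - (m/8)" by simp
      have "\<bar>y $ i\<bar> \<le> \<kappa>" using y[of i] unfolding dj by auto
      moreover have "\<bar>P i x\<bar> \<le> M" using a(2) by (simp add: M_def)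
      ultimately have "\<bar>y $ i * P i x\<bar> \<le> \<kappa> * M" unfolding abs_mult using k(1) by (intro mult_mono) auto
      then have "y $ i * P i x \<le> m/16" using k(3) by linarith
      then show ?thesis using j8 mM unfolding v12 by linarith
    qed
    show ?thesis
    proof (rule that[of \<kappa> "\<epsilon>/12" "\<epsilon>/2" d])
      fix x y :: R2 and t assume a: "x \<in> \<Omega>" "x \<in> ball x0 (\<epsilon>/2)" "0 < t" "t \<le> \<epsilon>/12"
        "\<And>i. min (d $ i) (d $ i / 2) - \<kappa> \<le> y $ i \<and> y $ i \<le> max (d $ i) (d $ i / 2) + \<kappa>"
      have ny: "norm y \<le> 3" by (rule normy[OF k(2) d1 a(5)])
      have der: "((\<lambda>s. \<rho> (x + s *\<^sub>R y)) has_real_derivative (y $ 1 * P 1 (x + s *\<^sub>R y) + y $ 2 * P 2 (x + s *\<^sub>R y))) (at s)" for s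
      proof -
        have "((\<lambda>s. x + s *\<^sub>R y) has_derivative (\<lambda>h. h *\<^sub>R y)) (at s)" by (auto intro!: derivative_eq_intros)
        from has_derivative_compose[OF this D[of "x + s *\<^sub>R y"]]
        show ?thesis unfolding has_field_derivative_def
          by (rule has_derivative_eq_rhs) (auto simp: fun_eq_iff algebra_simps)
      qed
      have "\<rho> (x + t *\<^sub>R y) < \<rho> (x + 0 *\<^sub>R y)"
      proof (rule DERIV_neg_imp_decreasing[OF a(3)])
        fix u assume u: "0 \<le> u" "u \<le> t"
        have "x + u *\<^sub>R y \<in> ball x0 \<epsilon>" using near[OF a(2) ny u(1)] u a(4) e by auto
        from neg[OF this a(5)] der[of u] show "\<exists>z. ((\<lambda>s. \<rho> (x + s *\<^sub>R y)) has_real_derivative z) (at u) \<and> z < 0" by blast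
      qed
      then show "x + t *\<^sub>R y \<in> \<Omega>" using a(1) by (simp add: \<rho>(2))
    qed (use e k d1 in auto)
  qed
qed

section \<open>Borel representatives\<close>

lemma AE_lebesgue_on_iff:
  assumes "S \<in> sets borel"
  shows "(AE x in lebesgue_on S. P x) \<longleftrightarrow> (AE x in lborel. x \<in> S \<longrightarrow> P (x :: 'a::euclidean_space))"
  using assms by (simp add: AE_restrict_space_iff AE_completion_iff)

text \<open>Measurability for \<open>lebesgue_on\<close> refers to the completed measure, while
  Fubini, translations and the reflection are applied to Borel functions on \<open>lborel\<close>.
  Extension by zero puts the representative on the whole space.\<close>

lemma borel_representative:
  fixes u :: "'a::euclidean_space \<Rightarrow> real"
  assumes u: "u \<in> borel_measurable (lebesgue_on S)" and S[measurable]: "S \<in> sets borel"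
  obtains f where "f \<in> borel_measurable borel" "AE x in lborel. x \<in> S \<longrightarrow> u x = f x" "\<And>x. x \<notin> S \<Longrightarrow> f x = 0"
proof -
  have "(\<lambda>x. indicator S x *\<^sub>R u x) \<in> borel_measurable lebesgue"
    using u borel_measurable_restrict_space_iff[of S lebesgue u] by simp
  then obtain f0 where f0[measurable]: "f0 \<in> borel_measurable lborel" "AE x in lborel. indicator S x *\<^sub>R u x = f0 x"
    using completion_ex_borel_measurable_real by blast
  show ?thesis
  proof (rule that[of "\<lambda>x. indicator S x * f0 x"])
    show "AE x in lborel. x \<in> S \<longrightarrow> u x = indicator S x * f0 x"
      using f0(2) by eventually_elim auto
  qed (use f0(1) in auto)
qed

lemma lebesgue_on_representative:
  fixes p q :: "'a::euclidean_space \<Rightarrow> real"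
  assumes S[measurable]: "S \<in> sets borel" and p: "p \<in> borel_measurable (lebesgue_on S)"
    and q[measurable]: "q \<in> borel_measurable borel" and eq: "AE x in lborel. x \<in> S \<longrightarrow> p x = q x"
  shows "integrable (lebesgue_on S) p \<longleftrightarrow> integrable lborel (\<lambda>x. indicator S x * q x)"
    and "integral\<^sup>L (lebesgue_on S) p = (\<integral>x. indicator S x * q x \<partial>lborel)"
proof -
  have pm: "(\<lambda>x. indicator S x *\<^sub>R p x) \<in> borel_measurable lebesgue"
    using p borel_measurable_restrict_space_iff[of S lebesgue p] by simp
  have qm: "(\<lambda>x. indicator S x * q x) \<in> borel_measurable lebesgue" by (intro measurable_completion) simp
  have ae: "AE x in lebesgue. indicator S x *\<^sub>R p x = indicator S x * q x"
    unfolding AE_completion_iff using eq by eventually_elim (auto simp: indicator_def)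
  have "integrable (lebesgue_on S) p \<longleftrightarrow> integrable lebesgue (\<lambda>x. indicator S x *\<^sub>R p x)"
    by (rule integrable_restrict_space) simp
  also have "\<dots> \<longleftrightarrow> integrable lebesgue (\<lambda>x. indicator S x * q x)"
    by (rule integrable_cong_AE[OF pm qm ae])
  also have "\<dots> \<longleftrightarrow> integrable lborel (\<lambda>x. indicator S x * q x)" by (rule integrable_completion) simp
  finally show "integrable (lebesgue_on S) p \<longleftrightarrow> integrable lborel (\<lambda>x. indicator S x * q x)" .
  have "integral\<^sup>L (lebesgue_on S) p = (\<integral>x. indicator S x *\<^sub>R p x \<partial>lebesgue)"
    by (rule integral_restrict_space) simp
  also have "\<dots> = (\<integral>x. indicator S x * q x \<partial>lebesgue)" by (rule integral_cong_AE[OF pm qm ae])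
  also have "\<dots> = (\<integral>x. indicator S x * q x \<partial>lborel)" by (rule integral_completion) simp
  finally show "integral\<^sup>L (lebesgue_on S) p = (\<integral>x. indicator S x * q x \<partial>lborel)" .
qed

text \<open>Either \<open>y\<close> is at least its share \<open>q\<close> of the sum, or
  \<open>x\<close> exceeds its share \<open>1 - q\<close>; that summand then dominates the sum after
  division by its share.\<close>

lemma add_power_le_weighted:
  fixes x y q :: real
  assumes "x \<ge> 0" "y \<ge> 0" "0 < q" "q < 1"
  shows "(x + y) ^ n \<le> (x / (1 - q)) ^ n + (y / q) ^ n"
proof (cases "x \<le> (1 - q) * (x + y)")
  case True
  then have "q * (x + y) \<le> y" by (simp add: algebra_simps)
  then have "x + y \<le> y / q" using assms by (simp add: field_simps)
  then have "(x + y) ^ n \<le> (y / q) ^ n" using assms by (intro power_mono) auto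
  then show ?thesis using assms by (smt (verit) divide_nonneg_pos zero_le_power)
next
  case False
  then have "x + y \<le> x / (1 - q)" using assms by (simp add: field_simps)
  then have "(x + y) ^ n \<le> (x / (1 - q)) ^ n" using assms by (intro power_mono) auto
  then show ?thesis using assms by (smt (verit) divide_nonneg_pos zero_le_power)
qed

text \<open>Peel off the first term with a weight \<open>q\<close> satisfying \<open>q ^ Suc n \<ge> 1/2\<close>.\<close>

lemma sum_power_le:
  obtains L :: real where "L \<ge> 0" "\<And>K a. (\<And>k. a k \<ge> 0) \<Longrightarrow> (\<Sum>k<K. a k) ^ Suc n \<le> L * (\<Sum>k<K. 2 ^ k * a k ^ Suc n)"
proof -
  \<comment> \<open>Bernoulli gives \<open>q ^ Suc n \<ge> 1/2\<close>, so each peeling at most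
    doubles the tail. The doublings accumulate to the weights \<open>2 ^ k\<close>, which a later
    decay of order \<open>1 / 4 ^ k\<close> absorbs.\<close>
  define q :: real where "q = 1 - 1 / (2 * real (Suc n))"
  have q: "0 < q" "q < 1" by (auto simp: q_def field_simps)
  have "1 + real (Suc n) * (q - 1) \<le> (1 + (q - 1)) ^ Suc n" using q by (intro Bernoulli_inequality) auto
  also have "1 + real (Suc n) * (q - 1) = 1/2" by (simp add: q_def field_simps)
  finally have qn: "1/2 \<le> q ^ Suc n" by simp
  define L where "L = 1 / (1 - q) ^ Suc n"
  have L: "L \<ge> 0" using q by (simp add: L_def)
  have "(\<Sum>k<K. a k) ^ Suc n \<le> L * (\<Sum>k<K. 2 ^ k * a k ^ Suc n)" if "\<And>k. a k \<ge> 0" for K a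
    using that
  proof (induction K arbitrary: a)
    case (Suc K)
    have IH: "(\<Sum>k<K. a (Suc k)) ^ Suc n \<le> L * (\<Sum>k<K. 2 ^ k * a (Suc k) ^ Suc n)" using Suc by simp
    have s0: "(\<Sum>k<K. a (Suc k)) \<ge> 0" using Suc.prems by (intro sum_nonneg) auto
    have "(\<Sum>k<Suc K. a k) ^ Suc n = (a 0 + (\<Sum>k<K. a (Suc k))) ^ Suc n" by (simp only: sum.lessThan_Suc_shift)
    also have "\<dots> \<le> (a 0 / (1 - q)) ^ Suc n + ((\<Sum>k<K. a (Suc k)) / q) ^ Suc n"
      by (rule add_power_le_weighted[OF Suc.prems s0 q])
    also have "(a 0 / (1 - q)) ^ Suc n = L * a 0 ^ Suc n" by (simp add: L_def power_divide)
    also have "((\<Sum>k<K. a (Suc k)) / q) ^ Suc n \<le> 2 * (\<Sum>k<K. a (Suc k)) ^ Suc n"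
    proof -
      have "(\<Sum>k<K. a (Suc k)) ^ Suc n * 1 \<le> (\<Sum>k<K. a (Suc k)) ^ Suc n * (2 * q ^ Suc n)"
        using qn s0 by (intro mult_left_mono zero_le_power) auto
      moreover have "q ^ Suc n > 0" using q by simp
      ultimately show ?thesis unfolding power_divide by (simp add: divide_le_eq mult_ac)
    qed
    also have "2 * (\<Sum>k<K. a (Suc k)) ^ Suc n \<le> 2 * (L * (\<Sum>k<K. 2 ^ k * a (Suc k) ^ Suc n))" using IH by simp
    also have "L * a 0 ^ Suc n + 2 * (L * (\<Sum>k<K. 2 ^ k * a (Suc k) ^ Suc n)) = L * (\<Sum>k<Suc K. 2 ^ k * a k ^ Suc n)"
      unfolding sum.lessThan_Suc_shift by (simp add: sum_distrib_left distrib_left mult_ac)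
    finally show ?case by simp
  qed simp
  with L that show ?thesis by blast
qed

lemma emeasure_square: "h \<ge> 0 \<Longrightarrow> emeasure lborel (square x h) = ennreal (4 * h\<^sup>2)"
proof -
  assume h: "h \<ge> 0"
  have "square x h \<noteq> {}" using h by (auto intro!: exI[of _ x] simp: mem_square simp flip: ex_in_conv)
  then have "measure lborel (square x h) = 4 * h\<^sup>2"
    using content_cbox_cart[of "x - vec h" "x + vec h"] by (simp add: UNIV_2 power2_eq_square)
  moreover have "emeasure lborel (square x h) = ennreal (measure lborel (square x h))"
    by (intro emeasure_eq_ennreal_measure) (simp add: emeasure_lborel_cbox_eq)
  ultimately show ?thesis by simp
qed

lemma borel_measurable_vec_nth[measurable (raw)]:
  "f \<in> borel_measurable M \<Longrightarrow> (\<lambda>x. (f x :: R2) $ i) \<in> borel_measurable M"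
  unfolding cart_eq_inner_axis by (intro borel_measurable_inner borel_measurable_const)

lemma measurable_square[measurable]: "Measurable.pred (borel \<Otimes>\<^sub>M borel) (\<lambda>p::R2 \<times> R2. snd p \<in> square (fst p) h)"
  unfolding mem_square by measurable

context R2_smooth_step
begin

definition bump_mass :: real where "bump_mass = (\<integral>y. bump 0 1 y \<partial>lborel)"

text \<open>All bumps of a chain are dilates about \<open>x\<close> of one fixed kernel
  \<open>bump d \<kappa>\<close>, centred at \<open>d\<close>; this is the form required by
  \<open>convolution_AE_subseq\<close>.\<close>

lemma bump_scale:
  assumes "s > 0"
  shows "bump (x + s *\<^sub>R d) (s * \<kappa>) (x + s *\<^sub>R y) = bump d \<kappa> y / s\<^sup>2"
proof -
  have "bump1 (x $ i + s * d $ i) (s * \<kappa>) (x $ i + s * y $ i) = bump1 (d $ i) \<kappa> (y $ i) / s" for i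
  proof -
    have "(x $ i + s * y $ i - (x $ i + s * d $ i)) / (s * \<kappa>) = (y $ i - d $ i) / \<kappa>"
      using assms by (simp flip: right_diff_distrib)
    then show ?thesis by (simp add: bump1_def mult.commute)
  qed
  then show ?thesis by (simp add: bump_def power2_eq_square)
qed

lemma bump_integral: "\<kappa> > 0 \<Longrightarrow> (\<integral>y. bump d \<kappa> y \<partial>lborel) = bump_mass"
proof -
  assume k: "\<kappa> > 0"
  have "(\<integral>y. bump d \<kappa> y \<partial>lborel) = \<bar>\<kappa>\<bar> ^ DIM(R2) * (\<integral>y. bump d \<kappa> (d + \<kappa> *\<^sub>R y) \<partial>lborel)"
    using k by (intro lborel_integral_affine) auto
  also have "(\<lambda>y. bump d \<kappa> (d + \<kappa> *\<^sub>R y)) = (\<lambda>y. bump 0 1 y / \<kappa>\<^sup>2)"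
    using bump_scale[OF k, of d 0 1] by simp
  finally show ?thesis using k by (simp add: bump_mass_def)
qed

lemma bump_out: "\<sigma> > 0 \<Longrightarrow> y \<notin> square c \<sigma> \<Longrightarrow> bump c \<sigma> y = 0"
  using bump1_out[of \<sigma> "y $ 1" "c $ 1"] bump1_out[of \<sigma> "y $ 2" "c $ 2"]
  by (auto simp: bump_def mem_square abs_le_iff not_le)

lemma bump_integrable_lborel: "\<sigma> > 0 \<Longrightarrow> integrable lborel (bump c \<sigma>)"
proof (rule integrableI_bounded_set[where A="square c \<sigma>" and B="(S / \<sigma>)\<^sup>2"])
  assume s: "\<sigma> > 0"
  show "emeasure lborel (square c \<sigma>) < \<infinity>" using s by (subst emeasure_square) auto
  show "AE x\<in>square c \<sigma> in lborel. norm (bump c \<sigma> x) \<le> (S / \<sigma>)\<^sup>2" using bump_bounds[OF s] by auto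
  show "AE x in lborel. x \<notin> square c \<sigma> \<longrightarrow> bump c \<sigma> x = 0" using bump_out[OF s] by auto
qed auto

lemma bump_mass_pos: "bump_mass > 0"
proof -
  have i: "integrable lborel (bump 0 1)" by (rule bump_integrable_lborel) simp
  have nn: "bump 0 1 x \<ge> 0" for x using bump_bounds[of 1] by auto
  have "bump_mass \<noteq> 0"
  proof
    assume "bump_mass = 0"
    then have ae: "AE x in lborel. bump 0 1 x = 0"
      using integral_nonneg_eq_0_iff_AE[OF i] nn by (simp add: bump_mass_def)
    obtain t where t: "\<beta> t > 0" using \<beta>_pos by blast
    define V where "V = {x :: R2. bump 0 1 x > 0}"
    have "continuous_on UNIV (bump 0 1)"
      unfolding bump_def[abs_def]
      by (intro continuous_intros continuous_on_compose2[OF smooth1_continuous[OF bump1_smooth, of UNIV]]) auto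
    then have "open V" unfolding V_def by (intro open_Collect_less) auto
    moreover have "vec t \<in> V" using t by (simp add: V_def bump_def bump1_def)
    ultimately have "\<not> negligible V" using open_not_negligible by blast
    moreover have "negligible V"
      unfolding negligible_iff_null_sets
    proof (rule AE_iff_null_sets[THEN iffD2])
      show "V \<in> sets lebesgue" using \<open>open V\<close> by auto
      show "AE x in lebesgue. x \<notin> V" unfolding AE_completion_iff using ae by eventually_elim (simp add: V_def)
    qed
    ultimately show False by blast
  qed
  moreover have "bump_mass \<ge> 0" unfolding bump_mass_def using nn by simp
  ultimately show ?thesis by simp
qed

lemma bump_mean_representative:
  assumes u: "u \<in> borel_measurable (lebesgue_on \<Omega>)" and f[measurable]: "f \<in> borel_measurable borel"
    and ae: "AE x in lborel. x \<in> \<Omega> \<longrightarrow> u x = f x" and f0: "\<And>x. x \<notin> \<Omega> \<Longrightarrow> f x = 0" and s: "s > 0"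
  shows "bump_mean \<Omega> u (x + s *\<^sub>R d) (s * \<kappa>) = (\<integral>y. f (x + s *\<^sub>R y) * bump d \<kappa> y \<partial>lborel)"
proof -
  have "bump_mean \<Omega> u (x + s *\<^sub>R d) (s * \<kappa>) = (\<integral>y. indicator \<Omega> y * (f y * bump (x + s *\<^sub>R d) (s * \<kappa>) y) \<partial>lborel)"
    unfolding bump_mean_def
  proof (rule lebesgue_on_representative(2))
    show "AE y in lborel. y \<in> \<Omega> \<longrightarrow> u y * bump (x + s *\<^sub>R d) (s * \<kappa>) y = f y * bump (x + s *\<^sub>R d) (s * \<kappa>) y"
      using ae by eventually_elim auto
  qed (use u borel_measurable_lebesgue_on[OF bump_measurable] in auto)
  also have "(\<lambda>y. indicator \<Omega> y * (f y * bump (x + s *\<^sub>R d) (s * \<kappa>) y)) = (\<lambda>y. f y * bump (x + s *\<^sub>R d) (s * \<kappa>) y)"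
    using f0 by (auto simp: indicator_def fun_eq_iff)
  also have "(\<integral>y. f y * bump (x + s *\<^sub>R d) (s * \<kappa>) y \<partial>lborel) =
      \<bar>s\<bar> ^ DIM(R2) * (\<integral>y. f (x + s *\<^sub>R y) * bump (x + s *\<^sub>R d) (s * \<kappa>) (x + s *\<^sub>R y) \<partial>lborel)"
    using s by (intro lborel_integral_affine) auto
  finally show ?thesis using s by (simp add: bump_scale)
qed

text \<open>The function is extended by zero to an integrable function on the plane, so the limit
  holds even for bumps that reach outside the domain or are not centred at \<open>x\<close>.\<close>

lemma bump_mean_AE_subseq:
  assumes u: "u \<in> borel_measurable (lebesgue_on \<Omega>)" "integrable (lebesgue_on \<Omega>) u"
    and k: "\<kappa> > 0" and s: "s \<longlonglongrightarrow> 0" "\<And>k. s k > 0"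
  obtains r where "strict_mono r"
    "AE x in lebesgue_on \<Omega>. (\<lambda>k. bump_mean \<Omega> u (x + s (r k) *\<^sub>R d) (s (r k) * \<kappa>)) \<longlonglongrightarrow> bump_mass * u x"
proof -
  obtain f where f: "f \<in> borel_measurable borel" "AE x in lborel. x \<in> \<Omega> \<longrightarrow> u x = f x" "\<And>x. x \<notin> \<Omega> \<Longrightarrow> f x = 0"
    using borel_representative[OF u(1) dom_borel] by blast
  have "integrable lborel (\<lambda>x. indicator \<Omega> x * f x)"
    using lebesgue_on_representative(1)[OF dom_borel u(1) f(1,2)] u(2) by simp
  moreover have "(\<lambda>x. indicator \<Omega> x * f x) = f" using f(3) by (auto simp: indicator_def fun_eq_iff)
  ultimately have fi: "integrable lborel f" by simp
  obtain r where r: "strict_mono r"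
    "AE x in lborel. (\<lambda>k. \<integral>y. f (x + s (r k) *\<^sub>R y) * bump d \<kappa> y \<partial>lborel) \<longlonglongrightarrow> (\<integral>y. bump d \<kappa> y \<partial>lborel) * f x"
    using convolution_AE_subseq[OF fi bump_integrable_lborel[OF k] s(1)] by blast
  have rep: "bump_mean \<Omega> u (x + s k *\<^sub>R d) (s k * \<kappa>) = (\<integral>y. f (x + s k *\<^sub>R y) * bump d \<kappa> y \<partial>lborel)" for x k
    by (rule bump_mean_representative[OF u(1) f s(2)])
  show ?thesis
  proof (rule that[OF r(1)])
    show "AE x in lebesgue_on \<Omega>. (\<lambda>k. bump_mean \<Omega> u (x + s (r k) *\<^sub>R d) (s (r k) * \<kappa>)) \<longlonglongrightarrow> bump_mass * u x"
      unfolding AE_lebesgue_on_iff[OF dom_borel] rep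
      using r(2) f(2) by eventually_elim (simp add: bump_integral[OF k])
  qed
qed

end

section \<open>Telescoping along a cone\<close>

context R2_smooth_step
begin

definition local_energy :: "(R2 \<Rightarrow> R2) \<Rightarrow> real \<Rightarrow> R2 \<Rightarrow> real" where
  "local_energy g h x = (\<integral>y. (norm (g y))\<^sup>2 * indicator (square x h) y \<partial>lebesgue_on \<Omega>)"

lemma local_energy_nonneg: "local_energy g h x \<ge> 0"
  by (simp add: local_energy_def)

lemma local_energy_le:
  assumes "weak_gradient \<Omega> u g" shows "local_energy g h x \<le> energy \<Omega> g"
  unfolding local_energy_def energy_def
  by (rule integral_mono'[OF weak_gradientD(1)[OF assms]]) (auto simp: indicator_def)

lemma gradient_L1_square:
  assumes "weak_gradient \<Omega> u g" "h \<ge> 0"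
  shows "(\<integral>y. norm (g y) * indicator (square x h) y \<partial>lebesgue_on \<Omega>)\<^sup>2 \<le> 4 * h\<^sup>2 * local_energy g h x"
proof -
  note d = weak_gradientD[OF assms(1)]
  have im: "(indicator (square x h) :: R2 \<Rightarrow> real) \<in> borel_measurable (lebesgue_on \<Omega>)"
    by (intro borel_measurable_lebesgue_on) auto
  have nm: "(\<lambda>y. norm (g y)) \<in> borel_measurable (lebesgue_on \<Omega>)"
    using d(2) by simp
  have i2: "(\<lambda>y. (norm (g y) * indicator (square x h) y)\<^sup>2) = (\<lambda>y. (norm (g y))\<^sup>2 * indicator (square x h) y)"
    by (auto simp: indicator_def)
  have ii: "integrable (lebesgue_on \<Omega>) (\<lambda>y. (norm (g y) * indicator (square x h) y)\<^sup>2)"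
    unfolding i2 by (rule integrable_mult_bounded[OF d(1) im, of 1]) (auto simp: indicator_def)
  have iI: "integrable (lebesgue_on \<Omega>) (\<lambda>y. (indicator (square x h) y :: real)\<^sup>2)"
    by (rule fin.integrable_const_bound[where B=1, OF _ borel_measurable_power[OF im]]) (auto simp: indicator_def)
  have CS: "(\<integral>y. (norm (g y) * indicator (square x h) y) * indicator (square x h) y \<partial>lebesgue_on \<Omega>)\<^sup>2 \<le>
     (\<integral>y. (norm (g y) * indicator (square x h) y)\<^sup>2 \<partial>lebesgue_on \<Omega>) * (\<integral>y. (indicat_real (square x h) y)\<^sup>2 \<partial>lebesgue_on \<Omega>)"
    by (rule integral_square_le[OF ii iI _ im]) (use nm im in auto)
  have eq: "(\<lambda>y. (norm (g y) * indicator (square x h) y) * indicator (square x h) y) = (\<lambda>y. norm (g y) * indicat_real (square x h) y)"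
    by (auto simp: indicator_def)
  have le: "(\<integral>y. (indicat_real (square x h) y)\<^sup>2 \<partial>lebesgue_on \<Omega>) \<le> 4 * h\<^sup>2"
  proof -
    have "(\<integral>y. (indicat_real (square x h) y)\<^sup>2 \<partial>lebesgue_on \<Omega>) = (\<integral>y. indicator \<Omega> y * (indicator (square x h) y)\<^sup>2 \<partial>lborel)"
      by (rule lebesgue_on_representative(2)[OF dom_borel borel_measurable_power[OF im]]) auto
    also have "\<dots> \<le> (\<integral>y. indicator (square x h) y \<partial>lborel)"
    proof (rule integral_mono')
      show "integrable lborel (indicat_real (square x h))"
        by (rule integrable_real_indicator) (auto simp: emeasure_square[OF assms(2)])
    qed (auto simp: indicator_def)
    also have "\<dots> = 4 * h\<^sup>2" using emeasure_square[OF assms(2), of x] by (simp add: measure_def)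
    finally show ?thesis .
  qed
  have "(\<integral>y. norm (g y) * indicator (square x h) y \<partial>lebesgue_on \<Omega>)\<^sup>2 \<le> local_energy g h x * (\<integral>y. (indicat_real (square x h) y)\<^sup>2 \<partial>lebesgue_on \<Omega>)"
    using CS unfolding eq i2 local_energy_def .
  also have "\<dots> \<le> local_energy g h x * (4 * h\<^sup>2)"
    by (rule mult_left_mono[OF le local_energy_nonneg])
  finally show ?thesis by (simp add: mult_ac)
qed

text \<open>Fubini and the symmetry of \<open>y \<in> square x h\<close> in \<open>x\<close> and
  \<open>y\<close>: each point \<open>y\<close> is counted with the area of the square around it.
  This turns a local bound independent of the scale into decay in the mean as \<open>h\<close>
  shrinks.\<close>

lemma local_energy_integral:
  assumes "weak_gradient \<Omega> u g" "h \<ge> 0"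
  shows "(\<lambda>x. ennreal (local_energy g h x)) \<in> borel_measurable borel"
    and "(\<integral>\<^sup>+x. ennreal (local_energy g h x) \<partial>lborel) = ennreal (4 * h\<^sup>2 * energy \<Omega> g)"
proof -
  note d = weak_gradientD[OF assms(1)]
  have nm: "(\<lambda>y. norm (g y)) \<in> borel_measurable (lebesgue_on \<Omega>)"
    using d(2) by simp
  obtain G where G[measurable]: "G \<in> borel_measurable borel" and ae: "AE x in lborel. x \<in> \<Omega> \<longrightarrow> norm (g x) = G x"
    and G0: "\<And>x. x \<notin> \<Omega> \<Longrightarrow> G x = 0"
    using borel_representative[OF nm dom_borel] by blast
  have G2: "indicator \<Omega> x * (G x)\<^sup>2 = (G x)\<^sup>2" for x using G0 by (auto simp: indicator_def)
  have ae2: "AE x in lborel. x \<in> \<Omega> \<longrightarrow> (norm (g x))\<^sup>2 = (G x)\<^sup>2" using ae by eventually_elim auto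
  have nm2: "(\<lambda>x. (norm (g x))\<^sup>2) \<in> borel_measurable (lebesgue_on \<Omega>)" using nm by simp
  have Gi: "integrable lborel (\<lambda>x. (G x)\<^sup>2)" and GE: "energy \<Omega> g = (\<integral>x. (G x)\<^sup>2 \<partial>lborel)"
    using lebesgue_on_representative[OF dom_borel nm2 _ ae2] d(1) by (simp_all add: G2 energy_def)
  have eq: "ennreal (local_energy g h x) = (\<integral>\<^sup>+y. ennreal ((G y)\<^sup>2) * indicator (square x h) y \<partial>lborel)" for x
  proof -
    have "local_energy g h x = (\<integral>y. indicator \<Omega> y * ((G y)\<^sup>2 * indicator (square x h) y) \<partial>lborel)"
      unfolding local_energy_def
    proof (rule lebesgue_on_representative(2)[OF dom_borel])
      show "AE y in lborel. y \<in> \<Omega> \<longrightarrow> (norm (g y))\<^sup>2 * indicator (square x h) y = (G y)\<^sup>2 * indicator (square x h) y"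
        using ae2 by eventually_elim auto
      show "(\<lambda>y. (norm (g y))\<^sup>2 * indicator (square x h) y) \<in> borel_measurable (lebesgue_on \<Omega>)"
        by (intro borel_measurable_times nm2 borel_measurable_lebesgue_on) auto
    qed auto
    also have "(\<lambda>y. indicator \<Omega> y * ((G y)\<^sup>2 * indicator (square x h) y)) = (\<lambda>y. (G y)\<^sup>2 * indicator (square x h) y)"
      unfolding mult.assoc[symmetric] G2 ..
    also have "ennreal (\<integral>y. (G y)\<^sup>2 * indicator (square x h) y \<partial>lborel) = (\<integral>\<^sup>+y. ennreal ((G y)\<^sup>2 * indicator (square x h) y) \<partial>lborel)"
      by (rule nn_integral_eq_integral[symmetric]) (auto intro!: integrable_mult_bounded[OF Gi, of _ 1] simp: indicator_def)
    also have "\<dots> = (\<integral>\<^sup>+y. ennreal ((G y)\<^sup>2) * indicator (square x h) y \<partial>lborel)"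
      by (intro nn_integral_cong) (auto simp: indicator_def)
    finally show ?thesis .
  qed
  have meas: "(\<lambda>(x, y). ennreal ((G y)\<^sup>2) * indicator (square x h) y) \<in> borel_measurable (lborel \<Otimes>\<^sub>M lborel)"
  proof -
    have "(\<lambda>p::R2 \<times> R2. indicator (square (fst p) h) (snd p) :: ennreal) = indicator {p \<in> space (borel \<Otimes>\<^sub>M borel). snd p \<in> square (fst p) h}"
      by (auto simp: indicator_def space_pair_measure fun_eq_iff)
    moreover have "{p \<in> space (borel \<Otimes>\<^sub>M borel). snd p \<in> square (fst p) h} \<in> sets (borel \<Otimes>\<^sub>M (borel :: R2 measure))"
      using measurable_square[of h] by (auto simp: pred_def)
    ultimately have "(\<lambda>p::R2 \<times> R2. indicator (square (fst p) h) (snd p) :: ennreal) \<in> borel_measurable (borel \<Otimes>\<^sub>M borel)"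
      by auto
    then show ?thesis by (simp add: case_prod_unfold cong: measurable_cong_sets)
  qed
  show "(\<lambda>x. ennreal (local_energy g h x)) \<in> borel_measurable borel"
    unfolding eq using lborel.borel_measurable_nn_integral[OF meas] by simp
  have "(\<integral>\<^sup>+x. ennreal (local_energy g h x) \<partial>lborel) = (\<integral>\<^sup>+y. \<integral>\<^sup>+x. ennreal ((G y)\<^sup>2) * indicator (square x h) y \<partial>lborel \<partial>lborel)"
    unfolding eq by (rule lborel_pair.Fubini'[OF meas, symmetric])
  also have "\<dots> = (\<integral>\<^sup>+y. ennreal ((G y)\<^sup>2) * ennreal (4 * h\<^sup>2) \<partial>lborel)"
  proof (rule nn_integral_cong)
    fix y :: R2
    have "(\<lambda>x. ennreal ((G y)\<^sup>2) * indicator (square x h) y) = (\<lambda>x. ennreal ((G y)\<^sup>2) * indicator (square y h) x)"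
      by (auto simp: indicator_def mem_square abs_minus_commute fun_eq_iff)
    then show "(\<integral>\<^sup>+x. ennreal ((G y)\<^sup>2) * indicator (square x h) y \<partial>lborel) = ennreal ((G y)\<^sup>2) * ennreal (4 * h\<^sup>2)"
      using emeasure_square[OF assms(2), of y] by (simp add: nn_integral_cmult_indicator)
  qed
  also have "\<dots> = (\<integral>\<^sup>+y. ennreal ((G y)\<^sup>2) \<partial>lborel) * ennreal (4 * h\<^sup>2)" by (rule nn_integral_multc) auto
  also have "(\<integral>\<^sup>+y. ennreal ((G y)\<^sup>2) \<partial>lborel) = ennreal (energy \<Omega> g)"
    unfolding GE by (rule nn_integral_eq_integral[OF Gi]) auto
  finally show "(\<integral>\<^sup>+x. ennreal (local_energy g h x) \<partial>lborel) = ennreal (4 * h\<^sup>2 * energy \<Omega> g)"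
    by (simp add: ennreal_mult' energy_nonneg mult.commute)
qed

text \<open>Telescoping along dyadic bumps that shrink to \<open>x\<close> inside the cone at \<open>x\<close>: each increment has
  bounded sup norm and its \<open>L\<^sup>2\<close> norm is \<open>O(2 ^ (-k))\<close>.\<close>

lemma cone_step:
  assumes H: "H1_pair \<Omega> u g" and k: "\<kappa> > 0" "\<kappa> \<le> 1/4" and s: "s > 0" and d1: "\<And>i. \<bar>d $ i\<bar> \<le> 1"
    and cone: "\<And>y. (\<And>i. min (d $ i) (d $ i / 2) - \<kappa> \<le> y $ i \<and> y $ i \<le> max (d $ i) (d $ i / 2) + \<kappa>) \<Longrightarrow> x + s *\<^sub>R y \<in> \<Omega>"
  shows "\<bar>bump_mean \<Omega> u (x + (s/2) *\<^sub>R d) (s/2 * \<kappa>) - bump_mean \<Omega> u (x + s *\<^sub>R d) (s * \<kappa>)\<bar>\<^sup>2 \<le> 144 * S\<^sup>2 / \<kappa>\<^sup>2 * local_energy g (2 * s) x"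
proof -
  note h = H1_pairD[OF H]
  \<comment> \<open>Corners of the direction box scaled by \<open>s\<close> and moved to
    \<open>x\<close>. The box contains the supports of both bumps and, since
    \<open>\<bar>d $ i\<bar> \<le> 1\<close> and \<open>\<kappa> \<le> 1/4\<close>, lies in
    \<open>square x (2 * s)\<close>.\<close>
  define l where "l = (\<chi> i. x $ i + s * (min (d $ i) (d $ i / 2) - \<kappa>))"
  define m where "m = (\<chi> i. x $ i + s * (max (d $ i) (d $ i / 2) + \<kappa>))"
  have sub: "cbox l m \<subseteq> \<Omega>"
  proof
    fix z assume z: "z \<in> cbox l m"
    define y where "y = (1/s) *\<^sub>R (z - x)"
    have zy: "z = x + s *\<^sub>R y" using s by (simp add: y_def)
    have "x + s *\<^sub>R y \<in> \<Omega>"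
    proof (rule cone)
      fix i
      have "l $ i \<le> z $ i" "z $ i \<le> m $ i" using z by (auto simp: mem_box_cart)
      then have "s * (min (d $ i) (d $ i / 2) - \<kappa>) \<le> s * y $ i" "s * y $ i \<le> s * (max (d $ i) (d $ i / 2) + \<kappa>)"
        unfolding zy by (simp_all add: l_def m_def)
      then show "min (d $ i) (d $ i / 2) - \<kappa> \<le> y $ i \<and> y $ i \<le> max (d $ i) (d $ i / 2) + \<kappa>" using s by simp
    qed
    then show "z \<in> \<Omega>" using zy by simp
  qed
  have big: "cbox l m \<subseteq> square x (2 * s)"
  proof
    fix z assume z: "z \<in> cbox l m"
    have "\<bar>z $ i - x $ i\<bar> \<le> 2 * s" for i
    proof -
      have zz: "l $ i \<le> z $ i" "z $ i \<le> m $ i" using z by (auto simp: mem_box_cart)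
      have "s * (-2) \<le> s * (min (d $ i) (d $ i / 2) - \<kappa>)" "s * (max (d $ i) (d $ i / 2) + \<kappa>) \<le> s * 2"
        using s d1[of i] k by (intro mult_left_mono; auto simp: min_def max_def abs_le_iff)+
      then show ?thesis using zz by (simp add: l_def m_def abs_le_iff)
    qed
    then show "z \<in> square x (2 * s)" by (simp add: mem_square)
  qed
  define J where "J = (\<integral>y. norm (g y) * indicator (square x (2 * s)) y \<partial>lebesgue_on \<Omega>)"
  have J0: "J \<ge> 0" by (simp add: J_def)
  have "\<bar>bump_mean \<Omega> u (x + (s/2) *\<^sub>R d) (s/2 * \<kappa>) - bump_mean \<Omega> u (x + s *\<^sub>R d) (s * \<kappa>)\<bar>
      \<le> S * (1/(s/2*\<kappa>) + 1/(s * \<kappa>)) * (\<integral>y. norm (g y) * indicator (cbox l m) y \<partial>lebesgue_on \<Omega>)"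
  proof (rule bump_mean_transfer[OF h])
    fix i
    have b: "min (d $ i) (d $ i / 2) - \<kappa> \<le> d $ i / 2 - \<kappa> / 2" "d $ i / 2 + \<kappa> / 2 \<le> max (d $ i) (d $ i / 2) + \<kappa>"
      "min (d $ i) (d $ i / 2) - \<kappa> \<le> d $ i - \<kappa>" "d $ i + \<kappa> \<le> max (d $ i) (d $ i / 2) + \<kappa>" using k by auto
    note c = b[THEN mult_left_mono, OF less_imp_le[OF s]]
    show "l $ i \<le> (x + (s/2) *\<^sub>R d) $ i - s/2 * \<kappa>" using c(1) by (simp add: l_def right_diff_distrib)
    show "(x + (s/2) *\<^sub>R d) $ i + s/2 * \<kappa> \<le> m $ i" using c(2) by (simp add: m_def distrib_left)
    show "l $ i \<le> (x + s *\<^sub>R d) $ i - s * \<kappa>" using c(3) by (simp add: l_def right_diff_distrib)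
    show "(x + s *\<^sub>R d) $ i + s * \<kappa> \<le> m $ i" using c(4) by (simp add: m_def distrib_left)
  qed (use s k sub in auto)
  also have "\<dots> \<le> S * (1/(s/2*\<kappa>) + 1/(s * \<kappa>)) * J"
  proof (rule mult_left_mono)
    have "integrable (lebesgue_on \<Omega>) (\<lambda>y. norm (g y) * indicator (square x (2 * s)) y)"
      by (rule integrable_mult_bounded[OF h(3), of _ 1]) (auto simp: indicator_def intro!: borel_measurable_lebesgue_on)
    then show "(\<integral>y. norm (g y) * indicator (cbox l m) y \<partial>lebesgue_on \<Omega>) \<le> J"
      unfolding J_def by (rule integral_mono') (use big in \<open>auto simp: indicator_def\<close>)
  qed (use S_pos s k in auto)
  also have "S * (1/(s/2*\<kappa>) + 1/(s * \<kappa>)) * J = 3 * S / (s * \<kappa>) * J" using s k by (simp add: field_simps)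
  finally have "\<bar>bump_mean \<Omega> u (x + (s/2) *\<^sub>R d) (s/2 * \<kappa>) - bump_mean \<Omega> u (x + s *\<^sub>R d) (s * \<kappa>)\<bar>\<^sup>2 \<le> (3 * S / (s * \<kappa>) * J)\<^sup>2"
    by (rule power_mono) simp
  also have "\<dots> = 9 * S\<^sup>2 / (s\<^sup>2 * \<kappa>\<^sup>2) * J\<^sup>2" by (simp add: power_mult_distrib power_divide)
  \<comment> \<open>The area of the square cancels \<open>1 / s\<^sup>2\<close>: in two dimensions
    the bound carries no power of the scale. The resulting 144 is \<open>9 * 4 * 4\<close>.\<close>
  also have "\<dots> \<le> 9 * S\<^sup>2 / (s\<^sup>2 * \<kappa>\<^sup>2) * (4 * (2 * s)\<^sup>2 * local_energy g (2 * s) x)"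
    unfolding J_def using s by (intro mult_left_mono gradient_L1_square[OF h(1)]) auto
  also have "\<dots> = 144 * S\<^sup>2 / \<kappa>\<^sup>2 * local_energy g (2 * s) x" using s by (simp add: field_simps power2_eq_square)
  finally show ?thesis .
qed

text \<open>The coarsest bumps of all chains near \<open>x0\<close> are compared with one reference
  bump. As \<open>x0\<close> itself may lie outside the domain, the comparison runs through a nearby
  point \<open>x1\<close> of the domain, fixed once, which keeps the constant independent of
  \<open>x\<close>.\<close>

lemma cone_base:
  assumes conn: "connected \<Omega>" and cs: "cs \<in> \<Omega>" "\<sigma> > 0" "square cs \<sigma> \<subseteq> \<Omega>"
    and x0: "x0 \<in> closure \<Omega>" and k: "\<kappa> > 0" and r: "r > 0" and \<delta>: "\<delta> > 0"
    and cone: "\<And>x. x \<in> \<Omega> \<Longrightarrow> x \<in> ball x0 \<delta> \<Longrightarrow> square (x + r *\<^sub>R d) (r * \<kappa>) \<subseteq> \<Omega>"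
  obtains \<delta>' C where "\<delta>' > 0" "\<delta>' \<le> \<delta>" "C \<ge> 0"
    "\<And>x u g. x \<in> \<Omega> \<Longrightarrow> x \<in> ball x0 \<delta>' \<Longrightarrow> H1_pair \<Omega> u g \<Longrightarrow> \<bar>bump_mean \<Omega> u (x + r *\<^sub>R d) (r * \<kappa>) - bump_mean \<Omega> u cs \<sigma>\<bar> \<le> C * sqrt (energy \<Omega> g)"
proof -
  define t where "t = r * \<kappa>"
  \<comment> \<open>With both points within \<open>t / 4\<close> of \<open>x0\<close>, the square of
    half size over \<open>x\<close> fits into the full square over \<open>x1\<close>.\<close>
  define \<delta>' where "\<delta>' = min \<delta> (t / 4)"
  have t: "t > 0" using r k by (simp add: t_def)
  have d': "\<delta>' > 0" "\<delta>' \<le> \<delta>" "\<delta>' \<le> t/4" using t \<delta> by (auto simp: \<delta>'_def)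
  obtain x1 where x1: "x1 \<in> \<Omega>" "dist x1 x0 < \<delta>'" using x0 d'(1) closure_approachable by blast
  define y1 where "y1 = x1 + r *\<^sub>R d"
  have y1: "square y1 t \<subseteq> \<Omega>" unfolding y1_def t_def using x1 d' by (intro cone) (auto simp: dist_commute)
  have "y1 \<in> \<Omega>" using y1 t by (auto simp: subset_iff mem_square)
  then obtain C1 where C1: "\<And>u g. H1_pair \<Omega> u g \<Longrightarrow> \<bar>bump_mean \<Omega> u y1 t - bump_mean \<Omega> u cs \<sigma>\<bar> \<le> C1 * sqrt (energy \<Omega> g)"
    using bump_mean_connected[OF conn _ cs(1) t cs(2) y1 cs(3)] by blast
  define C2 where "C2 = S * (1/t + 1/(t/2)) * sqrt (measure lebesgue \<Omega>)"
  have C2: "C2 \<ge> 0" using S_pos t by (simp add: C2_def)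
  show ?thesis
  proof (rule that[OF d'(1,2), of "2 * C2 + \<bar>C1\<bar>"])
    fix x u g assume x: "x \<in> \<Omega>" "x \<in> ball x0 \<delta>'" and H: "H1_pair \<Omega> u g"
    have sx: "square (x + r *\<^sub>R d) t \<subseteq> \<Omega>" unfolding t_def using x d' by (intro cone) auto
    have a: "\<bar>bump_mean \<Omega> u (x + r *\<^sub>R d) t - bump_mean \<Omega> u (x + r *\<^sub>R d) (t/2)\<bar> \<le> C2 * sqrt (energy \<Omega> g)"
      unfolding C2_def by (rule bump_mean_transfer_energy[OF H _ _ sx]) (use t in \<open>auto simp: subset_iff mem_square\<close>)
    have dxx: "dist x x1 < t/2" using x(2) x1(2) d'(3) dist_triangle[of x x1 x0] by (simp add: dist_commute)
    have "\<bar>(x - x1) $ i\<bar> \<le> t/2" for i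
      using component_le_norm_cart[of "x - x1" i] dxx by (simp add: dist_norm)
    from this[of 1] this[of 2] have "square (x + r *\<^sub>R d) (t/2) \<subseteq> square y1 t"
      unfolding subset_iff mem_square y1_def vector_add_component vector_minus_component vector_scaleR_component
      by (intro allI impI; linarith)
    then have b: "\<bar>bump_mean \<Omega> u y1 t - bump_mean \<Omega> u (x + r *\<^sub>R d) (t/2)\<bar> \<le> C2 * sqrt (energy \<Omega> g)"
      unfolding C2_def by (intro bump_mean_transfer_energy[OF H _ _ y1]) (use t in auto)
    have c: "\<bar>bump_mean \<Omega> u y1 t - bump_mean \<Omega> u cs \<sigma>\<bar> \<le> \<bar>C1\<bar> * sqrt (energy \<Omega> g)"
      using C1[OF H] mult_right_mono[OF abs_ge_self[of C1], of "sqrt (energy \<Omega> g)"] energy_nonneg[of \<Omega> g] by simp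
    show "\<bar>bump_mean \<Omega> u (x + r *\<^sub>R d) (r * \<kappa>) - bump_mean \<Omega> u cs \<sigma>\<bar> \<le> (2 * C2 + \<bar>C1\<bar>) * sqrt (energy \<Omega> g)"
      using a b c unfolding t_def[symmetric] distrib_right by linarith
  qed (use C2 in auto)
qed

end

section \<open>Sobolev-Poincare inequality\<close>

context R2_smooth_step
begin

text \<open>Stated with \<open>nn_integral\<close>, so that integrability is a conclusion. The
  subtracted value is the bump mean over the reference square and does not depend on
  \<open>x0\<close>, which allows the local bounds to be added.\<close>

lemma local_sobolev:
  assumes dom: "smooth_bounded_domain \<Omega>" and cs: "cs \<in> \<Omega>" "\<sigma> > 0" "square cs \<sigma> \<subseteq> \<Omega>"
    and x0: "x0 \<in> closure \<Omega>" and N: "N > 0"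
  obtains \<delta> C where "\<delta> > 0" "C \<ge> 0" "\<And>u g. H1_pair \<Omega> u g \<Longrightarrow>
     (\<integral>\<^sup>+x. ennreal (\<bar>bump_mass * u x - bump_mean \<Omega> u cs \<sigma>\<bar> ^ (2 * N)) * indicator (\<Omega> \<inter> ball x0 \<delta>) x \<partial>lebesgue) \<le> ennreal (C * energy \<Omega> g ^ N)"
proof -
  have conn: "connected \<Omega>" using dom by (simp add: smooth_bounded_domain_def)
  obtain d :: R2 and \<kappa> r \<delta>0 where kr: "\<kappa> > 0" "\<kappa> \<le> 1/4" "r > 0" "\<delta>0 > 0" "\<And>i. \<bar>d $ i\<bar> \<le> 1"
    and cone: "\<And>x t y. x \<in> \<Omega> \<Longrightarrow> x \<in> ball x0 \<delta>0 \<Longrightarrow> 0 < t \<Longrightarrow> t \<le> r \<Longrightarrow>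
       (\<And>i. min (d $ i) (d $ i / 2) - \<kappa> \<le> y $ i \<and> y $ i \<le> max (d $ i) (d $ i / 2) + \<kappa>) \<Longrightarrow> x + t *\<^sub>R y \<in> \<Omega>"
    apply (rule interior_cone[OF dom x0])
    subgoal premises p for d \<kappa> r \<delta> by (rule that[OF p(2-)]) done
  have sq: "square (x + r *\<^sub>R d) (r * \<kappa>) \<subseteq> \<Omega>" if x: "x \<in> \<Omega>" "x \<in> ball x0 \<delta>0" for x
  proof
    fix z assume z: "z \<in> square (x + r *\<^sub>R d) (r * \<kappa>)"
    define y where "y = (1/r) *\<^sub>R (z - x)"
    have zy: "z = x + r *\<^sub>R y" using kr by (simp add: y_def)
    have "x + r *\<^sub>R y \<in> \<Omega>"
    proof (rule cone[OF x kr(3) order_refl])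
      fix i :: 2
      have "(x + r *\<^sub>R d - vec (r * \<kappa>)) $ i \<le> z $ i" "z $ i \<le> (x + r *\<^sub>R d + vec (r * \<kappa>)) $ i"
        using z by (auto simp: mem_box_cart)
      then have "r * (d $ i - \<kappa>) \<le> r * y $ i" "r * y $ i \<le> r * (d $ i + \<kappa>)"
        unfolding zy by (simp_all add: right_diff_distrib distrib_left)
      then have "d $ i - \<kappa> \<le> y $ i" "y $ i \<le> d $ i + \<kappa>" using kr by simp_all
      then show "min (d $ i) (d $ i / 2) - \<kappa> \<le> y $ i \<and> y $ i \<le> max (d $ i) (d $ i / 2) + \<kappa>" by auto
    qed
    then show "z \<in> \<Omega>" using zy by simp
  qed
  obtain \<delta> C1 where \<delta>: "\<delta> > 0" "\<delta> \<le> \<delta>0" and C1: "C1 \<ge> 0"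
    "\<And>x u g. x \<in> \<Omega> \<Longrightarrow> x \<in> ball x0 \<delta> \<Longrightarrow> H1_pair \<Omega> u g \<Longrightarrow> \<bar>bump_mean \<Omega> u (x + r *\<^sub>R d) (r * \<kappa>) - bump_mean \<Omega> u cs \<sigma>\<bar> \<le> C1 * sqrt (energy \<Omega> g)"
    apply (rule cone_base[OF conn cs x0 kr(1,3,4) sq], assumption, assumption)
    subgoal premises p for \<delta>' C by (rule that[OF p(2-)]) done
  obtain n where n: "2 * N = Suc n" using N by (cases "2 * N") auto
  obtain L :: real where L: "L \<ge> 0" "\<And>K a. (\<And>k. a k \<ge> 0) \<Longrightarrow> (\<Sum>k<K. a k) ^ Suc n \<le> L * (\<Sum>k<K. 2 ^ k * a k ^ Suc n)"
    apply (rule sum_power_le[of n])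
    subgoal premises p for L by (rule that[OF p(2-)]) done
  define B where "B = 144 * S\<^sup>2 / \<kappa>\<^sup>2"
  have B: "B \<ge> 0" by (simp add: B_def)
  define s where "s k = r / 2 ^ k" for k
  have s: "s k > 0" "s k \<le> r" "s (Suc k) = s k / 2" for k
  proof -
    show "s k > 0" "s (Suc k) = s k / 2" using kr by (simp_all add: s_def)
    have "r * 1 \<le> r * 2 ^ k" using kr by (intro mult_left_mono) auto
    then show "s k \<le> r" by (simp add: s_def divide_le_eq)
  qed
  have slim: "s \<longlonglongrightarrow> 0"
    unfolding s_def[abs_def] by (rule LIMSEQ_divide_realpow_zero) simp
  define D where "D = 4 ^ N * C1 ^ (2 * N) * measure lebesgue \<Omega> + 4 ^ N * L * B ^ N * (32 * r\<^sup>2)"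
  have D: "D \<ge> 0" using C1 L B by (simp add: D_def)
  show ?thesis
  proof (rule that[OF \<delta>(1) D])
    fix u g assume H: "H1_pair \<Omega> u g"
    note h = H1_pairD[OF H]
    have um: "u \<in> borel_measurable (lebesgue_on \<Omega>)" using H by (simp add: H1_pair_def)
    define E where "E = energy \<Omega> g"
    define m where "m = bump_mean \<Omega> u cs \<sigma>"
    define A where "A k x = local_energy g (2 * s k) x" for k x
    define W where "W k x = bump_mean \<Omega> u (x + s k *\<^sub>R d) (s k * \<kappa>)" for k x
    define a where "a k x = \<bar>W (Suc k) x - W k x\<bar>" for k x
    have E0: "E \<ge> 0" by (simp add: E_def energy_nonneg)
    have A0: "A k x \<ge> 0" "A k x \<le> E" for k x by (simp_all add: A_def E_def local_energy_nonneg local_energy_le[OF h(1)])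
    have step: "(a k x)\<^sup>2 \<le> B * A k x" if "x \<in> \<Omega>" "x \<in> ball x0 \<delta>" for k x
      unfolding a_def W_def B_def A_def s(3)
      using that \<delta> by (intro cone_step[OF H kr(1,2) s(1) kr(5)] cone s) auto
    have tele: "\<bar>W K x - m\<bar> \<le> C1 * sqrt E + (\<Sum>k<K. a k x)" if "x \<in> \<Omega>" "x \<in> ball x0 \<delta>" for K x
    proof (induction K)
      case 0
      show ?case using C1(2)[OF that H] by (simp add: W_def m_def E_def s_def)
    next
      case (Suc K)
      then show ?case by (simp add: a_def)
    qed
    \<comment> \<open>The factor \<open>4 ^ N\<close> is \<open>2 ^ (2 * N)\<close>, from splitting
      the base term off the telescoping sum with equal weights. \<open>c2\<close> carries all but
      one power of the energy; the last one comes from the integral of \<open>A k\<close>.\<close>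
    define c1 c2 where "c1 = 4 ^ N * (C1 ^ (2 * N) * E ^ N)" and "c2 = 4 ^ N * (L * (B ^ N * E ^ (N - 1)))"
    have c: "c1 \<ge> 0" "c2 \<ge> 0" using C1 L B E0 by (auto simp: c1_def c2_def)
    have pw: "\<bar>W K x - m\<bar> ^ (2 * N) \<le> c1 + c2 * (\<Sum>k<K. 2 ^ k * A k x)" if x: "x \<in> \<Omega>" "x \<in> ball x0 \<delta>" for K x
    proof -
      define T where "T = (\<Sum>k<K. a k x)"
      have T0: "T \<ge> 0" by (auto simp: T_def a_def intro!: sum_nonneg)
      have "\<bar>W K x - m\<bar> ^ (2 * N) \<le> (C1 * sqrt E + T) ^ (2 * N)"
        using tele[OF x] by (intro power_mono) (auto simp: T_def)
      also have "\<dots> \<le> (C1 * sqrt E / (1 - 1/2)) ^ (2 * N) + (T / (1/2)) ^ (2 * N)"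
        using C1 E0 T0 by (intro add_power_le_weighted) auto
      also have "(C1 * sqrt E / (1 - 1/2)) ^ (2 * N) = c1"
        using E0 by (simp add: c1_def power_mult_distrib power_mult)
      also have "(T / (1/2)) ^ (2 * N) = 4 ^ N * T ^ (2 * N)" by (simp add: power_mult_distrib power_mult)
      also have "T ^ (2 * N) \<le> L * (\<Sum>k<K. 2 ^ k * a k x ^ (2 * N))"
        unfolding n T_def by (rule L(2)) (simp add: a_def)
      \<comment> \<open>Interpolation between the uniform bound and the bound in the mean: of the
        \<open>N\<close> factors \<open>A k x\<close>, all but one are estimated by the total energy
        and the last is kept for integration over \<open>x\<close>.\<close>
      also have "(\<Sum>k<K. 2 ^ k * a k x ^ (2 * N)) \<le> (\<Sum>k<K. 2 ^ k * (B ^ N * E ^ (N - 1) * A k x))"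
      proof (intro sum_mono mult_left_mono)
        fix k
        have "a k x ^ (2 * N) \<le> (B * A k x) ^ N" unfolding power_mult by (rule power_mono[OF step[OF x]]) simp
        also have "\<dots> = B ^ N * (A k x ^ (N - 1) * A k x)" by (simp only: power_mult_distrib power_minus_mult[OF N])
        also have "\<dots> \<le> B ^ N * (E ^ (N - 1) * A k x)"
          using B A0 by (intro mult_left_mono mult_right_mono power_mono) auto
        finally show "a k x ^ (2 * N) \<le> B ^ N * E ^ (N - 1) * A k x" by (simp add: mult.assoc)
      qed simp
      also have "\<dots> = B ^ N * E ^ (N - 1) * (\<Sum>k<K. 2 ^ k * A k x)" by (simp add: sum_distrib_left mult_ac)
      finally show ?thesis using L(1) by (simp add: c2_def mult.assoc mult_left_mono)
    qed
    define R where "R x = ennreal c1 + ennreal c2 * (\<Sum>k. ennreal (2 ^ k * A k x))" for x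
    have pwR: "ennreal (\<bar>W K x - m\<bar> ^ (2 * N)) \<le> R x" if x: "x \<in> \<Omega>" "x \<in> ball x0 \<delta>" for K x
    proof -
      have "ennreal (\<bar>W K x - m\<bar> ^ (2 * N)) \<le> ennreal (c1 + c2 * (\<Sum>k<K. 2 ^ k * A k x))"
        by (rule ennreal_leI[OF pw[OF x]])
      also have "\<dots> = ennreal c1 + ennreal c2 * (\<Sum>k<K. ennreal (2 ^ k * A k x))"
      proof -
        have e: "(\<Sum>k<K. ennreal (2 ^ k * A k x)) = ennreal (\<Sum>k<K. 2 ^ k * A k x)"
          by (rule sum_ennreal) (simp add: A0(1))
        have p: "(\<Sum>k<K. 2 ^ k * A k x) \<ge> 0" by (rule sum_nonneg) (simp add: A0(1))
        show ?thesis unfolding e ennreal_mult[OF c(2) p, symmetric]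
          by (rule ennreal_plus[OF c(1) mult_nonneg_nonneg[OF c(2) p]])
      qed
      also have "\<dots> \<le> R x" unfolding R_def by (intro add_left_mono mult_left_mono sum_le_suminf) auto
      finally show ?thesis .
    qed
    \<comment> \<open>Only a subsequence of the bump means is known to converge a.e.; this suffices,
      since the bound \<open>R x\<close> holds for every \<open>K\<close>.\<close>
    obtain j where j: "AE x in lebesgue_on \<Omega>. (\<lambda>k. W (j k) x) \<longlonglongrightarrow> bump_mass * u x"
      using bump_mean_AE_subseq[OF um h(2) kr(1) slim s(1), of d] unfolding W_def by blast
    have ae: "AE x in lebesgue. ennreal (\<bar>bump_mass * u x - m\<bar> ^ (2 * N)) * indicator (\<Omega> \<inter> ball x0 \<delta>) x \<le> R x * indicator \<Omega> x"
      using j unfolding AE_lebesgue_on_iff[OF dom_borel] AE_completion_iff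
    proof eventually_elim
      case (elim x)
      show ?case
      proof (cases "x \<in> \<Omega> \<inter> ball x0 \<delta>")
        case True
        then have "(\<lambda>k. W (j k) x) \<longlonglongrightarrow> bump_mass * u x" using elim by simp
        then have "(\<lambda>k. ennreal (\<bar>W (j k) x - m\<bar> ^ (2 * N))) \<longlonglongrightarrow> ennreal (\<bar>bump_mass * u x - m\<bar> ^ (2 * N))"
          by (intro tendsto_intros)
        then have "ennreal (\<bar>bump_mass * u x - m\<bar> ^ (2 * N)) \<le> R x"
          by (rule LIMSEQ_le_const2) (use pwR True in auto)
        then show ?thesis using True by simp
      qed simp
    qed
    have Am: "(\<lambda>x. ennreal (2 ^ k * A k x)) \<in> borel_measurable borel" for k
      using local_energy_integral(1)[OF h(1), of "2 * s k"] s(1)[of k] A0(1) by (simp add: ennreal_mult A_def less_imp_le)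
    \<comment> \<open>The integral of \<open>A k\<close> is
      \<open>16 * r\<^sup>2 * E / 4 ^ k\<close>; the weight \<open>2 ^ k\<close> leaves a geometric
      series with sum \<open>32 * r\<^sup>2 * E\<close>.\<close>
    have Ai: "(\<integral>\<^sup>+x. ennreal (2 ^ k * A k x) \<partial>lborel) = ennreal (16 * r\<^sup>2 * E * (1/2) ^ k)" for k
    proof -
      have "(\<integral>\<^sup>+x. ennreal (2 ^ k * A k x) \<partial>lborel) = ennreal (2 ^ k) * (\<integral>\<^sup>+x. ennreal (A k x) \<partial>lborel)"
        using local_energy_integral(1)[OF h(1), of "2 * s k"] s(1)[of k] A0(1)
        by (simp add: ennreal_mult nn_integral_cmult A_def less_imp_le)
      also have "(\<integral>\<^sup>+x. ennreal (A k x) \<partial>lborel) = ennreal (4 * (2 * s k)\<^sup>2 * E)"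
        unfolding A_def E_def using s(1)[of k] by (intro local_energy_integral(2)[OF h(1)]) simp
      also have "ennreal (2 ^ k) * \<dots> = ennreal (2 ^ k * (4 * (2 * s k)\<^sup>2 * E))" by (simp add: ennreal_mult')
      also have "2 ^ k * (4 * (2 * s k)\<^sup>2 * E) = 16 * r\<^sup>2 * E * (1/2) ^ k"
        by (simp add: s_def power_divide power2_eq_square field_simps)
      finally show ?thesis .
    qed
    have "(\<lambda>k. 16 * r\<^sup>2 * E * (1/2) ^ k) sums (16 * r\<^sup>2 * E * (1 / (1 - 1/2)))"
      by (intro sums_mult geometric_sums) simp
    then have sm: "(\<lambda>k. 16 * r\<^sup>2 * E * (1/2) ^ k) sums (32 * r\<^sup>2 * E)" by (simp add: mult.assoc)
    have ss: "(\<Sum>k. ennreal (16 * r\<^sup>2 * E * (1/2) ^ k)) = ennreal (32 * r\<^sup>2 * E)"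
      using E0 sm by (intro suminf_ennreal_eq) auto
    have "(\<integral>\<^sup>+x. ennreal (\<bar>bump_mass * u x - m\<bar> ^ (2 * N)) * indicator (\<Omega> \<inter> ball x0 \<delta>) x \<partial>lebesgue) \<le> (\<integral>\<^sup>+x. R x * indicator \<Omega> x \<partial>lebesgue)"
      by (rule nn_integral_mono_AE[OF ae])
    also have "\<dots> = (\<integral>\<^sup>+x. R x * indicator \<Omega> x \<partial>lborel)" by (rule nn_integral_completion)
    also have "\<dots> \<le> (\<integral>\<^sup>+x. ennreal c1 * indicator \<Omega> x + ennreal c2 * (\<Sum>k. ennreal (2 ^ k * A k x)) \<partial>lborel)"
      unfolding R_def by (intro nn_integral_mono) (auto simp: indicator_def)
    also have "\<dots> = ennreal c1 * emeasure lborel \<Omega> + ennreal c2 * (\<integral>\<^sup>+x. (\<Sum>k. ennreal (2 ^ k * A k x)) \<partial>lborel)"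
      using Am by (subst nn_integral_add) (auto simp: nn_integral_cmult nn_integral_cmult_indicator)
    also have "(\<integral>\<^sup>+x. (\<Sum>k. ennreal (2 ^ k * A k x)) \<partial>lborel) = (\<Sum>k. (\<integral>\<^sup>+x. ennreal (2 ^ k * A k x) \<partial>lborel))"
      using Am by (intro nn_integral_suminf) auto
    also have "\<dots> = ennreal (32 * r\<^sup>2 * E)" unfolding Ai ss ..
    also have "emeasure lborel \<Omega> = ennreal (measure lebesgue \<Omega>)"
    proof -
      have "emeasure lebesgue \<Omega> = ennreal (measure lebesgue \<Omega>)" using dom_lmeasurable by (intro emeasure_eq_ennreal_measure) (auto simp: fmeasurable_def)
      then show ?thesis by simp
    qed
    also have "ennreal c1 * ennreal (measure lebesgue \<Omega>) + ennreal c2 * ennreal (32 * r\<^sup>2 * E) = ennreal (c1 * measure lebesgue \<Omega> + c2 * (32 * r\<^sup>2 * E))"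
      using c E0 by (simp add: ennreal_mult ennreal_plus)
    also have "c1 * measure lebesgue \<Omega> + c2 * (32 * r\<^sup>2 * E) = D * E ^ N"
    proof -
      have "E ^ N = E ^ (N - 1) * E" by (simp only: power_minus_mult[OF N])
      then show ?thesis by (simp add: D_def c1_def c2_def algebra_simps)
    qed
    finally show "(\<integral>\<^sup>+x. ennreal (\<bar>bump_mass * u x - bump_mean \<Omega> u cs \<sigma>\<bar> ^ (2 * N)) * indicator (\<Omega> \<inter> ball x0 \<delta>) x \<partial>lebesgue) \<le> ennreal (D * energy \<Omega> g ^ N)"
      unfolding m_def E_def .
  qed
qed

end

context R2_smooth_step
begin

text \<open>Compactness of the closure: finitely many of the local balls cover the domain, and their
  bounds add up because all of them subtract the same bump mean.\<close>

lemma global_sobolev: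
  assumes dom: "smooth_bounded_domain \<Omega>" and cs: "cs \<in> \<Omega>" "\<sigma> > 0" "square cs \<sigma> \<subseteq> \<Omega>" and N: "N > 0"
  obtains C where "C \<ge> 0" "\<And>u g. H1_pair \<Omega> u g \<Longrightarrow>
     (\<integral>\<^sup>+x. ennreal (\<bar>bump_mass * u x - bump_mean \<Omega> u cs \<sigma>\<bar> ^ (2 * N)) * indicator \<Omega> x \<partial>lebesgue) \<le> ennreal (C * energy \<Omega> g ^ N)"
proof -
  define Q where "Q x0 \<delta> C \<longleftrightarrow> \<delta> > 0 \<and> C \<ge> 0 \<and> (\<forall>u g. H1_pair \<Omega> u g \<longrightarrow>
     (\<integral>\<^sup>+x. ennreal (\<bar>bump_mass * u x - bump_mean \<Omega> u cs \<sigma>\<bar> ^ (2 * N)) * indicator (\<Omega> \<inter> ball x0 \<delta>) x \<partial>lebesgue) \<le> ennreal (C * energy \<Omega> g ^ N))"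
    for x0 \<delta> C
  have "\<exists>\<delta> C. Q x0 \<delta> C" if "x0 \<in> closure \<Omega>" for x0
    unfolding Q_def
    apply (rule local_sobolev[OF dom cs that N])
    subgoal for \<delta> C by (intro exI[of _ \<delta>] exI[of _ C] conjI allI impI)
    done
  then obtain \<delta> C where Q: "\<And>x0. x0 \<in> closure \<Omega> \<Longrightarrow> Q x0 (\<delta> x0) (C x0)" by metis
  have dC: "\<And>x0. x0 \<in> closure \<Omega> \<Longrightarrow> \<delta> x0 > 0" "\<And>x0. x0 \<in> closure \<Omega> \<Longrightarrow> C x0 \<ge> 0"
    "\<And>x0 u g. x0 \<in> closure \<Omega> \<Longrightarrow> H1_pair \<Omega> u g \<Longrightarrow>
     (\<integral>\<^sup>+x. ennreal (\<bar>bump_mass * u x - bump_mean \<Omega> u cs \<sigma>\<bar> ^ (2 * N)) * indicator (\<Omega> \<inter> ball x0 (\<delta> x0)) x \<partial>lebesgue) \<le> ennreal (C x0 * energy \<Omega> g ^ N)"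
    using Q unfolding Q_def by blast+
  have cpt: "compact (closure \<Omega>)" using bounded_dom by simp
  have cov: "closure \<Omega> \<subseteq> (\<Union>x\<in>closure \<Omega>. ball x (\<delta> x))" using dC(1) by force
  obtain K where K: "K \<subseteq> closure \<Omega>" "finite K" "closure \<Omega> \<subseteq> (\<Union>x\<in>K. ball x (\<delta> x))"
    by (rule compactE_image[OF cpt open_ball cov])
  show ?thesis
  proof (rule that[of "\<Sum>x\<in>K. C x"])
    show "(\<Sum>x\<in>K. C x) \<ge> 0" using K dC(2) by (intro sum_nonneg) auto
    fix u g assume H: "H1_pair \<Omega> u g"
    define h where "h x = ennreal (\<bar>bump_mass * u x - bump_mean \<Omega> u cs \<sigma>\<bar> ^ (2 * N))" for x
    have um: "u \<in> borel_measurable (lebesgue_on \<Omega>)" using H by (simp add: H1_pair_def)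
    have hm: "(\<lambda>x. h x * indicator (\<Omega> \<inter> ball y r) x) \<in> borel_measurable lebesgue" for y r
    proof -
      have "h \<in> borel_measurable (lebesgue_on \<Omega>)" unfolding h_def[abs_def] using um by measurable
      then have "(\<lambda>x. h x * indicator \<Omega> x) \<in> borel_measurable lebesgue"
        by (simp add: borel_measurable_restrict_space_iff_ennreal)
      moreover have "ball y r \<in> sets lebesgue" by simp
      ultimately have "(\<lambda>x. (h x * indicator \<Omega> x) * indicator (ball y r) x) \<in> borel_measurable lebesgue"
        by (rule borel_measurable_times_ennreal[OF _ borel_measurable_indicator])
      also have "(\<lambda>x. (h x * indicator \<Omega> x) * indicator (ball y r) x) = (\<lambda>x. h x * indicator (\<Omega> \<inter> ball y r) x)"
        by (auto simp: indicator_def)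
      finally show ?thesis .
    qed
    have "(\<integral>\<^sup>+x. h x * indicator \<Omega> x \<partial>lebesgue) \<le> (\<integral>\<^sup>+x. (\<Sum>y\<in>K. h x * indicator (\<Omega> \<inter> ball y (\<delta> y)) x) \<partial>lebesgue)"
    proof (rule nn_integral_mono)
      fix x
      show "h x * indicator \<Omega> x \<le> (\<Sum>y\<in>K. h x * indicator (\<Omega> \<inter> ball y (\<delta> y)) x)"
      proof (cases "x \<in> \<Omega>")
        case True
        then obtain y where y: "y \<in> K" "x \<in> ball y (\<delta> y)" using K(3) closure_subset by blast
        then have "h x * indicator \<Omega> x = h x * indicator (\<Omega> \<inter> ball y (\<delta> y)) x" using True by simp
        also have "\<dots> \<le> (\<Sum>y\<in>K. h x * indicator (\<Omega> \<inter> ball y (\<delta> y)) x)" using y(1) K(2) by (intro member_le_sum) auto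
        finally show ?thesis .
      qed simp
    qed
    also have "\<dots> = (\<Sum>y\<in>K. \<integral>\<^sup>+x. h x * indicator (\<Omega> \<inter> ball y (\<delta> y)) x \<partial>lebesgue)"
      by (rule nn_integral_sum[OF hm])
    also have "\<dots> \<le> (\<Sum>y\<in>K. ennreal (C y * energy \<Omega> g ^ N))"
      unfolding h_def using K dC(3)[OF _ H] by (intro sum_mono) auto
    also have "\<dots> = ennreal ((\<Sum>y\<in>K. C y) * energy \<Omega> g ^ N)"
      using K dC(2) energy_nonneg[of \<Omega> g] by (subst sum_ennreal) (auto simp: sum_distrib_right subset_iff)
    finally show "(\<integral>\<^sup>+x. ennreal (\<bar>bump_mass * u x - bump_mean \<Omega> u cs \<sigma>\<bar> ^ (2 * N)) * indicator \<Omega> x \<partial>lebesgue) \<le> ennreal ((\<Sum>y\<in>K. C y) * energy \<Omega> g ^ N)"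
      unfolding h_def .
  qed
qed

section \<open>Fundamental lemma of the calculus of variations and uniqueness of the weak
  gradient\<close>

lemma bump_test_function:
  assumes "\<sigma> > 0" "square c \<sigma> \<subseteq> \<Omega>"
  shows "test_function \<Omega> (bump c \<sigma>)"
proof -
  obtain d1 where d1: "\<And>t. (bump1 (c $ 1) \<sigma> has_real_derivative d1 t) (at t)" using smooth1_derivE[OF bump1_smooth] by metis
  obtain d2 where d2: "\<And>t. (bump1 (c $ 2) \<sigma> has_real_derivative d2 t) (at t)" using smooth1_derivE[OF bump1_smooth] by metis
  show ?thesis
    unfolding bump_def[abs_def]
    by (rule product_test_function(1)[OF bump1_smooth d1 bump1_smooth d2 _ _ assms(2)])
       (use bump1_out[OF assms(1)] in auto)
qed

text \<open>For \<open>x\<close> in the domain, small bumps centred at \<open>x\<close> are test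
  functions, so the means of \<open>h\<close> against them vanish; along a subsequence these means
  converge a.e. to \<open>bump_mass * h x\<close>.\<close>

lemma AE_zero_of_test_functions:
  assumes h: "h \<in> borel_measurable (lebesgue_on \<Omega>)" "integrable (lebesgue_on \<Omega>) h"
    and z: "\<And>\<phi>. test_function \<Omega> \<phi> \<Longrightarrow> (\<integral>x. h x * \<phi> x \<partial>lebesgue_on \<Omega>) = 0"
  shows "AE x in lebesgue_on \<Omega>. h x = 0"
proof -
  define s :: "nat \<Rightarrow> real" where "s k = 1 / 2 ^ k" for k
  have s: "s \<longlonglongrightarrow> 0" "s k > 0" for k
    unfolding s_def[abs_def] by (rule LIMSEQ_divide_realpow_zero) simp_all
  obtain r where r: "strict_mono r"
    "AE x in lebesgue_on \<Omega>. (\<lambda>k. bump_mean \<Omega> h (x + s (r k) *\<^sub>R 0) (s (r k) * 1)) \<longlonglongrightarrow> bump_mass * h x"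
    by (rule bump_mean_AE_subseq[OF h zero_less_one s, of 0])
  have "AE x in lebesgue_on \<Omega>. x \<in> \<Omega>" by (metis AE_space space_lebesgue_on)
  with r(2) show ?thesis
  proof eventually_elim
    case (elim x)
    obtain \<sigma> where \<sigma>: "\<sigma> > 0" "square x \<sigma> \<subseteq> \<Omega>" using square_subset_open[OF open_dom elim(2)] by blast
    have "(\<lambda>k. s (r k)) \<longlonglongrightarrow> 0" using LIMSEQ_subseq_LIMSEQ[OF s(1) r(1)] by (simp add: o_def)
    then have "\<forall>\<^sub>F k in sequentially. s (r k) < \<sigma>" using \<sigma>(1) by (rule order_tendstoD)
    then have "\<forall>\<^sub>F k in sequentially. bump_mean \<Omega> h (x + s (r k) *\<^sub>R 0) (s (r k) * 1) = 0"
    proof eventually_elim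
      case (elim k)
      have "square x (s (r k)) \<subseteq> \<Omega>" using elim \<sigma>(2) by (fastforce simp: subset_iff mem_square)
      then show ?case unfolding bump_mean_def using z[OF bump_test_function[OF s(2)]] by simp
    qed
    then have "(\<lambda>k. bump_mean \<Omega> h (x + s (r k) *\<^sub>R 0) (s (r k) * 1)) \<longlonglongrightarrow> 0" by (rule tendsto_eventually)
    then have "bump_mass * h x = 0" using elim(1) LIMSEQ_unique by blast
    then show "h x = 0" using bump_mass_pos by simp
  qed
qed

end

lemma smooth_bounded_domain_R2: "smooth_bounded_domain \<Omega> \<Longrightarrow> R2_domain \<Omega>"
  by (simp add: smooth_bounded_domain_def R2_domain_def)

text \<open>One constant \<open>B\<close> bounds the function, bounds its derivative in direction
  \<open>v\<close>, and is the radius of a ball containing the support. Off the compact support the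
  function vanishes on a neighbourhood, so the derivative vanishes there too.\<close>

lemma test_function_bounded:
  assumes "test_function \<Omega> \<phi>"
  obtains B where "\<And>x. \<bar>\<phi> x\<bar> \<le> B" "\<And>x. \<bar>frechet_derivative \<phi> (at x) v\<bar> \<le> B"
    and "\<phi> \<in> borel_measurable borel" "(\<lambda>x. frechet_derivative \<phi> (at x) v) \<in> borel_measurable borel"
    and "\<And>x. x \<notin> \<Omega> \<Longrightarrow> \<phi> x = 0" "\<And>x. x \<notin> \<Omega> \<Longrightarrow> frechet_derivative \<phi> (at x) v = 0"
    and "\<And>x. norm x > B \<Longrightarrow> \<phi> x = 0"
proof -
  define K where "K = closure {x. \<phi> x \<noteq> 0}"
  have s: "smooth_on UNIV \<phi>" and K: "compact K" "K \<subseteq> \<Omega>" using assms by (auto simp: test_function_def K_def)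
  have z: "\<phi> x = 0" if "x \<notin> K" for x using that closure_subset[of "{x. \<phi> x \<noteq> 0}"] by (auto simp: K_def)
  have dz: "frechet_derivative \<phi> (at x) v = 0" if "x \<notin> K" for x
  proof -
    have "open (- K)" using K(1) compact_imp_closed by auto
    then have "\<forall>\<^sub>F y in nhds x. y \<in> - K" using that by (intro eventually_nhds_in_open) auto
    then have "\<forall>\<^sub>F y in nhds x. \<phi> y = 0" by eventually_elim (simp add: z)
    then have ev: "\<forall>\<^sub>F y in at x. \<phi> y = (\<lambda>_. 0) y" "\<phi> x = 0" using z[OF that] by (auto simp: eventually_nhds_conv_at)
    have "((\<lambda>_. 0 :: real) has_derivative frechet_derivative \<phi> (at x)) (at x)"
      by (rule has_derivative_transform_eventually[OF smooth_on_has_derivative[OF s] ev(1)]) (use ev in auto)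
    from has_derivative_unique[OF this has_derivative_const] show ?thesis by simp
  qed
  have c: "continuous_on UNIV \<phi>" "continuous_on UNIV (\<lambda>x. frechet_derivative \<phi> (at x) v)"
    using s smooth_on_continuous smooth_on_continuous_frechet by auto
  have "bounded (\<phi> ` K)" "bounded ((\<lambda>x. frechet_derivative \<phi> (at x) v) ` K)" "bounded K"
    using K c by (auto intro!: compact_imp_bounded compact_continuous_image intro: continuous_on_subset)
  then obtain B1 B2 B3 where B: "\<forall>x\<in>K. \<bar>\<phi> x\<bar> \<le> B1" "\<forall>x\<in>K. \<bar>frechet_derivative \<phi> (at x) v\<bar> \<le> B2" "\<forall>x\<in>K. norm x \<le> B3"
    unfolding bounded_iff by auto
  define B where "B = \<bar>B1\<bar> + \<bar>B2\<bar> + \<bar>B3\<bar>"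
  show ?thesis
  proof (rule that[of B])
    show "\<bar>\<phi> x\<bar> \<le> B" for x using B(1) z[of x] by (cases "x \<in> K") (force simp: B_def)+
    show "\<bar>frechet_derivative \<phi> (at x) v\<bar> \<le> B" for x using B(2) dz[of x] by (cases "x \<in> K") (force simp: B_def)+
    show "\<phi> x = 0" if "norm x > B" for x using that B(3) z[of x] by (cases "x \<in> K") (force simp: B_def)+
  qed (use c z dz K(2) in \<open>auto intro: borel_measurable_continuous_onI\<close>)
qed

lemma weak_gradient_unique:
  assumes dom: "smooth_bounded_domain \<Omega>" and g: "weak_gradient \<Omega> u g" "weak_gradient \<Omega> u g'"
  shows "AE x in lebesgue_on \<Omega>. g x = g' x"
proof -
  obtain F \<beta> S where st: "smooth_step F \<beta> S" by (rule smooth_step_locale)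
  interpret R2_smooth_step \<Omega> F \<beta> S
    by (intro R2_smooth_step.intro smooth_bounded_domain_R2 dom st)
  note d = weak_gradientD[OF g(1)] weak_gradientD[OF g(2)]
  have "AE x in lebesgue_on \<Omega>. g x $ i - g' x $ i = 0" for i
  proof (rule AE_zero_of_test_functions)
    have i: "integrable (lebesgue_on \<Omega>) (\<lambda>x. g x $ i)" "integrable (lebesgue_on \<Omega>) (\<lambda>x. g' x $ i)"
      by (rule integrable_of_square[OF d(3,4)] integrable_of_square[OF d(7,8)])+
    show "(\<lambda>x. g x $ i - g' x $ i) \<in> borel_measurable (lebesgue_on \<Omega>)" using d by auto
    show "integrable (lebesgue_on \<Omega>) (\<lambda>x. g x $ i - g' x $ i)" using i by auto
    fix \<phi> assume t: "test_function \<Omega> \<phi>"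
    obtain B where B: "\<And>x. \<bar>\<phi> x\<bar> \<le> B" "\<phi> \<in> borel_measurable borel"
      apply (rule test_function_bounded[OF t, of 0])
      subgoal premises p for B by (rule that[OF p(2,4)]) done
    note bb = borel_measurable_lebesgue_on[OF B(2)] B(1)
    have "(\<integral>x. (g x $ i - g' x $ i) * \<phi> x \<partial>lebesgue_on \<Omega>) = (\<integral>x. g x $ i * \<phi> x \<partial>lebesgue_on \<Omega>) - (\<integral>x. g' x $ i * \<phi> x \<partial>lebesgue_on \<Omega>)"
      unfolding left_diff_distrib using integrable_mult_bounded[OF i(1) bb] integrable_mult_bounded[OF i(2) bb] by simp
    also have "\<dots> = 0" using g t by (simp add: weak_gradient_def)
    finally show "(\<integral>x. (g x $ i - g' x $ i) * \<phi> x \<partial>lebesgue_on \<Omega>) = 0" .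
  qed
  from this[of 1] this[of 2] show ?thesis by eventually_elim (simp add: vec_eq_iff forall_2)
qed

lemma grad_norm_sq_eq_energy:
  assumes dom: "smooth_bounded_domain \<Omega>" and g: "weak_gradient \<Omega> u g"
  shows "grad_norm_sq \<Omega> u = energy \<Omega> g"
proof -
  define g' where "g' = (SOME g. weak_gradient \<Omega> u g)"
  have g': "weak_gradient \<Omega> u g'" unfolding g'_def by (rule someI[of "\<lambda>g. weak_gradient \<Omega> u g", OF g])
  have "AE x in lebesgue_on \<Omega>. g' x = g x" by (rule weak_gradient_unique[OF dom g' g])
  then have "energy \<Omega> g' = energy \<Omega> g" unfolding energy_def
    using weak_gradientD(2)[OF g] weak_gradientD(2)[OF g'] by (intro integral_cong_AE) auto
  then show ?thesis by (simp add: grad_norm_sq_def energy_def g'_def)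
qed

text \<open>The constant \<open>m\<close> is left existential: it is a normalised bump mean, not the
  mean of \<open>u\<close>, and depends on an auxiliary square. The later uses need only its
  existence.\<close>

lemma poincare_sobolev:
  assumes dom: "smooth_bounded_domain \<Omega>" and N: "N > 0"
  obtains C where "C \<ge> 0" "\<And>u g. H1_pair \<Omega> u g \<Longrightarrow> \<exists>m. integrable (lebesgue_on \<Omega>) (\<lambda>x. (u x - m) ^ (2 * N)) \<and>
     (\<integral>x. (u x - m) ^ (2 * N) \<partial>lebesgue_on \<Omega>) \<le> C * energy \<Omega> g ^ N"
proof -
  obtain F \<beta> S where st: "smooth_step F \<beta> S" by (rule smooth_step_locale)
  interpret R2_smooth_step \<Omega> F \<beta> S
    by (intro R2_smooth_step.intro smooth_bounded_domain_R2 dom st)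
  obtain cs where cs: "cs \<in> \<Omega>" using dom by (auto simp: smooth_bounded_domain_def)
  obtain \<sigma> where \<sigma>: "\<sigma> > 0" "square cs \<sigma> \<subseteq> \<Omega>" using square_subset_open[OF open_dom cs] by blast
  obtain C where C: "C \<ge> 0" "\<And>u g. H1_pair \<Omega> u g \<Longrightarrow>
     (\<integral>\<^sup>+x. ennreal (\<bar>bump_mass * u x - bump_mean \<Omega> u cs \<sigma>\<bar> ^ (2 * N)) * indicator \<Omega> x \<partial>lebesgue) \<le> ennreal (C * energy \<Omega> g ^ N)"
    apply (rule global_sobolev[OF dom cs \<sigma> N])
    subgoal premises p for C by (rule that[OF p(2-)]) done
  show ?thesis
  proof (rule that[of "C / bump_mass ^ (2 * N)"])
    show "C / bump_mass ^ (2 * N) \<ge> 0" using C(1) bump_mass_pos by simp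
    fix u g assume H: "H1_pair \<Omega> u g"
    have um: "u \<in> borel_measurable (lebesgue_on \<Omega>)" using H by (simp add: H1_pair_def)
    define m where "m = bump_mean \<Omega> u cs \<sigma> / bump_mass"
    have eq: "\<bar>bump_mass * u x - bump_mean \<Omega> u cs \<sigma>\<bar> ^ (2 * N) = bump_mass ^ (2 * N) * (u x - m) ^ (2 * N)" for x
    proof -
      have "bump_mass * u x - bump_mean \<Omega> u cs \<sigma> = bump_mass * (u x - m)"
        using bump_mass_pos by (simp add: m_def field_simps)
      then show ?thesis by (simp add: power_even_abs power_mult_distrib)
    qed
    have le: "(\<integral>\<^sup>+x. ennreal (bump_mass ^ (2 * N) * (u x - m) ^ (2 * N)) \<partial>lebesgue_on \<Omega>) \<le> ennreal (C * energy \<Omega> g ^ N)"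
      using C(2)[OF H] unfolding eq by (simp add: nn_integral_restrict_space)
    have nn: "bump_mass ^ (2 * N) * (u x - m) ^ (2 * N) \<ge> 0" for x using bump_mass_pos by simp
    have i: "integrable (lebesgue_on \<Omega>) (\<lambda>x. bump_mass ^ (2 * N) * (u x - m) ^ (2 * N))"
      using um le nn by (intro integrableI_nonneg) (auto simp: le_less_trans[OF le])
    have "ennreal (\<integral>x. bump_mass ^ (2 * N) * (u x - m) ^ (2 * N) \<partial>lebesgue_on \<Omega>) \<le> ennreal (C * energy \<Omega> g ^ N)"
      using le nn_integral_eq_integral[OF i] nn by simp
    then have l2: "(\<integral>x. bump_mass ^ (2 * N) * (u x - m) ^ (2 * N) \<partial>lebesgue_on \<Omega>) \<le> C * energy \<Omega> g ^ N"
      using C(1) energy_nonneg[of \<Omega> g] by (simp add: ennreal_le_iff)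
    have p: "bump_mass ^ (2 * N) > 0" using bump_mass_pos by simp
    show "\<exists>m. integrable (lebesgue_on \<Omega>) (\<lambda>x. (u x - m) ^ (2 * N)) \<and>
     (\<integral>x. (u x - m) ^ (2 * N) \<partial>lebesgue_on \<Omega>) \<le> C / bump_mass ^ (2 * N) * energy \<Omega> g ^ N"
      using i l2 p bump_mass_pos by (intro exI[of _ m]) (simp add: field_simps)
  qed
qed

section \<open>Functions of small energy\<close>

lemma has_derivative_line:
  assumes "(f has_derivative f') (at (x + t *\<^sub>R e))"
  shows "((\<lambda>t. f (x + t *\<^sub>R e)) has_real_derivative f' e) (at t)"
proof -
  have "((\<lambda>s. x + s *\<^sub>R e) has_derivative (\<lambda>h. h *\<^sub>R e)) (at t)" by (auto intro!: derivative_eq_intros)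
  from has_derivative_compose[OF this assms]
  show ?thesis unfolding has_field_derivative_def
    by (rule has_derivative_eq_rhs) (auto simp: fun_eq_iff linear_scale[OF has_derivative_linear[OF assms]])
qed

text \<open>Integrals of difference quotients vanish by translation invariance.\<close>

lemma integral_directional_derivative_eq_0:
  fixes f :: "'a::euclidean_space \<Rightarrow> real"
  assumes der: "\<And>x. (f has_derivative f' x) (at x)" and cont: "continuous_on UNIV (\<lambda>x. f' x e)"
    and z: "\<And>x. norm x > R \<Longrightarrow> f x = 0"
  shows "(\<integral>x. f' x e \<partial>lborel) = 0"
proof -
  have fc: "continuous_on UNIV f" using der by (intro differentiable_imp_continuous_on) (auto simp: differentiable_on_def differentiable_def)
  have [measurable]: "f \<in> borel_measurable borel" by (rule borel_measurable_continuous_onI[OF fc])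
  have [measurable]: "(\<lambda>x. f' x e) \<in> borel_measurable borel" by (rule borel_measurable_continuous_onI[OF cont])
  have dz: "f' x e = 0" if "norm x > R" for x
  proof -
    have "open {x. norm x > R}" by (intro open_Collect_less continuous_intros)
    then have "\<forall>\<^sub>F y in nhds x. y \<in> {x. norm x > R}" using that by (intro eventually_nhds_in_open) auto
    then have "\<forall>\<^sub>F y in at x. f y = (\<lambda>_. 0) y" unfolding eventually_nhds_conv_at
      by (elim conjE eventually_mono) (simp add: z)
    then have "((\<lambda>_. 0 :: real) has_derivative f' x) (at x)"
      by (rule has_derivative_transform_eventually[OF der]) (use z that in auto)
    from has_derivative_unique[OF this has_derivative_const] show ?thesis by simp
  qed
  have "bounded ((\<lambda>x. f' x e) ` cball 0 R)" "bounded (f ` cball 0 R)"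
    using cont fc by (auto intro!: compact_imp_bounded compact_continuous_image intro: continuous_on_subset)
  then obtain M1 M2 where M12: "\<forall>x\<in>cball 0 R. \<bar>f' x e\<bar> \<le> M1" "\<forall>x\<in>cball 0 R. \<bar>f x\<bar> \<le> M2" unfolding bounded_iff by auto
  define M where "M = \<bar>M1\<bar> + \<bar>M2\<bar>"
  have M: "\<bar>f' x e\<bar> \<le> M" for x
  proof (cases "norm x > R")
    case False
    then have "x \<in> cball 0 R" by simp
    then show ?thesis using M12(1) unfolding M_def by (smt (verit))
  qed (simp add: dz M_def)
  have Mf: "\<bar>f x\<bar> \<le> M" for x
  proof (cases "norm x > R")
    case False
    then have "x \<in> cball 0 R" by simp
    then show ?thesis using M12(2) unfolding M_def by (smt (verit))
  qed (simp add: z M_def)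
  have fi: "integrable lborel f"
  proof (rule integrableI_bounded_set[where A="cball 0 R" and B=M])
    show "emeasure lborel (cball 0 R :: 'a set) < \<infinity>" by (rule emeasure_lborel_cball_finite)
  qed (use Mf z in auto)
  define D where "D n x = real (Suc n) * (f (x + (1 / real (Suc n)) *\<^sub>R e) - f x)" for n x
  have D0: "(\<integral>x. D n x \<partial>lborel) = 0" for n
    unfolding D_def using fi shift_integrable[OF fi] by (simp add: lborel_integral_shift)
  \<comment> \<open>By the mean value theorem the quotients are bounded by \<open>M\<close>; as the
    displacements are at most \<open>norm e\<close>, they vanish outside the ball of radius
    \<open>R + norm e\<close>.\<close>
  have "(\<lambda>n. \<integral>x. D n x \<partial>lborel) \<longlonglongrightarrow> (\<integral>x. f' x e \<partial>lborel)"
  proof (rule integral_dominated_convergence[where w="\<lambda>x. M * indicator (cball 0 (R + norm e)) x"])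
    show "integrable lborel (\<lambda>x. M * indicator (cball 0 (R + norm e)) x :: real)"
      by (intro integrable_mult_right integrable_real_indicator emeasure_lborel_cball_finite) simp
    show "AE x in lborel. (\<lambda>n. D n x) \<longlonglongrightarrow> f' x e"
    proof (rule AE_I2)
      fix x
      have "((\<lambda>t. f (x + t *\<^sub>R e)) has_real_derivative f' x e) (at 0)"
        using has_derivative_line[of f "f' x" x 0 e] der[of x] by simp
      then have l: "((\<lambda>t. (f (x + t *\<^sub>R e) - f x) / t) \<longlongrightarrow> f' x e) (at 0)" by (simp add: has_field_derivative_iff)
      have "filterlim (\<lambda>n. 1 / real (Suc n)) (at 0) sequentially"
        using LIMSEQ_inverse_real_of_nat by (intro filterlim_atI) (auto simp: inverse_eq_divide)
      from filterlim_compose[OF l this] show "(\<lambda>n. D n x) \<longlonglongrightarrow> f' x e" by (simp add: D_def mult.commute)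
    qed
    fix n
    show "AE x in lborel. norm (D n x) \<le> M * indicator (cball 0 (R + norm e)) x"
    proof (rule AE_I2)
      fix x
      let ?h = "1 / real (Suc n)"
      show "norm (D n x) \<le> M * indicator (cball 0 (R + norm e)) x"
      proof (cases "norm x \<le> R + norm e")
        case True
        have ln: "((\<lambda>t. f (x + t *\<^sub>R e)) has_real_derivative f' (x + s *\<^sub>R e) e) (at s)" for s
          by (rule has_derivative_line[OF der])
        have "\<exists>t. 0 < t \<and> t < ?h \<and> f (x + ?h *\<^sub>R e) - f (x + 0 *\<^sub>R e) = (?h - 0) * f' (x + t *\<^sub>R e) e"
          by (rule MVT2) (auto intro: ln)
        then obtain t where "f (x + ?h *\<^sub>R e) - f x = ?h * f' (x + t *\<^sub>R e) e" by auto
        then have "D n x = f' (x + t *\<^sub>R e) e" by (simp add: D_def)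
        then show ?thesis using M[of "x + t *\<^sub>R e"] True by simp
      next
        case False
        have "norm (?h *\<^sub>R e) \<le> norm e" by (simp add: divide_le_eq mult_le_cancel_left1)
        then have "norm (x + ?h *\<^sub>R e) > R" using False norm_triangle_ineq4[of "x + ?h *\<^sub>R e" "?h *\<^sub>R e"] by simp
        moreover have "norm x > R" using False norm_ge_zero[of e] by linarith
        ultimately show ?thesis using False z by (simp add: D_def)
      qed
    qed
  qed (auto simp: D_def)
  then show ?thesis by (simp add: D0 LIMSEQ_const_iff)
qed

context R2_domain
begin

lemma integrable_continuous_dom:
  assumes "continuous_on UNIV (f :: R2 \<Rightarrow> real)"
  shows "integrable (lebesgue_on \<Omega>) f"
proof -
  have "bounded (f ` closure \<Omega>)" using assms bounded_dom
    by (intro compact_imp_bounded compact_continuous_image) (auto intro: continuous_on_subset)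
  then obtain B where B: "\<forall>x\<in>closure \<Omega>. \<bar>f x\<bar> \<le> B" unfolding bounded_iff by auto
  show ?thesis
  proof (rule fin.integrable_const_bound[where B=B])
    have "\<And>x. x \<in> \<Omega> \<Longrightarrow> \<bar>f x\<bar> \<le> B" using B closure_subset by blast
    then show "AE x in lebesgue_on \<Omega>. norm (f x) \<le> B" by (intro AE_I2) simp
  qed (intro borel_measurable_lebesgue_on borel_measurable_continuous_onI assms)
qed

text \<open>The product \<open>\<psi> * \<phi>\<close> is compactly supported, so the integral of
  its derivative vanishes and the product rule gives the weak formulation. As \<open>\<psi>\<close>
  is differentiable on the whole plane and the domain is bounded, integrability follows from
  continuity.\<close>

lemma weak_gradient_C1:
  assumes der: "\<And>x. (\<psi> has_derivative \<psi>' x) (at x)" and cont: "\<And>i. continuous_on UNIV (\<lambda>x. \<psi>' x (axis i 1))"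
  shows "weak_gradient \<Omega> \<psi> (\<lambda>x. \<chi> i. \<psi>' x (axis i 1))"
  unfolding weak_gradient_def
proof (intro conjI allI impI)
  fix i :: 2
  show "integrable (lebesgue_on \<Omega>) (\<lambda>x. ((\<chi> i. \<psi>' x (axis i 1)) $ i)\<^sup>2)"
    by (intro integrable_continuous_dom) (auto intro!: continuous_intros cont)
  have "continuous_on UNIV (\<lambda>x. \<chi> i. \<psi>' x (axis i 1))" by (intro continuous_on_vec_lambda cont)
  then show "(\<lambda>x. \<chi> i. \<psi>' x (axis i 1)) \<in> borel_measurable (lebesgue_on \<Omega>)"
    by (intro measurable_restrict_space1 measurable_completion) (simp add: borel_measurable_continuous_onI)
  fix \<phi> assume t: "test_function \<Omega> \<phi>"
  let ?d = "\<lambda>x. frechet_derivative \<phi> (at x) (axis i 1)"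
  have sm: "smooth_on UNIV \<phi>" using t by (simp add: test_function_def)
  have pc: "continuous_on UNIV \<psi>" using der by (intro differentiable_imp_continuous_on) (auto simp: differentiable_on_def differentiable_def)
  note c = pc cont[of i] smooth_on_continuous[OF sm] smooth_on_continuous_frechet[OF sm, of "axis i 1"]
  obtain B where B: "\<And>x. x \<notin> \<Omega> \<Longrightarrow> \<phi> x = 0" "\<And>x. x \<notin> \<Omega> \<Longrightarrow> ?d x = 0" "\<And>x. norm x > B \<Longrightarrow> \<phi> x = 0"
    apply (rule test_function_bounded[OF t, of "axis i 1"])
    subgoal premises p for B by (rule that[OF p(6,7,8)]) done
  have "(\<integral>x. \<psi> x * ?d x \<partial>lebesgue_on \<Omega>) + (\<integral>x. \<psi>' x (axis i 1) * \<phi> x \<partial>lebesgue_on \<Omega>) = (\<integral>x. \<psi> x * ?d x + \<psi>' x (axis i 1) * \<phi> x \<partial>lebesgue_on \<Omega>)"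
    using c by (intro Bochner_Integration.integral_add[symmetric] integrable_continuous_dom continuous_intros) auto
  also have "\<dots> = (\<integral>x. indicator \<Omega> x * (\<psi> x * ?d x + \<psi>' x (axis i 1) * \<phi> x) \<partial>lborel)"
  proof (rule lebesgue_on_representative(2)[OF dom_borel])
    show b: "(\<lambda>x. \<psi> x * ?d x + \<psi>' x (axis i 1) * \<phi> x) \<in> borel_measurable borel"
      using c by (intro borel_measurable_continuous_onI continuous_intros) auto
    show "(\<lambda>x. \<psi> x * ?d x + \<psi>' x (axis i 1) * \<phi> x) \<in> borel_measurable (lebesgue_on \<Omega>)"
      by (rule borel_measurable_lebesgue_on[OF b])
  qed simp
  also have "(\<lambda>x. indicator \<Omega> x * (\<psi> x * ?d x + \<psi>' x (axis i 1) * \<phi> x)) = (\<lambda>x. \<psi> x * ?d x + \<psi>' x (axis i 1) * \<phi> x)"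
    using B(1,2) by (auto simp: indicator_def fun_eq_iff)
  also have "(\<integral>x. \<psi> x * ?d x + \<psi>' x (axis i 1) * \<phi> x \<partial>lborel) = 0"
  proof (rule integral_directional_derivative_eq_0[where f="\<lambda>x. \<psi> x * \<phi> x" and R=B])
    show "((\<lambda>x. \<psi> x * \<phi> x) has_derivative (\<lambda>v. \<psi> x * frechet_derivative \<phi> (at x) v + \<psi>' x v * \<phi> x)) (at x)" for x
      by (rule has_derivative_mult[OF der smooth_on_has_derivative[OF sm]])
    show "continuous_on UNIV (\<lambda>x. \<psi> x * ?d x + \<psi>' x (axis i 1) * \<phi> x)" using c by (intro continuous_intros)
  qed (use B in auto)
  finally show "(\<integral>x. \<psi> x * ?d x \<partial>lebesgue_on \<Omega>) = - (\<integral>x. (\<chi> i. \<psi>' x (axis i 1)) $ i * \<phi> x \<partial>lebesgue_on \<Omega>)" by simp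
qed

lemma integral_square_indicator:
  assumes "h \<ge> 0"
  shows integral_square_indicator_le: "(\<integral>x. indicat_real (square z h) x \<partial>lebesgue_on \<Omega>) \<le> 4 * h\<^sup>2"
    and "square z h \<subseteq> \<Omega> \<Longrightarrow> (\<integral>x. indicat_real (square z h) x \<partial>lebesgue_on \<Omega>) = 4 * h\<^sup>2"
proof -
  have eq: "(\<integral>x. indicat_real (square z h) x \<partial>lebesgue_on \<Omega>) = (\<integral>y. indicator \<Omega> y * indicat_real (square z h) y \<partial>lborel)"
    by (rule lebesgue_on_representative(2)[OF dom_borel]) (auto intro!: borel_measurable_lebesgue_on)
  have m: "(\<integral>y. indicat_real (square z h) y \<partial>lborel) = 4 * h\<^sup>2"
    using emeasure_square[OF assms, of z] by (simp add: measure_def)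
  have i: "integrable lborel (indicat_real (square z h))"
    by (rule integrable_real_indicator) (auto simp: emeasure_square[OF assms])
  show "(\<integral>x. indicat_real (square z h) x \<partial>lebesgue_on \<Omega>) \<le> 4 * h\<^sup>2"
    unfolding eq m[symmetric] by (rule integral_mono'[OF i]) (auto simp: indicator_def)
  assume s: "square z h \<subseteq> \<Omega>"
  have e2: "(\<lambda>y. indicator \<Omega> y * indicat_real (square z h) y) = indicat_real (square z h)"
    using s by (auto simp: indicator_def fun_eq_iff)
  show "(\<integral>x. indicat_real (square z h) x \<partial>lebesgue_on \<Omega>) = 4 * h\<^sup>2" unfolding eq e2 by (rule m)
qed

end

lemma square_sum_disjoint:
  fixes c :: "'i \<Rightarrow> real"
  assumes "finite I" "\<And>i j. i \<in> I \<Longrightarrow> j \<in> I \<Longrightarrow> i \<noteq> j \<Longrightarrow> c i * c j = 0"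
  shows "(\<Sum>i\<in>I. c i)\<^sup>2 = (\<Sum>i\<in>I. (c i)\<^sup>2)"
proof -
  have "(\<Sum>i\<in>I. c i)\<^sup>2 = (\<Sum>i\<in>I. \<Sum>j\<in>I. c i * c j)" by (simp add: power2_eq_square sum_product)
  also have "\<dots> = (\<Sum>i\<in>I. (c i)\<^sup>2)"
  proof (rule sum.cong[OF refl])
    fix i assume i: "i \<in> I"
    have "(\<Sum>j\<in>I. c i * c j) = (\<Sum>j\<in>I. if i = j then (c i)\<^sup>2 else 0)"
      using assms(2)[OF i] by (intro sum.cong) (auto simp: power2_eq_square)
    then show "(\<Sum>j\<in>I. c i * c j) = (c i)\<^sup>2" using assms(1) i by simp
  qed
  finally show ?thesis .
qed

section \<open>Plateau profiles\<close>

context smooth_step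
begin

text \<open>An ascending step with transition in \<open>[-2, -1]\<close> times a descending one with
  transition in \<open>[1, 2]\<close>: equal to 1 on \<open>[-1, 1]\<close> and to 0 outside
  \<open>[-2, 2]\<close>.\<close>

definition plateau :: "real \<Rightarrow> real" where "plateau t = F (2 * t + 3) * F (3 - 2 * t)"
definition plateau' :: "real \<Rightarrow> real" where
  "plateau' t = 2 * \<beta> (2 * t + 3) * F (3 - 2 * t) - 2 * \<beta> (3 - 2 * t) * F (2 * t + 3)"

lemma plateau_deriv: "(plateau has_real_derivative plateau' t) (at t)"
proof -
  have a: "((\<lambda>t. F (2 * t + 3)) has_real_derivative \<beta> (2 * t + 3) * 2) (at t)"
    by (rule DERIV_chain2[OF F_deriv]) (auto intro!: derivative_eq_intros)
  have b: "((\<lambda>t. F (3 - 2 * t)) has_real_derivative \<beta> (3 - 2 * t) * (- 2)) (at t)"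
    by (rule DERIV_chain2[OF F_deriv]) (auto intro!: derivative_eq_intros)
  show ?thesis unfolding plateau_def[abs_def]
    by (rule DERIV_mult[OF a b, THEN DERIV_cong]) (simp add: plateau'_def)
qed

lemma plateau_continuous: "continuous_on UNIV plateau" "continuous_on UNIV plateau'"
  unfolding plateau_def[abs_def] plateau'_def[abs_def]
  by (intro continuous_intros continuous_on_compose2[OF smooth1_continuous[OF smooth_F, of UNIV]]
    continuous_on_compose2[OF smooth1_continuous[OF smooth_\<beta>, of UNIV]]; simp)+

lemma plateau_bounds: "0 \<le> plateau t" "plateau t \<le> 1"
  using F_nonneg F_le1 by (auto simp: plateau_def mult_le_one)

lemma plateau_one: "\<bar>t\<bar> \<le> 1 \<Longrightarrow> plateau t = 1" by (simp add: plateau_def F_right abs_le_iff)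

lemma plateau_zero: "\<bar>t\<bar> \<ge> 2 \<Longrightarrow> plateau t = 0" using F_left[of "2 * t + 3"] F_left[of "3 - 2 * t"] by (auto simp: plateau_def abs_if split: if_splits)

lemma plateau'_bound: "\<bar>plateau' t\<bar> \<le> 4 * S"
proof -
  have "0 \<le> \<beta> a * F b" "\<beta> a * F b \<le> S" for a b
    using \<beta>_nonneg[of a] \<beta>_le[of a] F_nonneg[of b] F_le1[of b] mult_mono[of "\<beta> a" S "F b" 1] S_pos by auto
  from this[of "2 * t + 3" "3 - 2 * t"] this[of "3 - 2 * t" "2 * t + 3"] S_pos show ?thesis
    unfolding plateau'_def mult.assoc by linarith
qed

lemma plateau'_zero: "\<bar>t\<bar> < 1 \<or> \<bar>t\<bar> > 2 \<Longrightarrow> plateau' t = 0"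
proof (elim disjE)
  assume "\<bar>t\<bar> < 1"
  then show ?thesis using \<beta>_out[of "2 * t + 3"] \<beta>_out[of "3 - 2 * t"] by (auto simp: plateau'_def)
next
  assume "\<bar>t\<bar> > 2"
  then have "t > 2 \<or> t < -2" by auto
  then show ?thesis
  proof
    assume "t > 2" then show ?thesis using F_left[of "3 - 2 * t"] \<beta>_out[of "3 - 2 * t"] by (simp add: plateau'_def)
  next
    assume "t < -2" then show ?thesis using F_left[of "2 * t + 3"] \<beta>_out[of "2 * t + 3"] by (simp add: plateau'_def)
  qed
qed

end

context R2_smooth_step
begin

text \<open>A point has zero capacity in the plane: average \<open>K\<close> plateaus at the scales \<open>\<rho> / 4 ^ j\<close>.
  Their gradients have disjoint supports and equal energies, so the energy of the average is \<open>O(1/K)\<close>.\<close>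

lemma low_energy_function:
  assumes "\<Omega> \<noteq> {}" "\<epsilon> > 0"
  obtains w g V where "H1_pair \<Omega> w g" "integrable (lebesgue_on \<Omega>) w" "(\<integral>x. w x \<partial>lebesgue_on \<Omega>) = 0" "continuous_on UNIV w"
    "energy \<Omega> g \<le> \<epsilon>" "V \<in> sets borel" "(\<integral>x. indicat_real V x \<partial>lebesgue_on \<Omega>) > 0" "\<And>x. x \<in> V \<Longrightarrow> 1/2 \<le> \<bar>w x\<bar>"
proof -
  obtain z where z: "z \<in> \<Omega>" using assms(1) by blast
  obtain \<rho>3 where r3: "\<rho>3 > 0" "square z \<rho>3 \<subseteq> \<Omega>" using square_subset_open[OF open_dom z] by blast
  define \<rho> where "\<rho> = \<rho>3 / 3"
  have \<rho>: "\<rho> > 0" "square z (3 * \<rho>) \<subseteq> \<Omega>" using r3 by (auto simp: \<rho>_def)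
  \<comment> \<open>Each of the two gradient components will contribute at most
    \<open>256 * S\<^sup>2 / K\<close> to the energy.\<close>
  obtain K where K: "512 * S\<^sup>2 / \<epsilon> < real K" using reals_Archimedean2 by blast
  have "0 \<le> 512 * S\<^sup>2 / \<epsilon>" using assms(2) by simp
  then have K0: "K > 0" using K by (cases K) auto
  have KE: "512 * S\<^sup>2 / real K \<le> \<epsilon>" using K K0 assms(2) by (simp add: field_simps)
  define l where "l j = 4 ^ j / \<rho>" for j :: nat
  have l: "l j > 0" for j using \<rho> by (simp add: l_def)
  define \<psi> where "\<psi> x = (\<Sum>j<K. plateau (l j * (x $ 1 - z $ 1)) * plateau (l j * (x $ 2 - z $ 2))) / real K" for x :: R2
  define a where "a i j x = (if i = (1::2) then plateau' (l j * (x $ 1 - z $ 1)) * plateau (l j * (x $ 2 - z $ 2))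
      else plateau (l j * (x $ 1 - z $ 1)) * plateau' (l j * (x $ 2 - z $ 2)))" for i j and x :: R2
  define \<psi>' where "\<psi>' x v = (\<Sum>j<K. l j * (a 1 j x * v $ 1 + a 2 j x * v $ 2)) / real K" for x v :: R2
  have der: "(\<psi> has_derivative \<psi>' x) (at x)" for x
  proof -
    have p: "((\<lambda>x::R2. plateau (l j * (x $ i - z $ i))) has_derivative (\<lambda>v. plateau' (l j * (x $ i - z $ i)) * (l j * v $ i))) (at x)" for i j
    proof -
      have "((\<lambda>x::R2. l j * (x $ i - z $ i)) has_derivative (\<lambda>v. l j * v $ i)) (at x)"
        by (auto intro!: derivative_eq_intros bounded_linear.has_derivative[OF bounded_linear_vec_nth])
      from has_derivative_compose[OF this plateau_deriv[unfolded has_field_derivative_def]] show ?thesis .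
    qed
    have "(\<psi> has_derivative (\<lambda>v. (\<Sum>j<K. plateau (l j * (x $ 1 - z $ 1)) * (plateau' (l j * (x $ 2 - z $ 2)) * (l j * v $ 2)) +
        plateau' (l j * (x $ 1 - z $ 1)) * (l j * v $ 1) * plateau (l j * (x $ 2 - z $ 2))) / real K)) (at x)"
      unfolding \<psi>_def[abs_def]
      by (intro bounded_linear.has_derivative[OF bounded_linear_divide] has_derivative_sum has_derivative_mult p)
    then show ?thesis by (rule has_derivative_eq_rhs) (auto simp: \<psi>'_def a_def fun_eq_iff algebra_simps)
  qed
  have pc: "continuous_on UNIV (\<lambda>x::R2. plateau (l j * (x $ i - z $ i)))" "continuous_on UNIV (\<lambda>x::R2. plateau' (l j * (x $ i - z $ i)))" for i j
    by (intro continuous_on_compose2[OF plateau_continuous(1)] continuous_on_compose2[OF plateau_continuous(2)] continuous_intros; simp)+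
  have \<psi>c: "continuous_on UNIV \<psi>" unfolding \<psi>_def[abs_def] using K0 by (intro continuous_intros pc) auto
  have ac: "continuous_on UNIV (a i j)" for i j
    unfolding a_def[abs_def] by (cases "i = 1") (auto intro!: continuous_intros pc)
  have eq': "\<psi>' x (axis i 1) = (\<Sum>j<K. l j * a i j x) / real K" for x i
    using exhaust_2[of i] by (auto simp: \<psi>'_def axis_def)
  have cont: "continuous_on UNIV (\<lambda>x. \<psi>' x (axis i 1))" for i
    unfolding eq' using K0 by (intro continuous_intros ac) auto
  define c where "c = (\<integral>x. \<psi> x \<partial>lebesgue_on \<Omega>) / measure lebesgue \<Omega>"
  define w where "w x = \<psi> x - c" for x
  define g where "g x = (\<chi> i. \<psi>' x (axis i 1))" for x
  have wder: "(w has_derivative \<psi>' x) (at x)" for x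
    unfolding w_def[abs_def] using has_derivative_diff[OF der has_derivative_const[of c]] by simp
  have wc: "continuous_on UNIV w" unfolding w_def[abs_def] by (intro continuous_intros \<psi>c)
  have wg: "weak_gradient \<Omega> w g" unfolding g_def[abs_def] by (rule weak_gradient_C1[OF wder cont])
  have wi: "integrable (lebesgue_on \<Omega>) w" by (rule integrable_continuous_dom[OF wc])
  have H: "H1_pair \<Omega> w g"
    using wg wi wc by (auto simp: H1_pair_def intro!: integrable_continuous_dom continuous_intros)
  have mpos: "measure lebesgue \<Omega> > 0"
  proof -
    have "\<not> negligible \<Omega>" using open_not_negligible[OF open_dom] assms(1) by blast
    then show ?thesis using dom_lmeasurable by (metis negligible_iff_measure zero_less_measure_iff)
  qed
  have mean0: "(\<integral>x. w x \<partial>lebesgue_on \<Omega>) = 0"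
    unfolding w_def using integrable_continuous_dom[OF \<psi>c] mpos by (simp add: c_def measure_restrict_space)
  \<comment> \<open>Componentwise disjointness is enough: \<open>a i j\<close> and
    \<open>a i k\<close> both contain \<open>plateau'\<close> in coordinate \<open>i\<close>, which
    is nonzero only for arguments of size between 1 and 2, and the factor 4 between consecutive
    scales separates these ranges.\<close>
  have disj: "a i j x * a i k x = 0" if "j \<noteq> k" for i j k x
  proof -
    have main: "plateau' (l j * t) * plateau' (l k * t) = 0" if "j < k" for j k t
    proof (rule ccontr)
      assume "\<not> ?thesis"
      then have "1 \<le> \<bar>l j * t\<bar>" "\<bar>l k * t\<bar> \<le> 2" using plateau'_zero by (metis mult_eq_0_iff not_le)+
      moreover have "4 * l j \<le> l k"
      proof -
        have "(4::real) ^ Suc j \<le> 4 ^ k" using that by (intro power_increasing) auto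
        then show ?thesis using \<rho> by (simp add: l_def divide_right_mono)
      qed
      then have "4 * \<bar>l j * t\<bar> \<le> \<bar>l k * t\<bar>" using l[of j] l[of k] by (simp add: abs_mult flip: mult.assoc) (simp add: mult_right_mono)
      ultimately show False by linarith
    qed
    have "plateau' (l j * t) * plateau' (l k * t) = 0" for t
      using main[of j k t] main[of k j t] that by (cases "j < k") (auto simp: mult.commute)
    then show ?thesis by (auto simp: a_def)
  qed
  have abound: "(a i j x)\<^sup>2 \<le> 16 * S\<^sup>2 * indicator (square z (2 / l j)) x" for i j x
  proof (cases "x \<in> square z (2 / l j)")
    case True
    have pq: "(plateau' s * plateau t)\<^sup>2 \<le> 16 * S\<^sup>2" for s t
    proof -
      have "\<bar>plateau' s * plateau t\<bar> \<le> 4 * S * 1"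
        unfolding abs_mult using plateau'_bound[of s] plateau_bounds[of t] S_pos by (intro mult_mono) auto
      then have "\<bar>plateau' s * plateau t\<bar>\<^sup>2 \<le> (4 * S)\<^sup>2" by (intro power_mono) auto
      then show ?thesis by (simp add: power_mult_distrib)
    qed
    have pq2: "(plateau t * plateau' s)\<^sup>2 \<le> 16 * S\<^sup>2" for s t using pq[of s t] by (simp only: mult.commute)
    show ?thesis using True pq pq2 by (simp add: a_def)
  next
    case False
    then have "\<bar>x $ 1 - z $ 1\<bar> > 2 / l j \<or> \<bar>x $ 2 - z $ 2\<bar> > 2 / l j" by (auto simp: mem_square)
    then have "\<bar>l j * (x $ 1 - z $ 1)\<bar> > 2 \<or> \<bar>l j * (x $ 2 - z $ 2)\<bar> > 2"
      using l[of j] by (simp add: abs_mult divide_less_eq mult.commute)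
    then have "a i j x = 0" using plateau_zero plateau'_zero by (auto simp: a_def less_imp_le)
    then show ?thesis by simp
  qed
  have ind: "integrable (lebesgue_on \<Omega>) (indicat_real (square z h))" for h
    by (rule fin.integrable_const_bound[where B=1]) (auto intro!: borel_measurable_lebesgue_on simp: indicator_def)
  have comp: "integrable (lebesgue_on \<Omega>) (\<lambda>x. (g x $ i)\<^sup>2)" "(\<integral>x. (g x $ i)\<^sup>2 \<partial>lebesgue_on \<Omega>) \<le> 256 * S\<^sup>2 / real K" for i
  proof -
    show i1: "integrable (lebesgue_on \<Omega>) (\<lambda>x. (g x $ i)\<^sup>2)" using wg by (simp add: weak_gradient_def)
    have pt: "(g x $ i)\<^sup>2 \<le> (\<Sum>j<K. (l j)\<^sup>2 * (16 * S\<^sup>2 * indicator (square z (2 / l j)) x)) / (real K)\<^sup>2" for x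
    proof -
      have "(g x $ i)\<^sup>2 = (\<Sum>j<K. l j * a i j x)\<^sup>2 / (real K)\<^sup>2" by (simp add: g_def eq' power_divide)
      also have "(\<Sum>j<K. l j * a i j x)\<^sup>2 = (\<Sum>j<K. (l j * a i j x)\<^sup>2)" using disj by (intro square_sum_disjoint) auto
      also have "\<dots> \<le> (\<Sum>j<K. (l j)\<^sup>2 * (16 * S\<^sup>2 * indicator (square z (2 / l j)) x))"
        unfolding power_mult_distrib by (intro sum_mono mult_left_mono abound) auto
      finally show ?thesis by (simp add: divide_right_mono)
    qed
    have "(\<integral>x. (g x $ i)\<^sup>2 \<partial>lebesgue_on \<Omega>) \<le> (\<integral>x. (\<Sum>j<K. (l j)\<^sup>2 * (16 * S\<^sup>2 * indicator (square z (2 / l j)) x)) / (real K)\<^sup>2 \<partial>lebesgue_on \<Omega>)"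
      using pt by (intro integral_mono i1 integrable_divide Bochner_Integration.integrable_sum integrable_mult_right ind)
    also have "\<dots> = (\<Sum>j<K. (l j)\<^sup>2 * (16 * S\<^sup>2 * (\<integral>x. indicat_real (square z (2 / l j)) x \<partial>lebesgue_on \<Omega>))) / (real K)\<^sup>2"
      using ind by simp
    \<comment> \<open>The factor \<open>(l j)\<^sup>2\<close> cancels against the area
      \<open>4 * (2 / l j)\<^sup>2\<close>, so all scales contribute equally; \<open>K\<close> equal
      terms over \<open>K\<^sup>2\<close> leave \<open>1 / K\<close>.\<close>
    also have "\<dots> \<le> (\<Sum>j<K. (l j)\<^sup>2 * (16 * S\<^sup>2 * (4 * (2 / l j)\<^sup>2))) / (real K)\<^sup>2"
      using l by (intro divide_right_mono sum_mono mult_left_mono integral_square_indicator_le) (auto simp: less_imp_le)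
    also have "\<dots> = (\<Sum>j<K. 256 * S\<^sup>2) / (real K)\<^sup>2"
    proof -
      have "(l j)\<^sup>2 * (16 * S\<^sup>2 * (4 * (2 / l j)\<^sup>2)) = 256 * S\<^sup>2" for j using l[of j] by (simp add: power_divide field_simps)
      then show ?thesis by (simp only:)
    qed
    also have "\<dots> = 256 * S\<^sup>2 / real K" using K0 by (simp add: power2_eq_square)
    finally show "(\<integral>x. (g x $ i)\<^sup>2 \<partial>lebesgue_on \<Omega>) \<le> 256 * S\<^sup>2 / real K" .
  qed
  have "energy \<Omega> g \<le> 512 * S\<^sup>2 / real K"
    unfolding energy_def norm_square_R2 using comp(1)[of 1] comp(1)[of 2] comp(2)[of 1] comp(2)[of 2] by simp
  then have en: "energy \<Omega> g \<le> \<epsilon>" using KE by linarith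
  define r1 where "r1 = \<rho> / 4 ^ K"
  have r1: "r1 > 0" "r1 \<le> \<rho>" using \<rho>(1) one_le_power[of "4::real" K] by (auto simp: r1_def divide_le_eq mult_le_cancel_left1)
  have one: "\<psi> x = 1" if x: "x \<in> square z r1" for x
  proof -
    have "\<bar>l j * (x $ i - z $ i)\<bar> \<le> 1" if j: "j < K" and xi: "\<bar>x $ i - z $ i\<bar> \<le> r1" for i j
    proof -
      have "\<bar>l j * (x $ i - z $ i)\<bar> \<le> l j * r1" using l[of j] xi by (simp add: abs_mult)
      also have "\<dots> = 4 ^ j / 4 ^ K" using \<rho> by (simp add: l_def r1_def)
      also have "\<dots> \<le> 1" using power_increasing[of j K "4::real"] j by simp
      finally show ?thesis .
    qed
    then have "plateau (l j * (x $ 1 - z $ 1)) * plateau (l j * (x $ 2 - z $ 2)) = 1" if "j < K" for j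
      using x that by (simp add: mem_square plateau_one)
    then show ?thesis using K0 by (simp add: \<psi>_def)
  qed
  \<comment> \<open>On the square of radius \<open>\<rho>/4\<close> about \<open>y\<close> both
    offsets from \<open>z\<close> lie between \<open>9/4 * \<rho>\<close> and
    \<open>11/4 * \<rho>\<close>: beyond the widest plateau, yet inside
    \<open>square z (3 * \<rho>)\<close>.\<close>
  define y where "y = z + vec (5/2 * \<rho>)"
  have zero: "\<psi> x = 0" if x: "x \<in> square y (\<rho>/4)" for x
  proof -
    have "\<bar>x $ 1 - (z $ 1 + 5/2 * \<rho>)\<bar> \<le> \<rho>/4" using x unfolding mem_square y_def by simp
    then have "x $ 1 - z $ 1 \<ge> 2 * \<rho>" using \<rho>(1) by linarith
    then have "2 * \<rho> * l j \<le> l j * (x $ 1 - z $ 1)" for j using l[of j] by (simp add: mult.commute)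
    moreover have "2 * \<rho> * l j \<ge> 2" for j using \<rho> one_le_power[of "4::real" j] by (simp add: l_def)
    ultimately have "2 \<le> l j * (x $ 1 - z $ 1)" for j using order_trans by blast
    then have "plateau (l j * (x $ 1 - z $ 1)) = 0" for j by (intro plateau_zero) (metis abs_ge_self order_trans)
    then show ?thesis by (simp add: \<psi>_def)
  qed
  have sub1: "square z r1 \<subseteq> \<Omega>" using \<rho>(2) r1 \<rho>(1) by (auto simp: subset_iff mem_square)
  have sub0: "square y (\<rho>/4) \<subseteq> \<Omega>"
  proof (rule order_trans[OF _ \<rho>(2)], rule subsetI)
    fix x assume "x \<in> square y (\<rho>/4)"
    then have "\<bar>x $ 1 - (z $ 1 + 5/2 * \<rho>)\<bar> \<le> \<rho>/4" "\<bar>x $ 2 - (z $ 2 + 5/2 * \<rho>)\<bar> \<le> \<rho>/4"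
      unfolding mem_square y_def by simp_all
    then show "x \<in> square z (3 * \<rho>)" unfolding mem_square using \<rho>(1) by linarith
  qed
  \<comment> \<open>\<open>\<psi>\<close> takes the values 1 and 0 on two squares, so whatever the
    mean \<open>c\<close> is, one of them has \<open>\<bar>\<psi> x - c\<bar> \<ge> 1/2\<close>
    throughout. This avoids estimating \<open>c\<close>.\<close>
  show ?thesis
  proof (cases "c \<le> 1/2")
    case True
    show ?thesis
    proof (rule that[OF H wi mean0 wc en, of "square z r1"])
      show "(\<integral>x. indicat_real (square z r1) x \<partial>lebesgue_on \<Omega>) > 0"
        using integral_square_indicator(2)[OF _ sub1] r1 by simp
      show "1/2 \<le> \<bar>w x\<bar>" if "x \<in> square z r1" for x using one[OF that] True by (simp add: w_def)
    qed simp
  next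
    case False
    show ?thesis
    proof (rule that[OF H wi mean0 wc en, of "square y (\<rho>/4)"])
      show "(\<integral>x. indicat_real (square y (\<rho>/4)) x \<partial>lebesgue_on \<Omega>) > 0"
        using integral_square_indicator(2)[OF _ sub0] \<rho> by simp
      show "1/2 \<le> \<bar>w x\<bar>" if "x \<in> square y (\<rho>/4)" for x using zero[OF that] False by (simp add: w_def)
    qed simp
  qed
qed

end

section \<open>Smallness of the infimum for large exponents\<close>

lemma grad_norm_sq_nonneg: "grad_norm_sq \<Omega> u \<ge> 0" by (simp add: grad_norm_sq_def)

text \<open>All quotients are nonnegative, including those equal to 0 by division by zero; a lower
  bound is what makes the real \<open>INF\<close> lie below each of them.\<close>

lemma Lambda_p_le:
  assumes "u \<in> Hza_nonzero \<Omega>"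
  shows "Lambda_p p \<Omega> \<le> grad_norm_sq \<Omega> u / (Lp_norm p \<Omega> u)\<^sup>2"
  unfolding Lambda_p_def using assms
  by (intro cINF_lower bdd_belowI[where m=0]) (auto simp: grad_norm_sq_nonneg)

text \<open>One function of energy at most \<open>\<epsilon>/8\<close> is tested for all
  \<open>p\<close>. It is at least \<open>1/2\<close> in absolute value on a set of measure
  \<open>\<mu>\<close>, so its squared norm is at least \<open>\<mu> powr (2/p) / 4\<close>; since
  \<open>\<mu> powr (2/p)\<close> tends to 1, this is eventually at least
  \<open>1/8\<close>.\<close>

lemma Lambda_p_small:
  assumes dom: "smooth_bounded_domain \<Omega>" and e: "\<epsilon> > 0"
  obtains p1 where "\<And>p. p > p1 \<Longrightarrow> Lambda_p p \<Omega> \<le> \<epsilon>"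
proof -
  obtain F \<beta> S where st: "smooth_step F \<beta> S" by (rule smooth_step_locale)
  interpret R2_smooth_step \<Omega> F \<beta> S
    by (intro R2_smooth_step.intro smooth_bounded_domain_R2 dom st)
  have ne: "\<Omega> \<noteq> {}" using dom by (simp add: smooth_bounded_domain_def)
  have e8: "\<epsilon> / 8 > 0" using e by simp
  obtain w g V where w: "H1_pair \<Omega> w g" "integrable (lebesgue_on \<Omega>) w" "(\<integral>x. w x \<partial>lebesgue_on \<Omega>) = 0" "continuous_on UNIV w"
    "energy \<Omega> g \<le> \<epsilon> / 8" "V \<in> sets borel" "(\<integral>x. indicat_real V x \<partial>lebesgue_on \<Omega>) > 0" "\<And>x. x \<in> V \<Longrightarrow> 1/2 \<le> \<bar>w x\<bar>"
    by (rule low_energy_function[OF ne e8]) (rule that)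
  define \<mu> where "\<mu> = (\<integral>x. indicat_real V x \<partial>lebesgue_on \<Omega>)"
  have \<mu>: "\<mu> > 0" using w(7) by (simp add: \<mu>_def)
  have low: "\<mu> * (1/2) powr p \<le> (\<integral>x. \<bar>w x\<bar> powr p \<partial>lebesgue_on \<Omega>)" if p: "p > 0" for p
  proof -
    have iw: "integrable (lebesgue_on \<Omega>) (\<lambda>x. \<bar>w x\<bar> powr p)"
      using p by (intro integrable_continuous_dom continuous_on_powr' continuous_intros w(4)) auto
    have "\<mu> * (1/2) powr p = (\<integral>x. indicat_real V x * (1/2) powr p \<partial>lebesgue_on \<Omega>)" by (simp add: \<mu>_def)
    also have "\<dots> \<le> (\<integral>x. \<bar>w x\<bar> powr p \<partial>lebesgue_on \<Omega>)"
      using w(8) p by (intro integral_mono'[OF iw]) (auto simp: indicator_def intro!: powr_mono2)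
    finally show ?thesis .
  qed
  have nz: "w \<in> Hza_nonzero \<Omega>"
  proof -
    have "\<not> (AE x in lebesgue_on \<Omega>. w x = 0)"
    proof
      assume "AE x in lebesgue_on \<Omega>. w x = 0"
      then have "(\<integral>x. \<bar>w x\<bar> powr 1 \<partial>lebesgue_on \<Omega>) = 0"
        by (intro integral_eq_zero_AE) (auto elim!: eventually_mono)
      then show False using low[of 1] \<mu> by simp
    qed
    then show ?thesis using w(1-3) by (auto simp: Hza_nonzero_def Hza_def H1_def H1_pair_def)
  qed
  have "((\<lambda>p. \<mu> powr (2 / p)) \<longlongrightarrow> \<mu> powr 0) at_top"
    using \<mu> by (intro tendsto_intros tendsto_divide_0[OF tendsto_const] filterlim_at_top_imp_at_infinity filterlim_ident) auto
  then have "\<forall>\<^sub>F p in at_top. \<mu> powr (2 / p) > 1/2" using \<mu> by (intro order_tendstoD) auto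
  then obtain p0 where p0: "\<And>p. p \<ge> p0 \<Longrightarrow> \<mu> powr (2 / p) > 1/2" unfolding eventually_at_top_linorder by auto
  show ?thesis
  proof (rule that[of "max p0 1"])
    fix p assume p: "p > max p0 1"
    have gn: "grad_norm_sq \<Omega> w = energy \<Omega> g" using w(1) by (intro grad_norm_sq_eq_energy dom) (simp add: H1_pair_def)
    define I where "I = (\<integral>x. \<bar>w x\<bar> powr p \<partial>lebesgue_on \<Omega>)"
    have I: "\<mu> * (1/2) powr p \<le> I" unfolding I_def using p by (intro low) auto
    have N2: "(Lp_norm p \<Omega> w)\<^sup>2 = I powr (2 / p)"
      by (simp add: Lp_norm_def I_def power2_eq_square flip: powr_add)
    have "(\<mu> * (1/2) powr p) powr (2/p) \<le> I powr (2 / p)" using I \<mu> p by (intro powr_mono2) auto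
    also have "(\<mu> * (1/2) powr p) powr (2/p) = \<mu> powr (2/p) * (1/2) powr 2"
      using \<mu> p by (simp add: powr_mult powr_powr)
    also have "\<dots> = \<mu> powr (2/p) / 4" by (simp add: powr_numeral power2_eq_square)
    finally have N8: "1/8 \<le> (Lp_norm p \<Omega> w)\<^sup>2" using p0[of p] p unfolding N2 by simp
    have "Lambda_p p \<Omega> \<le> energy \<Omega> g / (Lp_norm p \<Omega> w)\<^sup>2" using Lambda_p_le[OF nz, of p] by (simp add: gn)
    also have "\<dots> \<le> (\<epsilon> / 8) / (1/8)" using N8 w(5) energy_nonneg[of \<Omega> g] e by (intro frac_le) auto
    finally show "Lambda_p p \<Omega> \<le> \<epsilon>" by simp
  qed
qed

section \<open>Reflection and truncation\<close>

lemma reflection_borel[measurable]: "reflection a n \<in> borel \<rightarrow>\<^sub>M borel"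
  unfolding reflection_def[abs_def] by (intro borel_measurable_continuous_onI continuous_intros)

lemma reflection_inner:
  assumes "norm n = 1" shows "(reflection a n x - a) \<bullet> n = - ((x - a) \<bullet> n)"
proof -
  have "n \<bullet> n = 1" using assms by (simp add: dot_square_norm)
  then show ?thesis by (simp add: reflection_def inner_diff_left algebra_simps)
qed

lemma reflection_involution:
  assumes "norm n = 1" shows "reflection a n (reflection a n x) = x"
proof -
  have "reflection a n (reflection a n x) = reflection a n x - (2 * ((reflection a n x - a) \<bullet> n)) *\<^sub>R n" by (simp only: reflection_def[of a n "reflection a n x"])
  also have "\<dots> = x" unfolding reflection_inner[OF assms] by (simp add: reflection_def)
  finally show ?thesis .
qed

lemma reflection_minus: "reflection a (- n) = reflection a n"
  by (auto simp: reflection_def fun_eq_iff)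

text \<open>A reflection is a translation after an orthogonal map. Being an involution it has equal
  images and preimages, so invariance of measure under images computes the preimage of a
  box.\<close>

lemma lborel_distr_reflection:
  assumes n: "norm n = 1" shows "distr lborel borel (reflection a n) = lborel"
proof (rule lborel_eqI[symmetric])
  define T where "T x = x - (2 * (x \<bullet> n)) *\<^sub>R n" for x :: R2
  have nn: "n \<bullet> n = 1" using n by (simp add: dot_square_norm)
  have "linear T" unfolding T_def by (rule linearI) (auto simp: inner_add_left algebra_simps)
  moreover have "T x \<bullet> T y = x \<bullet> y" for x y
    by (simp add: T_def inner_diff_left inner_diff_right nn inner_commute[of n y] algebra_simps)
  ultimately have oT: "orthogonal_transformation T" by (simp add: orthogonal_transformation_def)
  fix l u :: R2 assume lu: "\<And>b. b \<in> Basis \<Longrightarrow> l \<bullet> b \<le> u \<bullet> b"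
  have RT: "reflection a n x = (2 * (a \<bullet> n)) *\<^sub>R n + T x" for x
    by (simp add: reflection_def T_def inner_diff_left algebra_simps)
  have pre: "reflection a n -` box l u = reflection a n ` box l u"
  proof (rule set_eqI)
    fix x
    have "x \<in> reflection a n ` box l u" if "reflection a n x \<in> box l u"
      using imageI[OF that, of "reflection a n"] by (simp only: reflection_involution[OF n])
    then show "x \<in> reflection a n -` box l u \<longleftrightarrow> x \<in> reflection a n ` box l u"
      using reflection_involution[OF n] by auto
  qed
  also have "\<dots> = (+) ((2 * (a \<bullet> n)) *\<^sub>R n) ` (T ` box l u)" by (auto simp: RT image_iff)
  finally have im: "reflection a n -` box l u = (+) ((2 * (a \<bullet> n)) *\<^sub>R n) ` (T ` box l u)" .
  have lm: "T ` box l u \<in> lmeasurable" by (rule measurable_orthogonal_image[OF oT]) simp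
  have "measure lebesgue (reflection a n -` box l u) = measure lebesgue (box l u)"
    unfolding im measure_translation by (rule measure_orthogonal_image[OF oT]) simp
  moreover have "reflection a n -` box l u \<in> lmeasurable" unfolding im by (rule measurable_translation[OF lm])
  ultimately have "emeasure lebesgue (reflection a n -` box l u) = emeasure lebesgue (box l u)"
    by (simp add: emeasure_eq_measure2 fmeasurableD2 emeasure_eq_ennreal_measure)
  moreover have "reflection a n -` box l u \<in> sets borel"
    using measurable_sets[OF reflection_borel[of a n], of "box l u"] by simp
  ultimately have "emeasure lborel (reflection a n -` box l u) = emeasure lborel (box l u)" by simp
  then show "emeasure (distr lborel borel (reflection a n)) (box l u) = (\<Prod>b\<in>Basis. (u - l) \<bullet> b)"
    using lu by (simp add: emeasure_distr)
qed simp

lemma AE_reflection: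
  assumes "norm n = 1" "AE x in lborel. P x" shows "AE x in lborel. P (reflection a n x)"
proof -
  have "AE x in distr lborel borel (reflection a n). P x"
    unfolding lborel_distr_reflection[OF assms(1)] by (rule assms(2))
  from AE_distrD[OF _ this] show ?thesis by simp
qed

lemma integral_reflection:
  fixes f :: "R2 \<Rightarrow> real"
  assumes "norm n = 1" "f \<in> borel_measurable borel"
  shows "(\<integral>x. f (reflection a n x) \<partial>lborel) = (\<integral>x. f x \<partial>lborel)"
proof -
  have "(\<integral>x. f x \<partial>lborel) = (\<integral>x. f x \<partial>distr lborel borel (reflection a n))"
    by (simp add: lborel_distr_reflection[OF assms(1)])
  also have "\<dots> = (\<integral>x. f (reflection a n x) \<partial>lborel)" using assms(2) by (intro integral_distr) auto
  finally show ?thesis by simp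
qed

text \<open>The reflection is unchanged when \<open>n\<close> is replaced by \<open>- n\<close>,
  whereas \<open>half\<close> becomes the opposite side; interpreting the locale for both normals
  therefore treats both halves with one proof.\<close>

locale reflected_domain = R2_domain \<Omega> for \<Omega> +
  fixes a n :: R2
  assumes unit: "norm n = 1" and refl: "reflection a n ` \<Omega> = \<Omega>"
begin

abbreviation R where "R \<equiv> reflection a n"

definition height :: "R2 \<Rightarrow> real" where "height x = (x - a) \<bullet> n"

definition half :: "R2 set" where "half = {x. height x > 0}"

lemma height_R: "height (R x) = - height x"
  using reflection_inner[OF unit] by (simp add: height_def)

lemma R_R: "R (R x) = x" by (rule reflection_involution[OF unit])

lemma R_dom: "R x \<in> \<Omega> \<longleftrightarrow> x \<in> \<Omega>"
  using refl R_R by (metis image_iff)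

lemma height_continuous: "continuous_on S height"
  unfolding height_def[abs_def] by (intro continuous_intros)

lemma half_borel[measurable, simp]: "half \<in> sets borel"
proof -
  have "open half" unfolding half_def by (intro open_Collect_less continuous_intros height_continuous)
  then show ?thesis by simp
qed

lemma indicator_half_measurable: "indicat_real half \<in> borel_measurable (lebesgue_on \<Omega>)"
  by (intro borel_measurable_lebesgue_on) simp

lemma AE_height: "AE x in lebesgue_on \<Omega>. height x \<noteq> 0"
proof -
  have "negligible {x. n \<bullet> x = n \<bullet> a}" using unit by (intro negligible_hyperplane) auto
  moreover have "{x. n \<bullet> x = n \<bullet> a} = {x. height x = 0}" by (simp add: height_def inner_diff_left inner_commute[of n])
  ultimately have "{x. height x = 0} \<in> null_sets lebesgue" by (simp add: negligible_iff_null_sets)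
  then have "AE x in lebesgue. x \<notin> {x. height x = 0}" by (rule AE_not_in)
  then have "AE x in lebesgue. x \<in> \<Omega> \<longrightarrow> height x \<noteq> 0" by eventually_elim simp
  then show ?thesis by (simp add: AE_restrict_space_iff)
qed

text \<open>Invariance of the domain makes the extension by zero antisymmetric a.e. on the whole
  plane, so the change of variables can be carried out on \<open>lborel\<close>.\<close>

lemma antisymmetric_representative:
  assumes u: "u \<in> borel_measurable (lebesgue_on \<Omega>)" and anti: "antisymmetric_wrt \<Omega> R u"
  obtains h where "h \<in> borel_measurable borel" "AE x in lborel. x \<in> \<Omega> \<longrightarrow> u x = h x" "\<And>x. x \<notin> \<Omega> \<Longrightarrow> h x = 0"
    "AE x in lborel. h (R x) = - h x"
proof -
  obtain h where h: "h \<in> borel_measurable borel" "AE x in lborel. x \<in> \<Omega> \<longrightarrow> u x = h x" "\<And>x. x \<notin> \<Omega> \<Longrightarrow> h x = 0"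
    using borel_representative[OF u dom_borel] by blast
  have "AE x in lborel. x \<in> \<Omega> \<longrightarrow> u (R x) = - u x"
    using anti unfolding antisymmetric_wrt_def AE_lebesgue_on_iff[OF dom_borel] .
  moreover have "AE x in lborel. R x \<in> \<Omega> \<longrightarrow> u (R x) = h (R x)" by (rule AE_reflection[OF unit h(2)])
  ultimately have "AE x in lborel. h (R x) = - h x" using h(2)
  proof eventually_elim
    case (elim x)
    then show ?case using R_dom[of x] h(3)[of x] h(3)[of "R x"] by (cases "x \<in> \<Omega>") auto
  qed
  with h that show ?thesis by blast
qed

text \<open>Integration against \<open>u\<close> sees only the part of \<open>k\<close> that is odd
  under the reflection; the even part integrates to 0.\<close>

lemma antisymmetric_integral:
  assumes u: "u \<in> borel_measurable (lebesgue_on \<Omega>)" and anti: "antisymmetric_wrt \<Omega> R u" and k[measurable]: "k \<in> borel_measurable borel"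
  shows "(\<integral>x. u x * k x \<partial>lebesgue_on \<Omega>) = - (\<integral>x. u x * k (R x) \<partial>lebesgue_on \<Omega>)"
proof -
  obtain h where h[measurable]: "h \<in> borel_measurable borel" and ae: "AE x in lborel. x \<in> \<Omega> \<longrightarrow> u x = h x" and h0: "\<And>x. x \<notin> \<Omega> \<Longrightarrow> h x = 0"
    and hR: "AE x in lborel. h (R x) = - h x" using antisymmetric_representative[OF u anti] by blast
  have rep: "(\<integral>x. u x * k x \<partial>lebesgue_on \<Omega>) = (\<integral>x. h x * k x \<partial>lborel)" if [measurable]: "k \<in> borel_measurable borel" for k
  proof -
    have "(\<integral>x. u x * k x \<partial>lebesgue_on \<Omega>) = (\<integral>x. indicator \<Omega> x * (h x * k x) \<partial>lborel)"
      using ae by (intro lebesgue_on_representative(2)[OF dom_borel] borel_measurable_times u borel_measurable_lebesgue_on)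
        (auto elim!: eventually_mono)
    also have "(\<lambda>x. indicator \<Omega> x * (h x * k x)) = (\<lambda>x. h x * k x)" using h0 by (auto simp: indicator_def fun_eq_iff)
    finally show ?thesis .
  qed
  have "(\<integral>x. h x * k x \<partial>lborel) = (\<integral>x. h (R x) * k (R x) \<partial>lborel)"
    by (rule integral_reflection[OF unit, symmetric]) measurable
  also have "\<dots> = (\<integral>x. - (h x * k (R x)) \<partial>lborel)"
  proof (rule integral_cong_AE)
    show "AE x in lborel. h (R x) * k (R x) = - (h x * k (R x))" using hR by eventually_elim simp
  qed measurable
  finally show ?thesis using rep[OF k] rep[of "\<lambda>x. k (R x)"] by simp
qed

text \<open>\<open>\<bar>u\<bar> powr p\<close> is even, the reflection exchanges the sides, and the
  axis is a null set: each side carries exactly half.\<close>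

lemma antisymmetric_half_powr:
  assumes u: "u \<in> borel_measurable (lebesgue_on \<Omega>)" and anti: "antisymmetric_wrt \<Omega> R u"
    and i: "integrable (lebesgue_on \<Omega>) (\<lambda>x. \<bar>u x\<bar> powr p)"
  shows "(\<integral>x. \<bar>indicator half x * u x\<bar> powr p \<partial>lebesgue_on \<Omega>) = (\<integral>x. \<bar>u x\<bar> powr p \<partial>lebesgue_on \<Omega>) / 2"
proof -
  obtain h where h[measurable]: "h \<in> borel_measurable borel" and ae: "AE x in lborel. x \<in> \<Omega> \<longrightarrow> u x = h x" and h0: "\<And>x. x \<notin> \<Omega> \<Longrightarrow> h x = 0"
    and hR: "AE x in lborel. h (R x) = - h x" using antisymmetric_representative[OF u anti] by blast
  have rep: "(\<integral>x. \<bar>u x\<bar> powr p * k x \<partial>lebesgue_on \<Omega>) = (\<integral>x. \<bar>h x\<bar> powr p * k x \<partial>lborel)" if [measurable]: "k \<in> borel_measurable borel" for k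
  proof -
    have "(\<integral>x. \<bar>u x\<bar> powr p * k x \<partial>lebesgue_on \<Omega>) = (\<integral>x. indicator \<Omega> x * (\<bar>h x\<bar> powr p * k x) \<partial>lborel)"
      using ae u by (intro lebesgue_on_representative(2)[OF dom_borel] borel_measurable_times borel_measurable_lebesgue_on[OF that])
        (auto elim!: eventually_mono)
    also have "(\<lambda>x. indicator \<Omega> x * (\<bar>h x\<bar> powr p * k x)) = (\<lambda>x. \<bar>h x\<bar> powr p * k x)" using h0 by (auto simp: indicator_def fun_eq_iff)
    finally show ?thesis .
  qed
  have "(\<integral>x. \<bar>h x\<bar> powr p * indicator half x \<partial>lborel) = (\<integral>x. \<bar>h (R x)\<bar> powr p * indicator half (R x) \<partial>lborel)"
    by (rule integral_reflection[OF unit, symmetric]) measurable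
  also have "\<dots> = (\<integral>x. \<bar>h x\<bar> powr p * indicator half (R x) \<partial>lborel)"
  proof (rule integral_cong_AE)
    show "AE x in lborel. \<bar>h (R x)\<bar> powr p * indicator half (R x) = \<bar>h x\<bar> powr p * indicator half (R x)" using hR by eventually_elim simp
  qed measurable
  finally have e: "(\<integral>x. \<bar>u x\<bar> powr p * indicator half x \<partial>lebesgue_on \<Omega>) = (\<integral>x. \<bar>u x\<bar> powr p * indicator half (R x) \<partial>lebesgue_on \<Omega>)"
    by (simp add: rep)
  have b: "integrable (lebesgue_on \<Omega>) (\<lambda>x. \<bar>u x\<bar> powr p * indicator half x)" "integrable (lebesgue_on \<Omega>) (\<lambda>x. \<bar>u x\<bar> powr p * indicator half (R x))"
    by (auto intro!: integrable_mult_bounded[OF i, where B=1] borel_measurable_lebesgue_on simp: indicator_def)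
  have "(\<integral>x. \<bar>u x\<bar> powr p \<partial>lebesgue_on \<Omega>) = (\<integral>x. \<bar>u x\<bar> powr p * indicator half x + \<bar>u x\<bar> powr p * indicator half (R x) \<partial>lebesgue_on \<Omega>)"
  proof (rule integral_cong_AE)
    show "AE x in lebesgue_on \<Omega>. \<bar>u x\<bar> powr p = \<bar>u x\<bar> powr p * indicator half x + \<bar>u x\<bar> powr p * indicator half (R x)"
      using AE_height by eventually_elim (auto simp: half_def height_R indicator_def)
  qed (use i b in auto)
  also have "\<dots> = 2 * (\<integral>x. \<bar>u x\<bar> powr p * indicator half x \<partial>lebesgue_on \<Omega>)" using b e by simp
  finally have "(\<integral>x. \<bar>u x\<bar> powr p \<partial>lebesgue_on \<Omega>) = 2 * (\<integral>x. \<bar>u x\<bar> powr p * indicator half x \<partial>lebesgue_on \<Omega>)" .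
  moreover have "(\<lambda>x. \<bar>indicator half x * u x\<bar> powr p) = (\<lambda>x. \<bar>u x\<bar> powr p * indicator half x)" by (auto simp: indicator_def)
  ultimately show ?thesis by simp
qed

text \<open>Smooth approximation of \<open>indicator half\<close> as \<open>m\<close> grows. Compact
  support comes from the test function it multiplies; \<open>arctan\<close> provides an explicit
  derivative that is even in the height.\<close>

definition cutoff :: "real \<Rightarrow> R2 \<Rightarrow> real" where
  "cutoff m x = 1/2 + arctan (m * height x) / pi"

lemma cutoff_bounds: "0 \<le> cutoff m x" "cutoff m x \<le> 1"
proof -
  have "- (pi / 2) / pi \<le> arctan (m * height x) / pi" "arctan (m * height x) / pi \<le> (pi / 2) / pi"
    using arctan_bounded[of "m * height x"] by (intro divide_right_mono; simp)+
  moreover have "- (pi / 2) / pi = - (1/2)" "(pi / 2) / pi = 1/2" by simp_all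
  ultimately show "0 \<le> cutoff m x" "cutoff m x \<le> 1" unfolding cutoff_def by linarith+
qed

lemma cutoff_smooth: "smooth_on UNIV (cutoff m)"
proof -
  have "smooth1 (\<lambda>t. 1/2 + (1/pi) * arctan (m * t + 0))"
    by (intro smooth1_add smooth1_mult smooth1_const smooth1_affine[OF smooth1_arctan])
  from smooth_on_inner[OF this, of n "- (a \<bullet> n)"] show ?thesis
    by (simp add: cutoff_def[abs_def] height_def inner_diff_left)
qed

lemma cutoff_derivative:
  "(cutoff m has_derivative (\<lambda>v. m / (pi * (1 + (m * height x)\<^sup>2)) * (v \<bullet> n))) (at x)"
proof -
  have h: "(height has_derivative (\<lambda>v. v \<bullet> n)) (at x)" unfolding height_def[abs_def] by (auto intro!: derivative_eq_intros)
  have d: "((\<lambda>t. 1/2 + arctan (m * t) / pi) has_real_derivative m / (pi * (1 + (m * t)\<^sup>2))) (at t)" for t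
  proof -
    have "((\<lambda>t. arctan (m * t)) has_real_derivative inverse (1 + (m * t)\<^sup>2) * m) (at t)"
      by (rule DERIV_chain2[OF DERIV_arctan]) (auto intro!: derivative_eq_intros)
    from DERIV_add[OF DERIV_const DERIV_cdivide[OF this], of "1/2" pi]
    show ?thesis by (rule DERIV_cong) (simp add: divide_inverse mult_ac)
  qed
  from has_derivative_compose[OF h d[unfolded has_field_derivative_def]]
  show ?thesis by (simp add: cutoff_def[abs_def])
qed

lemma cutoff_tendsto:
  assumes "height x \<noteq> 0"
  shows "(\<lambda>k. cutoff (real k) x) \<longlonglongrightarrow> indicator half x"
proof (cases "height x > 0")
  case True
  have "filterlim (\<lambda>k. height x * real k) at_top sequentially"
    by (rule filterlim_tendsto_pos_mult_at_top[OF tendsto_const True filterlim_real_sequentially])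
  then have "filterlim (\<lambda>k. real k * height x) at_top sequentially" by (simp add: mult.commute)
  from filterlim_compose[OF tendsto_arctan_at_top this]
  have "(\<lambda>k. cutoff (real k) x) \<longlonglongrightarrow> 1/2 + (pi/2) / pi"
    unfolding cutoff_def by (intro tendsto_intros) auto
  then show ?thesis using True by (simp add: half_def)
next
  case False
  then have "height x < 0" using assms by simp
  from filterlim_tendsto_neg_mult_at_bot[OF tendsto_const this filterlim_real_sequentially]
  have "filterlim (\<lambda>k. height x * real k) at_bot sequentially" .
  then have "filterlim (\<lambda>k. real k * height x) at_bot sequentially" by (simp add: mult.commute)
  from filterlim_compose[OF tendsto_arctan_at_bot this]
  have "(\<lambda>k. cutoff (real k) x) \<longlonglongrightarrow> 1/2 + (- (pi/2)) / pi"
    unfolding cutoff_def by (intro tendsto_intros) auto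
  then show ?thesis using False by (simp add: half_def)
qed

end

lemma test_function_mult:
  assumes "test_function \<Omega> \<phi>" "smooth_on UNIV f"
  shows "test_function \<Omega> (\<lambda>x. f x * \<phi> x)"
proof -
  have sub: "closure {x. f x * \<phi> x \<noteq> 0} \<subseteq> closure {x. \<phi> x \<noteq> 0}" by (intro closure_mono) auto
  have "compact (closure {x. \<phi> x \<noteq> 0})" using assms(1) by (simp add: test_function_def)
  from compact_Int_closed[OF this closed_closure[of "{x. f x * \<phi> x \<noteq> 0}"]]
  have "compact (closure {x. f x * \<phi> x \<noteq> 0})" unfolding Int_absorb1[OF sub] .
  then show ?thesis using assms sub by (auto simp: test_function_def intro: smooth_on_mult)
qed

context reflected_domain
begin

text \<open>\<open>x\<close> and its mirror image differ by \<open>2 * \<bar>height x\<bar>\<close>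
  along \<open>n\<close>, so a bound on the normal derivative of \<open>\<phi>\<close> gives linear
  vanishing on the axis.\<close>

lemma test_function_odd_part:
  assumes t: "test_function \<Omega> \<phi>"
  obtains B where "\<And>x. \<bar>\<phi> x - \<phi> (R x)\<bar> \<le> B * \<bar>height x\<bar>" "B \<ge> 0"
proof -
  have s: "smooth_on UNIV \<phi>" using t by (simp add: test_function_def)
  obtain B where B: "\<And>x. \<bar>frechet_derivative \<phi> (at x) n\<bar> \<le> B"
    apply (rule test_function_bounded[OF t, of n])
    subgoal premises p for B by (rule that[OF p(3)]) done
  show ?thesis
  proof (rule that[of "2 * B"])
    show "2 * B \<ge> 0" using B[of 0] by linarith
    fix x
    have Rx: "R x = x + (- 2 * height x) *\<^sub>R n" by (simp add: reflection_def height_def)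
    have "norm (\<phi> (x + 0 *\<^sub>R n) - \<phi> (x + (- 2 * height x) *\<^sub>R n)) \<le> B * norm (0 - (- 2 * height x))"
    proof (rule field_differentiable_bound[of UNIV "\<lambda>t. \<phi> (x + t *\<^sub>R n)"])
      show "((\<lambda>t. \<phi> (x + t *\<^sub>R n)) has_real_derivative frechet_derivative \<phi> (at (x + t *\<^sub>R n)) n) (at t within UNIV)" for t
        by (rule has_field_derivative_at_within, rule has_derivative_line, rule smooth_on_has_derivative[OF s])
    qed (use B in auto)
    then show "\<bar>\<phi> x - \<phi> (R x)\<bar> \<le> 2 * B * \<bar>height x\<bar>" unfolding Rx by (simp add: abs_mult mult_ac)
  qed
qed

text \<open>Cut off smoothly across the axis. The derivative of the cutoff has size \<open>m\<close> on a strip of width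
  \<open>1/m\<close>, but it is even while \<open>u\<close> is odd, so only the odd part of the test function contributes, and
  that part vanishes linearly on the axis. Thus no trace theory is needed.\<close>

lemma weak_gradient_half:
  assumes H: "H1_pair \<Omega> u g" and anti: "antisymmetric_wrt \<Omega> R u"
  shows "weak_gradient \<Omega> (\<lambda>x. indicator half x * u x) (\<lambda>x. indicator half x *\<^sub>R g x)"
  unfolding weak_gradient_def
proof (intro conjI allI impI)
  have wg: "weak_gradient \<Omega> u g" and um: "u \<in> borel_measurable (lebesgue_on \<Omega>)" and u2: "integrable (lebesgue_on \<Omega>) (\<lambda>x. (u x)\<^sup>2)"
    using H by (auto simp: H1_pair_def)
  note ui = integrable_of_square[OF um u2]
  note d = weak_gradientD[OF wg]
  fix i :: 2
  note gi = integrable_of_square[OF d(3)[of i] d(4)[of i]]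
  have "(\<lambda>x. ((indicator half x *\<^sub>R g x) $ i)\<^sup>2) = (\<lambda>x. (g x $ i)\<^sup>2 * indicator half x)" by (auto simp: indicator_def)
  then show "integrable (lebesgue_on \<Omega>) (\<lambda>x. ((indicator half x *\<^sub>R g x) $ i)\<^sup>2)"
    using integrable_mult_bounded[OF d(4)[of i] indicator_half_measurable, of 1] by (simp add: indicator_def)
  show "(\<lambda>x. indicator half x *\<^sub>R g x) \<in> borel_measurable (lebesgue_on \<Omega>)"
    by (intro borel_measurable_scaleR indicator_half_measurable d(2))
  fix \<phi> assume t: "test_function \<Omega> \<phi>"
  have s: "smooth_on UNIV \<phi>" using t by (simp add: test_function_def)
  define \<phi>i where "\<phi>i x = frechet_derivative \<phi> (at x) (axis i 1)" for x
  obtain B where B: "\<And>x. \<bar>\<phi> x\<bar> \<le> B" "\<And>x. \<bar>\<phi>i x\<bar> \<le> B" and m[measurable]: "\<phi> \<in> borel_measurable borel" "\<phi>i \<in> borel_measurable borel"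
    apply (rule test_function_bounded[OF t, of "axis i 1"])
    subgoal premises p for B by (rule that[of B]) (use p in \<open>auto simp: \<phi>i_def[abs_def]\<close>) done
  obtain L where L: "\<And>x. \<bar>\<phi> x - \<phi> (R x)\<bar> \<le> L * \<bar>height x\<bar>" "L \<ge> 0" using test_function_odd_part[OF t] by blast
  have cm[measurable]: "cutoff m \<in> borel_measurable borel" for m
    by (intro borel_measurable_continuous_onI smooth_on_continuous cutoff_smooth)
  have hm[measurable]: "height \<in> borel_measurable borel" by (intro borel_measurable_continuous_onI height_continuous)
  \<comment> \<open>Component \<open>i\<close> of the gradient of
    \<open>cutoff (real k)\<close>.\<close>
  define \<kappa> where "\<kappa> k x = real k / (pi * (1 + (real k * height x)\<^sup>2)) * n $ i" for k x
  have km[measurable]: "\<kappa> k \<in> borel_measurable borel" for k unfolding \<kappa>_def by measurable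
  have \<kappa>R: "\<kappa> k (R x) = \<kappa> k x" for k x by (simp add: \<kappa>_def height_R)
  have \<kappa>b: "\<bar>\<kappa> k x\<bar> \<le> real k" for k x
  proof -
    have "1 * 1 \<le> pi * (1 + (real k * height x)\<^sup>2)" using pi_ge_two by (intro mult_mono) auto
    then have "real k / (pi * (1 + (real k * height x)\<^sup>2)) \<le> real k / 1" by (intro divide_left_mono) auto
    then have a: "\<bar>real k / (pi * (1 + (real k * height x)\<^sup>2))\<bar> \<le> real k" by simp
    have b: "\<bar>n $ i\<bar> \<le> 1" using component_le_norm_cart[of n i] unit by simp
    have "\<bar>\<kappa> k x\<bar> \<le> real k * 1" unfolding \<kappa>_def abs_mult by (intro mult_mono a b) auto
    then show ?thesis by simp
  qed
  note bl = borel_measurable_lebesgue_on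
  have cb: "\<bar>cutoff k x * \<phi>i x\<bar> \<le> B" for k x
    using mult_mono[OF cutoff_bounds(2) B(2)[of x] zero_le_one abs_ge_zero, of k x] cutoff_bounds(1)[of k x] by (simp add: abs_mult)
  have kb: "\<bar>\<kappa> k x * \<phi> y\<bar> \<le> real k * B" for k x y
    unfolding abs_mult by (intro mult_mono B \<kappa>b) auto
  have i1: "integrable (lebesgue_on \<Omega>) (\<lambda>x. u x * (cutoff k x * \<phi>i x))" for k
    by (rule integrable_mult_bounded[OF ui bl cb]) measurable
  have i2: "integrable (lebesgue_on \<Omega>) (\<lambda>x. u x * (\<kappa> k x * \<phi> x))" for k
    by (rule integrable_mult_bounded[OF ui bl kb]) measurable
  have i3: "integrable (lebesgue_on \<Omega>) (\<lambda>x. u x * (\<kappa> k x * \<phi> (R x)))" for k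
    by (rule integrable_mult_bounded[OF ui bl kb]) measurable
  \<comment> \<open>Oddness of \<open>u\<close> turns the pairing with
    \<open>\<kappa> k * \<phi>\<close> into minus the pairing with its mirror image; averaging the
    two expressions replaces \<open>\<phi>\<close> by half the difference.\<close>
  have id: "(\<integral>x. u x * (cutoff (real k) x * \<phi>i x) \<partial>lebesgue_on \<Omega>) + (\<integral>x. u x * (\<kappa> k x * (\<phi> x - \<phi> (R x))) \<partial>lebesgue_on \<Omega>) / 2
     = - (\<integral>x. g x $ i * (cutoff (real k) x * \<phi> x) \<partial>lebesgue_on \<Omega>)" for k
  proof -
    have der: "((\<lambda>x. cutoff (real k) x * \<phi> x) has_derivative (\<lambda>v. cutoff (real k) x * frechet_derivative \<phi> (at x) v
        + real k / (pi * (1 + (real k * height x)\<^sup>2)) * (v \<bullet> n) * \<phi> x)) (at x)" for x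
      by (rule has_derivative_mult[OF cutoff_derivative smooth_on_has_derivative[OF s]])
    have fd: "frechet_derivative (\<lambda>x. cutoff (real k) x * \<phi> x) (at x) (axis i 1) = cutoff (real k) x * \<phi>i x + \<kappa> k x * \<phi> x" for x
      unfolding frechet_derivative_at[OF der, symmetric] \<phi>i_def \<kappa>_def by (simp add: inner_axis')
    have "(\<integral>x. u x * (cutoff (real k) x * \<phi>i x + \<kappa> k x * \<phi> x) \<partial>lebesgue_on \<Omega>) = - (\<integral>x. g x $ i * (cutoff (real k) x * \<phi> x) \<partial>lebesgue_on \<Omega>)"
      using wg test_function_mult[OF t cutoff_smooth[of "real k"]] unfolding weak_gradient_def fd[symmetric] by blast
    moreover have "(\<integral>x. u x * (cutoff (real k) x * \<phi>i x + \<kappa> k x * \<phi> x) \<partial>lebesgue_on \<Omega>) = (\<integral>x. u x * (cutoff (real k) x * \<phi>i x) \<partial>lebesgue_on \<Omega>) + (\<integral>x. u x * (\<kappa> k x * \<phi> x) \<partial>lebesgue_on \<Omega>)"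
      unfolding distrib_left by (rule Bochner_Integration.integral_add[OF i1 i2])
    moreover have "(\<integral>x. u x * (\<kappa> k x * (\<phi> x - \<phi> (R x))) \<partial>lebesgue_on \<Omega>) = (\<integral>x. u x * (\<kappa> k x * \<phi> x) \<partial>lebesgue_on \<Omega>) - (\<integral>x. u x * (\<kappa> k x * \<phi> (R x)) \<partial>lebesgue_on \<Omega>)"
      unfolding right_diff_distrib by (rule Bochner_Integration.integral_diff[OF i2 i3])
    moreover have "(\<integral>x. u x * (\<kappa> k x * \<phi> x) \<partial>lebesgue_on \<Omega>) = - (\<integral>x. u x * (\<kappa> k x * \<phi> (R x)) \<partial>lebesgue_on \<Omega>)"
      using antisymmetric_integral[OF um anti, of "\<lambda>x. \<kappa> k x * \<phi> x"] by (simp add: \<kappa>R)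
    ultimately show ?thesis by simp
  qed
  have l1: "(\<lambda>k. \<integral>x. u x * (cutoff (real k) x * \<phi>i x) \<partial>lebesgue_on \<Omega>) \<longlonglongrightarrow> (\<integral>x. u x * (indicator half x * \<phi>i x) \<partial>lebesgue_on \<Omega>)"
  proof (rule integral_dominated_convergence[where w="\<lambda>x. B * \<bar>u x\<bar>"])
    show "AE x in lebesgue_on \<Omega>. (\<lambda>k. u x * (cutoff (real k) x * \<phi>i x)) \<longlonglongrightarrow> u x * (indicator half x * \<phi>i x)"
      using AE_height by eventually_elim (intro tendsto_intros cutoff_tendsto)
    have "\<bar>u x * (cutoff (real k) x * \<phi>i x)\<bar> \<le> \<bar>u x\<bar> * (1 * B)" for k x
      unfolding abs_mult by (intro mult_left_mono mult_mono B) (auto simp: cutoff_bounds)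
    then show "AE x in lebesgue_on \<Omega>. norm (u x * (cutoff (real k) x * \<phi>i x)) \<le> B * \<bar>u x\<bar>" for k
      by (simp add: mult.commute)
    show "(\<lambda>x. u x * (indicator half x * \<phi>i x)) \<in> borel_measurable (lebesgue_on \<Omega>)"
      by (rule borel_measurable_times[OF um bl]) measurable
    show "(\<lambda>x. u x * (cutoff (real k) x * \<phi>i x)) \<in> borel_measurable (lebesgue_on \<Omega>)" for k
      by (rule borel_measurable_times[OF um bl]) measurable
    show "integrable (lebesgue_on \<Omega>) (\<lambda>x. B * \<bar>u x\<bar>)" using ui by simp
  qed
  have l2: "(\<lambda>k. \<integral>x. g x $ i * (cutoff (real k) x * \<phi> x) \<partial>lebesgue_on \<Omega>) \<longlonglongrightarrow> (\<integral>x. g x $ i * (indicator half x * \<phi> x) \<partial>lebesgue_on \<Omega>)"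
  proof (rule integral_dominated_convergence[where w="\<lambda>x. B * \<bar>g x $ i\<bar>"])
    show "AE x in lebesgue_on \<Omega>. (\<lambda>k. g x $ i * (cutoff (real k) x * \<phi> x)) \<longlonglongrightarrow> g x $ i * (indicator half x * \<phi> x)"
      using AE_height by eventually_elim (intro tendsto_intros cutoff_tendsto)
    have "\<bar>g x $ i * (cutoff (real k) x * \<phi> x)\<bar> \<le> \<bar>g x $ i\<bar> * (1 * B)" for k x
      unfolding abs_mult by (intro mult_left_mono mult_mono B) (auto simp: cutoff_bounds)
    then show "AE x in lebesgue_on \<Omega>. norm (g x $ i * (cutoff (real k) x * \<phi> x)) \<le> B * \<bar>g x $ i\<bar>" for k
      by (simp add: mult.commute)
    show "(\<lambda>x. g x $ i * (indicator half x * \<phi> x)) \<in> borel_measurable (lebesgue_on \<Omega>)"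
      by (rule borel_measurable_times[OF d(3) bl]) measurable
    show "(\<lambda>x. g x $ i * (cutoff (real k) x * \<phi> x)) \<in> borel_measurable (lebesgue_on \<Omega>)" for k
      by (rule borel_measurable_times[OF d(3) bl]) measurable
    show "integrable (lebesgue_on \<Omega>) (\<lambda>x. B * \<bar>g x $ i\<bar>)" using gi by simp
  qed
  \<comment> \<open>With \<open>y = real k * \<bar>height x\<bar>\<close> the bound is
    \<open>L * (y / (1 + y\<^sup>2))\<close>: the steepness \<open>k\<close> of the cutoff is
    compensated by the linear vanishing, so the term is bounded by \<open>L\<close> and tends to 0
    off the axis.\<close>
  have \<kappa>2: "\<bar>\<kappa> k x * (\<phi> x - \<phi> (R x))\<bar> \<le> L * (real k * \<bar>height x\<bar> / (1 + (real k * \<bar>height x\<bar>)\<^sup>2))" for k x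
  proof -
    have b: "\<bar>n $ i\<bar> \<le> 1" using component_le_norm_cart[of n i] unit by simp
    have q: "1 + (real k * height x)\<^sup>2 > 0" by (metis add_pos_nonneg zero_le_power2 zero_less_one)
    have "real k / (pi * (1 + (real k * height x)\<^sup>2)) \<le> real k / (1 * (1 + (real k * height x)\<^sup>2))"
      using pi_ge_two q by (intro divide_left_mono mult_right_mono) auto
    then have "\<bar>\<kappa> k x\<bar> \<le> real k / (1 + (real k * height x)\<^sup>2) * 1"
      unfolding \<kappa>_def abs_mult using b q by (intro mult_mono) auto
    then have "\<bar>\<kappa> k x\<bar> * \<bar>\<phi> x - \<phi> (R x)\<bar> \<le> (real k / (1 + (real k * height x)\<^sup>2) * 1) * (L * \<bar>height x\<bar>)"
      using q by (intro mult_mono L) auto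
    then show ?thesis by (simp add: abs_mult power_mult_distrib mult_ac)
  qed
  have l3: "(\<lambda>k. \<integral>x. u x * (\<kappa> k x * (\<phi> x - \<phi> (R x))) \<partial>lebesgue_on \<Omega>) \<longlonglongrightarrow> (\<integral>x. 0 \<partial>lebesgue_on \<Omega>)"
  proof (rule integral_dominated_convergence[where w="\<lambda>x. L * \<bar>u x\<bar>"])
    show "AE x in lebesgue_on \<Omega>. (\<lambda>k. u x * (\<kappa> k x * (\<phi> x - \<phi> (R x)))) \<longlonglongrightarrow> 0"
      using AE_height
    proof eventually_elim
      case (elim x)
      have a: "\<bar>height x\<bar> > 0" using elim by simp
      have "((\<lambda>y::real. y / (1 + y\<^sup>2)) \<longlongrightarrow> 0) at_top" by real_asymp
      moreover have "filterlim (\<lambda>k. real k * \<bar>height x\<bar>) at_top sequentially"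
        using filterlim_tendsto_pos_mult_at_top[OF tendsto_const a filterlim_real_sequentially] by (simp add: mult.commute)
      ultimately have "(\<lambda>k. real k * \<bar>height x\<bar> / (1 + (real k * \<bar>height x\<bar>)\<^sup>2)) \<longlonglongrightarrow> 0" by (rule filterlim_compose)
      from tendsto_mult[OF tendsto_const this, of L]
      have lim0: "(\<lambda>k. L * (real k * \<bar>height x\<bar> / (1 + (real k * \<bar>height x\<bar>)\<^sup>2))) \<longlonglongrightarrow> 0" by simp
      have "(\<lambda>k. \<kappa> k x * (\<phi> x - \<phi> (R x))) \<longlonglongrightarrow> 0"
        by (rule Lim_null_comparison[OF always_eventually lim0]) (unfold real_norm_def, rule allI, rule \<kappa>2)
      from tendsto_mult[OF tendsto_const this, of "u x"] show ?case by simp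
    qed
    have "\<bar>\<kappa> k x * (\<phi> x - \<phi> (R x))\<bar> \<le> L" for k x
    proof -
      have "y / (1 + y\<^sup>2) \<le> 1" for y :: real
      proof -
        have "0 \<le> (y - 1)\<^sup>2" by simp
        then have "2 * y \<le> 1 + y\<^sup>2" by (simp add: power2_diff)
        moreover have "0 < 1 + y\<^sup>2" by (metis add_pos_nonneg zero_le_power2 zero_less_one)
        ultimately show ?thesis by (simp add: divide_le_eq)
      qed
      from mult_left_mono[OF this L(2)] show ?thesis using \<kappa>2[of k x] by (smt (verit) mult.right_neutral)
    qed
    then have "\<bar>u x * (\<kappa> k x * (\<phi> x - \<phi> (R x)))\<bar> \<le> \<bar>u x\<bar> * L" for k x
      unfolding abs_mult[of "u x"] by (intro mult_left_mono) auto
    then show "AE x in lebesgue_on \<Omega>. norm (u x * (\<kappa> k x * (\<phi> x - \<phi> (R x)))) \<le> L * \<bar>u x\<bar>" for k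
      by (simp add: mult.commute)
    show "(\<lambda>x. u x * (\<kappa> k x * (\<phi> x - \<phi> (R x)))) \<in> borel_measurable (lebesgue_on \<Omega>)" for k
      by (rule borel_measurable_times[OF um bl]) measurable
    show "integrable (lebesgue_on \<Omega>) (\<lambda>x. L * \<bar>u x\<bar>)" using ui by simp
  qed simp
  have "(\<lambda>k. (\<integral>x. u x * (cutoff (real k) x * \<phi>i x) \<partial>lebesgue_on \<Omega>) + (\<integral>x. u x * (\<kappa> k x * (\<phi> x - \<phi> (R x))) \<partial>lebesgue_on \<Omega>) / 2)
      \<longlonglongrightarrow> (\<integral>x. u x * (indicator half x * \<phi>i x) \<partial>lebesgue_on \<Omega>) + (\<integral>x. 0 \<partial>lebesgue_on \<Omega>) / 2"
    by (intro tendsto_intros l1 l3) simp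
  from LIMSEQ_unique[OF this[unfolded id] tendsto_minus[OF l2]]
  show "(\<integral>x. indicator half x * u x * frechet_derivative \<phi> (at x) (axis i 1) \<partial>lebesgue_on \<Omega>) = - (\<integral>x. (indicator half x *\<^sub>R g x) $ i * \<phi> x \<partial>lebesgue_on \<Omega>)"
    by (simp add: \<phi>i_def mult_ac)
qed

end

section \<open>Antisymmetric functions are not minimizers\<close>

context R2_domain
begin

text \<open>The constant function 1 has weak gradient 0, so partial derivatives of test functions
  have integral 0 and subtracting \<open>c\<close> leaves the defining identity intact.\<close>

lemma weak_gradient_diff_const:
  assumes wg: "weak_gradient \<Omega> u g" and ui: "integrable (lebesgue_on \<Omega>) u"
  shows "weak_gradient \<Omega> (\<lambda>x. u x - c) g"
  unfolding weak_gradient_def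
proof (intro conjI allI impI)
  show "integrable (lebesgue_on \<Omega>) (\<lambda>x. (g x $ i)\<^sup>2)" for i by (rule weak_gradientD(4)[OF wg])
  show "g \<in> borel_measurable (lebesgue_on \<Omega>)" by (rule weak_gradientD(2)[OF wg])
  fix \<phi> i assume t: "test_function \<Omega> \<phi>"
  let ?d = "\<lambda>x. frechet_derivative \<phi> (at x) (axis i 1)"
  obtain B where B: "\<And>x. \<bar>?d x\<bar> \<le> B" "?d \<in> borel_measurable borel"
    apply (rule test_function_bounded[OF t, of "axis i 1"])
    subgoal premises p for B by (rule that[OF p(3,5)]) done
  have "weak_gradient \<Omega> (\<lambda>x. 1) (\<lambda>x. \<chi> i. 0)"
    using weak_gradient_C1[of "\<lambda>_. 1" "\<lambda>_ _. 0"] by simp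
  then have z: "(\<integral>x. ?d x \<partial>lebesgue_on \<Omega>) = 0" using t by (simp add: weak_gradient_def)
  have i1: "integrable (lebesgue_on \<Omega>) (\<lambda>x. u x * ?d x)" 
    by (rule integrable_mult_bounded[OF ui borel_measurable_lebesgue_on[OF B(2)] B(1)])
  have i2: "integrable (lebesgue_on \<Omega>) (\<lambda>x. 1 * ?d x)"
    by (rule integrable_mult_bounded[OF _ borel_measurable_lebesgue_on[OF B(2)] B(1)]) simp
  have "(\<integral>x. (u x - c) * ?d x \<partial>lebesgue_on \<Omega>) = (\<integral>x. u x * ?d x - c * (1 * ?d x) \<partial>lebesgue_on \<Omega>)"
    by (simp add: left_diff_distrib)
  also have "\<dots> = (\<integral>x. u x * ?d x \<partial>lebesgue_on \<Omega>) - c * (\<integral>x. ?d x \<partial>lebesgue_on \<Omega>)"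
    using i1 i2 by simp
  also have "\<dots> = - (\<integral>x. (g x $ i) * \<phi> x \<partial>lebesgue_on \<Omega>)" using wg t z by (simp add: weak_gradient_def)
  finally show "(\<integral>x. (u x - c) * ?d x \<partial>lebesgue_on \<Omega>) = - (\<integral>x. (g x $ i) * \<phi> x \<partial>lebesgue_on \<Omega>)" .
qed

lemma measure_dom_pos: "\<Omega> \<noteq> {} \<Longrightarrow> measure lebesgue \<Omega> > 0"
  using open_not_negligible[OF open_dom] dom_lmeasurable by (metis negligible_iff_measure zero_less_measure_iff)

end

text \<open>The real exponent is dominated by an even integer \<open>2 * N\<close>, to which the
  Sobolev bound applies; the shift by \<open>m\<close> is absorbed since constants are integrable on
  a bounded domain.\<close>

lemma powr_integrable:
  assumes dom: "smooth_bounded_domain \<Omega>" and H: "H1_pair \<Omega> u g" and p: "p > 0"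
  shows "integrable (lebesgue_on \<Omega>) (\<lambda>x. \<bar>u x\<bar> powr p)"
proof -
  interpret R2_domain \<Omega> by (rule smooth_bounded_domain_R2[OF dom])
  obtain N :: nat where N: "p \<le> real N" using real_arch_simple by blast
  then have N0: "N > 0" using p by (cases N) auto
  have um: "u \<in> borel_measurable (lebesgue_on \<Omega>)" using H by (simp add: H1_pair_def)
  obtain m where m: "integrable (lebesgue_on \<Omega>) (\<lambda>x. (u x - m) ^ (2 * N))"
    using poincare_sobolev[OF dom N0] H by metis
  show ?thesis
  proof (rule Bochner_Integration.integrable_bound)
    show "integrable (lebesgue_on \<Omega>) (\<lambda>x. 1 + 2 ^ (2 * N) * ((u x - m) ^ (2 * N) + m ^ (2 * N)))"
      using m by (intro Bochner_Integration.integrable_add integrable_mult_right) auto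
    show "(\<lambda>x. \<bar>u x\<bar> powr p) \<in> borel_measurable (lebesgue_on \<Omega>)" using um by simp
    have "\<bar>u x\<bar> powr p \<le> 1 + 2 ^ (2 * N) * ((u x - m) ^ (2 * N) + m ^ (2 * N))" for x
    proof -
      have "\<bar>u x\<bar> powr p \<le> 1 + \<bar>u x\<bar> ^ (2 * N)"
      proof (cases "\<bar>u x\<bar> \<le> 1")
        case True
        then have "\<bar>u x\<bar> powr p \<le> 1 powr p" using p by (intro powr_mono2) auto
        then show ?thesis by (simp add: add_increasing2)
      next
        case False
        then have "\<bar>u x\<bar> powr p \<le> \<bar>u x\<bar> powr real (2 * N)" using N by (intro powr_mono) auto
        also have "\<dots> = \<bar>u x\<bar> ^ (2 * N)" using False by (intro powr_realpow) auto
        finally show ?thesis by simp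
      qed
      also have "\<bar>u x\<bar> ^ (2 * N) \<le> (\<bar>u x - m\<bar> + \<bar>m\<bar>) ^ (2 * N)" by (intro power_mono) auto
      also have "\<dots> \<le> (\<bar>u x - m\<bar> / (1 - 1/2)) ^ (2 * N) + (\<bar>m\<bar> / (1/2)) ^ (2 * N)"
        by (intro add_power_le_weighted) auto
      also have "\<dots> = 2 ^ (2 * N) * ((u x - m) ^ (2 * N) + m ^ (2 * N))"
        by (simp add: power_mult_distrib power_even_abs distrib_left)
      finally show ?thesis by simp
    qed
    then show "AE x in lebesgue_on \<Omega>. norm (\<bar>u x\<bar> powr p) \<le> norm (1 + 2 ^ (2 * N) * ((u x - m) ^ (2 * N) + m ^ (2 * N)))"
      by (auto intro: order_trans[OF _ abs_ge_self])
  qed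
qed

text \<open>For a function of mean 0, subtracting a constant can only increase the integral of the
  square, so the unknown \<open>m\<close> of \<open>poincare_sobolev\<close> may be dropped.\<close>

lemma poincare_mean_zero:
  assumes dom: "smooth_bounded_domain \<Omega>"
  obtains C where "C \<ge> 0" "\<And>u g. H1_pair \<Omega> u g \<Longrightarrow> integrable (lebesgue_on \<Omega>) u \<Longrightarrow> (\<integral>x. u x \<partial>lebesgue_on \<Omega>) = 0 \<Longrightarrow>
    (\<integral>x. (u x)\<^sup>2 \<partial>lebesgue_on \<Omega>) \<le> C * energy \<Omega> g"
proof -
  interpret R2_domain \<Omega> by (rule smooth_bounded_domain_R2[OF dom])
  obtain C where C: "C \<ge> 0" "\<And>u g. H1_pair \<Omega> u g \<Longrightarrow> \<exists>m. integrable (lebesgue_on \<Omega>) (\<lambda>x. (u x - m) ^ (2 * 1)) \<and>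
     (\<integral>x. (u x - m) ^ (2 * 1) \<partial>lebesgue_on \<Omega>) \<le> C * energy \<Omega> g ^ 1"
    using poincare_sobolev[OF dom zero_less_one] by metis
  show ?thesis
  proof (rule that[OF C(1)])
    fix u g assume H: "H1_pair \<Omega> u g" and ui: "integrable (lebesgue_on \<Omega>) u" and u0: "(\<integral>x. u x \<partial>lebesgue_on \<Omega>) = 0"
    obtain m where m: "(\<integral>x. (u x - m)\<^sup>2 \<partial>lebesgue_on \<Omega>) \<le> C * energy \<Omega> g" using C(2)[OF H] by auto
    have u2: "integrable (lebesgue_on \<Omega>) (\<lambda>x. (u x)\<^sup>2)" using H by (simp add: H1_pair_def)
    have "(\<lambda>x. (u x - m)\<^sup>2) = (\<lambda>x. (u x)\<^sup>2 - 2 * m * u x + m\<^sup>2)" by (auto simp: power2_diff)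
    then have "(\<integral>x. (u x - m)\<^sup>2 \<partial>lebesgue_on \<Omega>) = (\<integral>x. (u x)\<^sup>2 \<partial>lebesgue_on \<Omega>) + m\<^sup>2 * measure (lebesgue_on \<Omega>) \<Omega>"
      using u2 ui u0 by simp
    then show "(\<integral>x. (u x)\<^sup>2 \<partial>lebesgue_on \<Omega>) \<le> C * energy \<Omega> g" using m by (smt (verit) measure_nonneg mult_nonneg_nonneg zero_le_power2)
  qed
qed

text \<open>The factors are the reciprocals of the weights \<open>3/4\<close> and
  \<open>1/4\<close>. Equal weights would put 2 in front of the main term; \<open>4/3\<close> lies
  below \<open>sqrt 2\<close>, as is needed for \<open>(4/3) powr p * 2 powr (- p / 2)\<close> to
  tend to 0.\<close>

lemma abs_powr_le_weighted:
  fixes x y p :: real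
  assumes "p > 0"
  shows "\<bar>x + y\<bar> powr p \<le> (4/3) powr p * \<bar>x\<bar> powr p + 4 powr p * \<bar>y\<bar> powr p"
proof (cases "\<bar>x\<bar> \<ge> 3/4 * \<bar>x + y\<bar>")
  case True
  then have "\<bar>x + y\<bar> powr p \<le> (4/3 * \<bar>x\<bar>) powr p" using assms by (intro powr_mono2) auto
  also have "\<dots> = (4/3) powr p * \<bar>x\<bar> powr p" by (rule powr_mult)
  finally show ?thesis by (simp add: add_increasing2)
next
  case False
  moreover have "T \<le> 4 * Y" if "\<not> 3/4 * T \<le> X" "T \<le> X + Y" for T X Y :: real using that by linarith
  ultimately have "\<bar>x + y\<bar> \<le> 4 * \<bar>y\<bar>" using abs_triangle_ineq by blast
  then have "\<bar>x + y\<bar> powr p \<le> (4 * \<bar>y\<bar>) powr p" using assms by (intro powr_mono2) auto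
  also have "\<dots> = 4 powr p * \<bar>y\<bar> powr p" by (simp add: powr_mult)
  finally show ?thesis by (simp add: add_increasing)
qed

lemma Hza_nonzeroE:
  assumes "u \<in> Hza_nonzero \<Omega>"
  obtains g where "H1_pair \<Omega> u g" "integrable (lebesgue_on \<Omega>) u" "(\<integral>x. u x \<partial>lebesgue_on \<Omega>) = 0" "\<not> (AE x in lebesgue_on \<Omega>. u x = 0)"
  using assms by (auto simp: Hza_nonzero_def Hza_def H1_def H1_pair_def)

context reflected_domain
begin

text \<open>\<open>halfE\<close> says that the side singled out by \<open>n\<close> is the good one;
  the sign of the normal is chosen where the lemma is applied. \<open>large\<close> is the numerical
  inequality that contradicts the final estimate of \<open>I / 2\<close>.\<close>

lemma antisymmetric_not_minimizer:
  assumes dom: "smooth_bounded_domain \<Omega>" and p: "p > 1"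
    and C: "C \<ge> 0" "\<And>u g. H1_pair \<Omega> u g \<Longrightarrow> integrable (lebesgue_on \<Omega>) u \<Longrightarrow> (\<integral>x. u x \<partial>lebesgue_on \<Omega>) = 0 \<Longrightarrow>
      (\<integral>x. (u x)\<^sup>2 \<partial>lebesgue_on \<Omega>) \<le> C * energy \<Omega> g"
    and small: "C * Lambda_p p \<Omega> \<le> measure lebesgue \<Omega> / 64"
    and large: "(4 / 3) powr p * 2 powr (- p / 2) + measure lebesgue \<Omega> * (1/2) powr p < 1/2"
    and u: "is_minimizer p \<Omega> u" and anti: "antisymmetric_wrt \<Omega> R u"
    and H: "H1_pair \<Omega> u g" and halfE: "energy \<Omega> (\<lambda>x. indicator half x *\<^sub>R g x) \<le> energy \<Omega> g / 2"
  shows False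
proof -
  let ?M = "lebesgue_on \<Omega>"
  define \<mu> where "\<mu> = measure lebesgue \<Omega>"
  have \<mu>: "\<mu> > 0" unfolding \<mu>_def using dom by (intro measure_dom_pos) (simp add: smooth_bounded_domain_def)
  have \<mu>M: "measure ?M \<Omega> = \<mu>" by (simp add: \<mu>_def measure_restrict_space)
  have uH: "u \<in> Hza_nonzero \<Omega>" and umin: "grad_norm_sq \<Omega> u / (Lp_norm p \<Omega> u)\<^sup>2 = Lambda_p p \<Omega>"
    using u by (auto simp: is_minimizer_def)
  have ui: "integrable ?M u" and u0: "(\<integral>x. u x \<partial>?M) = 0" and unz: "\<not> (AE x in ?M. u x = 0)"
    using uH by (auto simp: Hza_nonzero_def Hza_def)
  have um: "u \<in> borel_measurable ?M" and u2: "integrable ?M (\<lambda>x. (u x)\<^sup>2)" and wg: "weak_gradient \<Omega> u g"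
    using H by (auto simp: H1_pair_def)
  define E where "E = energy \<Omega> g"
  have E: "grad_norm_sq \<Omega> u = E" unfolding E_def by (rule grad_norm_sq_eq_energy[OF dom wg])
  have up: "integrable ?M (\<lambda>x. \<bar>u x\<bar> powr p)" using p by (intro powr_integrable[OF dom H]) simp
  define I where "I = (\<integral>x. \<bar>u x\<bar> powr p \<partial>?M)"
  \<comment> \<open>Integrability of the power makes a vanishing integral force \<open>u = 0\<close>
    a.e.\<close>
  have I: "I > 0"
  proof -
    have "I \<noteq> 0"
    proof
      assume "I = 0"
      then have "AE x in ?M. \<bar>u x\<bar> powr p = 0" using integral_nonneg_eq_0_iff_AE[OF up] by (simp add: I_def)
      then have "AE x in ?M. u x = 0" by eventually_elim simp
      then show False using unz by simp
    qed
    moreover have "I \<ge> 0" by (simp add: I_def)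
    ultimately show ?thesis by simp
  qed
  have PE: "(\<integral>x. (u x)\<^sup>2 \<partial>?M) \<le> C * E" unfolding E_def by (rule C(2)[OF H ui u0])
  have E0: "E > 0"
  proof -
    have "E \<noteq> 0"
    proof
      assume "E = 0"
      then have "(\<integral>x. (u x)\<^sup>2 \<partial>?M) \<le> 0" using PE by simp
      moreover have "(\<integral>x. (u x)\<^sup>2 \<partial>?M) \<ge> 0" by simp
      ultimately have "(\<integral>x. (u x)\<^sup>2 \<partial>?M) = 0" by linarith
      then have "AE x in ?M. (u x)\<^sup>2 = 0" using integral_nonneg_eq_0_iff_AE[OF u2] by simp
      then have "AE x in ?M. u x = 0" by eventually_elim simp
      then show False using unz by simp
    qed
    then show ?thesis using energy_nonneg[of \<Omega> g] by (simp add: E_def)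
  qed
  have N2: "(Lp_norm p \<Omega> f)\<^sup>2 = (\<integral>x. \<bar>f x\<bar> powr p \<partial>?M) powr (2 / p)" for f
    by (simp add: Lp_norm_def power2_eq_square flip: powr_add)
  have Lam: "Lambda_p p \<Omega> = E / I powr (2 / p)" using umin unfolding E N2 I_def by simp
  define v where "v x = indicator half x * u x" for x
  define c where "c = (\<integral>x. v x \<partial>?M) / \<mu>"
  define w where "w x = v x - c" for x
  define gw where "gw x = indicator half x *\<^sub>R g x" for x
  have vi: "integrable ?M v"
    using integrable_mult_bounded[OF ui indicator_half_measurable, of 1] by (simp add: v_def[abs_def] mult.commute indicator_def)
  have v2: "integrable ?M (\<lambda>x. (v x)\<^sup>2)"
  proof -
    have "(\<lambda>x. (v x)\<^sup>2) = (\<lambda>x. (u x)\<^sup>2 * indicator half x)" by (auto simp: v_def indicator_def)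
    then show ?thesis using integrable_mult_bounded[OF u2 indicator_half_measurable, of 1] by (simp add: indicator_def)
  qed
  have vg: "weak_gradient \<Omega> v gw" unfolding v_def[abs_def] gw_def[abs_def] by (rule weak_gradient_half[OF H anti])
  have wg: "weak_gradient \<Omega> w gw" unfolding w_def[abs_def] by (rule weak_gradient_diff_const[OF vg vi])
  have wi: "integrable ?M w" unfolding w_def[abs_def] using vi by simp
  have w2: "integrable ?M (\<lambda>x. (w x)\<^sup>2)"
  proof -
    have "(\<lambda>x. (w x)\<^sup>2) = (\<lambda>x. (v x)\<^sup>2 - 2 * c * v x + c\<^sup>2)" by (auto simp: w_def power2_diff)
    then show ?thesis using v2 vi by simp
  qed
  have w0: "(\<integral>x. w x \<partial>?M) = 0" unfolding w_def using vi \<mu> \<mu>M by (simp add: c_def)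
  have Hw: "H1_pair \<Omega> w gw" using wi w2 wg by (simp add: H1_pair_def)
  have wp: "integrable ?M (\<lambda>x. \<bar>w x\<bar> powr p)" using p by (intro powr_integrable[OF dom Hw]) simp
  define J where "J = (\<integral>x. \<bar>w x\<bar> powr p \<partial>?M)"
  have J0: "J \<ge> 0" by (simp add: J_def)
  have Ew: "grad_norm_sq \<Omega> w \<le> E / 2"
    using halfE grad_norm_sq_eq_energy[OF dom wg] by (simp add: gw_def[abs_def] E_def)
  \<comment> \<open>Minimality tested with \<open>w\<close>: halving the energy gives
    \<open>J powr (2/p) \<le> I powr (2/p) / 2\<close>, which is raised to the power
    \<open>p/2\<close>. The case \<open>J = 0\<close>, where the quotient would be a division by
    zero, satisfies the bound trivially.\<close>
  have JI: "J \<le> 2 powr (- p / 2) * I"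
  proof (cases "J = 0")
    case True
    then show ?thesis using I by simp
  next
    case False
    have "\<not> (AE x in ?M. w x = 0)"
    proof
      assume "AE x in ?M. w x = 0"
      then have "J = 0" unfolding J_def by (intro integral_eq_zero_AE) (auto elim!: eventually_mono)
      with False show False by simp
    qed
    then have "w \<in> Hza_nonzero \<Omega>"
      using wi w2 wg w0 by (auto simp: Hza_nonzero_def Hza_def H1_def)
    from Lambda_p_le[OF this, of p] have "E / I powr (2 / p) \<le> grad_norm_sq \<Omega> w / J powr (2 / p)"
      unfolding Lam N2 J_def .
    also have "\<dots> \<le> (E / 2) / J powr (2 / p)" using Ew by (intro divide_right_mono) auto
    finally have "E / I powr (2 / p) \<le> (E / 2) / J powr (2 / p)" .
    then have "J powr (2 / p) \<le> I powr (2 / p) / 2"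
      using E0 I False J0 by (simp add: field_simps)
    then have "(J powr (2 / p)) powr (p / 2) \<le> (I powr (2 / p) / 2) powr (p / 2)" using p by (intro powr_mono2) auto
    then show ?thesis using p I J0 False by (simp add: powr_powr powr_divide powr_minus_divide mult.commute)
  qed
  \<comment> \<open>Poincare and minimality bound the mean by \<open>1/8\<close> of the norm of
    \<open>u\<close>, the 8 being the root of the 64 in \<open>small\<close>. Multiplied by the
    factor \<open>4 powr p\<close> of the splitting, \<open>(1/2) powr p\<close> remains.\<close>
  have cI: "\<bar>c\<bar> powr p \<le> (1/8) powr p * I"
  proof -
    have "(\<integral>x. v x * 1 \<partial>?M)\<^sup>2 \<le> (\<integral>x. (v x)\<^sup>2 \<partial>?M) * (\<integral>x. 1\<^sup>2 \<partial>?M)"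
      by (rule integral_square_le[OF v2]) (use vi in auto)
    also have "(\<integral>x. 1\<^sup>2 \<partial>?M) = \<mu>" using \<mu>M by simp
    also have "(\<integral>x. (v x)\<^sup>2 \<partial>?M) \<le> (\<integral>x. (u x)\<^sup>2 \<partial>?M)" by (rule integral_mono[OF v2 u2]) (auto simp: v_def indicator_def)
    also have "\<dots> \<le> C * E" by (rule PE)
    also have "C * E = C * Lambda_p p \<Omega> * I powr (2 / p)" using I by (simp add: Lam)
    also have "\<dots> \<le> \<mu> / 64 * I powr (2 / p)" using small by (intro mult_right_mono) (auto simp: \<mu>_def)
    finally have "(c * \<mu>)\<^sup>2 \<le> \<mu> / 64 * I powr (2 / p) * \<mu>" using \<mu> by (simp add: c_def)
    then have "c\<^sup>2 \<le> I powr (2 / p) / 64" using \<mu> by (simp add: power_mult_distrib power2_eq_square field_simps)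
    also have "\<dots> = (I powr (1 / p) / 8)\<^sup>2" by (simp add: power2_eq_square flip: powr_add)
    finally have "\<bar>c\<bar> \<le> I powr (1 / p) / 8" by (simp add: abs_le_square_iff[of c "I powr (1 / p) / 8", symmetric])
    then have "\<bar>c\<bar> powr p \<le> (I powr (1 / p) / 8) powr p" using p by (intro powr_mono2) auto
    then show ?thesis using p I by (simp add: powr_divide powr_powr)
  qed
  have "I / 2 = (\<integral>x. \<bar>v x\<bar> powr p \<partial>?M)"
    unfolding v_def I_def by (rule antisymmetric_half_powr[OF um anti up, symmetric])
  also have "\<dots> \<le> (\<integral>x. (4/3) powr p * \<bar>w x\<bar> powr p + 4 powr p * \<bar>c\<bar> powr p \<partial>?M)"
  proof (rule integral_mono')
    show "integrable ?M (\<lambda>x. (4/3) powr p * \<bar>w x\<bar> powr p + 4 powr p * \<bar>c\<bar> powr p)" using wp by simp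
    show "\<bar>v x\<bar> powr p \<le> (4/3) powr p * \<bar>w x\<bar> powr p + 4 powr p * \<bar>c\<bar> powr p" for x
      using abs_powr_le_weighted[of p "w x" c] p by (simp add: w_def)
  qed simp
  also have "\<dots> = (4/3) powr p * J + 4 powr p * \<bar>c\<bar> powr p * \<mu>" using wp \<mu>M by (simp add: J_def)
  also have "\<dots> \<le> (4/3) powr p * (2 powr (- p / 2) * I) + 4 powr p * ((1/8) powr p * I) * \<mu>"
    using JI cI \<mu> by (intro add_mono mult_left_mono mult_right_mono) auto
  also have "4 powr p * ((1/8) powr p * I) * \<mu> = \<mu> * (1/2) powr p * I"
    by (simp add: powr_mult[symmetric] flip: mult.assoc)
  also have "(4/3) powr p * (2 powr (- p / 2) * I) + \<mu> * (1/2) powr p * I = ((4/3) powr p * 2 powr (- p / 2) + \<mu> * (1/2) powr p) * I"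
    by (simp add: algebra_simps)
  also have "\<dots> < (1/2) * I" using large I by (intro mult_strict_right_mono) (auto simp: \<mu>_def)
  finally show False by simp
qed

end

theorem theorem7p4:
  fixes \<Omega> :: "(real ^ 2) set" and a n :: "real ^ 2"
  assumes "smooth_bounded_domain \<Omega>"
    and "norm n = 1"
    and "reflection a n ` \<Omega> = \<Omega>"
  shows "\<exists>p0. \<forall>p > p0. \<forall>u. is_minimizer p \<Omega> u \<longrightarrow> \<not> antisymmetric_wrt \<Omega> (reflection a n) u"
proof -
  note dom = assms(1)
  interpret pos: reflected_domain \<Omega> a n
    by (intro reflected_domain.intro reflected_domain_axioms.intro smooth_bounded_domain_R2 assms)
  interpret neg: reflected_domain \<Omega> a "- n"
    by (intro reflected_domain.intro reflected_domain_axioms.intro smooth_bounded_domain_R2) (simp_all add: assms reflection_minus)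
  define \<mu> where "\<mu> = measure lebesgue \<Omega>"
  have \<mu>: "\<mu> > 0" unfolding \<mu>_def using dom by (intro pos.measure_dom_pos) (simp add: smooth_bounded_domain_def)
  obtain C where C: "C \<ge> 0" "\<And>u g. H1_pair \<Omega> u g \<Longrightarrow> integrable (lebesgue_on \<Omega>) u \<Longrightarrow> (\<integral>x. u x \<partial>lebesgue_on \<Omega>) = 0 \<Longrightarrow>
      (\<integral>x. (u x)\<^sup>2 \<partial>lebesgue_on \<Omega>) \<le> C * energy \<Omega> g"
    apply (rule poincare_mean_zero[OF dom])
    subgoal premises p for C by (rule that[OF p(2-)]) done
  \<comment> \<open>\<open>C + 1\<close> takes the place of \<open>C\<close>, which may be
    0.\<close>
  have "\<mu> / (64 * (C + 1)) > 0" using \<mu> C(1) by simp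
  then obtain p1 where p1: "\<And>p. p > p1 \<Longrightarrow> Lambda_p p \<Omega> \<le> \<mu> / (64 * (C + 1))" using Lambda_p_small[OF dom] by metis
  have "((\<lambda>p. (4/3) powr p * 2 powr (- p / 2) + \<mu> * (1/2) powr p) \<longlongrightarrow> 0) at_top"
  proof -
    have "(4/3) powr p * 2 powr (- p / 2) = (8/9) powr (p / 2)" for p :: real
    proof -
      have "(4/3) powr p = ((4/3) powr 2) powr (p / 2)" by (simp only: powr_powr) simp
      also have "(4/3 :: real) powr 2 = 16/9" by (simp add: power2_eq_square)
      finally have "(4/3) powr p = (16/9) powr (p / 2)" .
      moreover have "(2::real) powr (- p / 2) = (1/2) powr (p / 2)" by (simp add: powr_minus_divide powr_divide)
      ultimately show ?thesis by (simp flip: powr_mult)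
    qed
    moreover have "((\<lambda>p::real. (8/9) powr (p / 2)) \<longlongrightarrow> 0) at_top" "((\<lambda>p::real. (1/2) powr p) \<longlongrightarrow> 0) at_top"
      by real_asymp+
    from tendsto_add[OF this(1) tendsto_mult[OF tendsto_const this(2), of \<mu>]]
    have "((\<lambda>p. (8/9) powr (p / 2) + \<mu> * (1/2) powr p) \<longlongrightarrow> 0) at_top" by simp
    ultimately show ?thesis by simp
  qed
  then have "\<forall>\<^sub>F p in at_top. (4/3) powr p * 2 powr (- p / 2) + \<mu> * (1/2) powr p < 1/2"
    by (rule order_tendstoD) simp
  then obtain p2 where p2: "\<And>p. p \<ge> p2 \<Longrightarrow> (4/3) powr p * 2 powr (- p / 2) + \<mu> * (1/2) powr p < 1/2"
    unfolding eventually_at_top_linorder by auto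
  show ?thesis
  proof (intro exI[of _ "max 1 (max p1 p2)"] allI impI notI)
    fix p u assume p: "p > max 1 (max p1 p2)" and u: "is_minimizer p \<Omega> u" and anti: "antisymmetric_wrt \<Omega> (reflection a n) u"
    obtain g where g: "H1_pair \<Omega> u g" using u Hza_nonzeroE unfolding is_minimizer_def by metis
    have wg: "weak_gradient \<Omega> u g" using g by (simp add: H1_pair_def)
    have small: "C * Lambda_p p \<Omega> \<le> measure lebesgue \<Omega> / 64"
    proof -
      have "C * Lambda_p p \<Omega> \<le> C * (\<mu> / (64 * (C + 1)))" using p1[of p] p C(1) by (intro mult_left_mono) auto
      also have "\<dots> \<le> \<mu> / 64" using C(1) \<mu> by (simp add: field_simps)
      finally show ?thesis by (simp add: \<mu>_def)
    qed
    have large: "(4/3) powr p * 2 powr (- p / 2) + measure lebesgue \<Omega> * (1/2) powr p < 1/2"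
      using p2[of p] p by (simp add: \<mu>_def)
    have hn: "neg.half = {x. pos.height x < 0}" by (simp add: neg.half_def neg.height_def pos.height_def)
    have i: "integrable (lebesgue_on \<Omega>) (\<lambda>x. (norm (indicator A x *\<^sub>R g x))\<^sup>2)" if "A \<in> sets borel" for A
    proof -
      have "(\<lambda>x. (norm (indicator A x *\<^sub>R g x))\<^sup>2) = (\<lambda>x. (norm (g x))\<^sup>2 * indicator A x)" by (auto simp: indicator_def)
      moreover have "integrable (lebesgue_on \<Omega>) (\<lambda>x. (norm (g x))\<^sup>2 * indicat_real A x)"
        by (rule integrable_mult_bounded[OF weak_gradientD(1)[OF wg] borel_measurable_lebesgue_on, of _ 1]) (use that in \<open>auto simp: indicator_def\<close>)
      ultimately show ?thesis by simp
    qed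
    have "energy \<Omega> (\<lambda>x. indicator pos.half x *\<^sub>R g x) + energy \<Omega> (\<lambda>x. indicator neg.half x *\<^sub>R g x)
        = (\<integral>x. (norm (indicator pos.half x *\<^sub>R g x))\<^sup>2 + (norm (indicator neg.half x *\<^sub>R g x))\<^sup>2 \<partial>lebesgue_on \<Omega>)"
      unfolding energy_def by (rule Bochner_Integration.integral_add[OF i[OF pos.half_borel] i[OF neg.half_borel], symmetric])
    also have "\<dots> \<le> energy \<Omega> g"
      unfolding energy_def
      by (rule integral_mono'[OF weak_gradientD(1)[OF wg]]) (auto simp: indicator_def hn pos.half_def)
    finally have "energy \<Omega> (\<lambda>x. indicator pos.half x *\<^sub>R g x) \<le> energy \<Omega> g / 2 \<or> energy \<Omega> (\<lambda>x. indicator neg.half x *\<^sub>R g x) \<le> energy \<Omega> g / 2"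
      by linarith
    then show False
    proof
      assume h: "energy \<Omega> (\<lambda>x. indicator pos.half x *\<^sub>R g x) \<le> energy \<Omega> g / 2"
      show False
        by (rule pos.antisymmetric_not_minimizer[OF dom _ C small large u anti g h]) (use p in auto)
    next
      assume h: "energy \<Omega> (\<lambda>x. indicator neg.half x *\<^sub>R g x) \<le> energy \<Omega> g / 2"
      show False
        by (rule neg.antisymmetric_not_minimizer[OF dom _ C small large u _ g h]) (use p anti in \<open>auto simp: reflection_minus\<close>)
    qed
  qed
qed

end
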